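(* Let $n\geq 1$ and let $\sigma\in S_n$ be a permutation. Then the Bruhat graph $\mathcal{B}(\sigma)$ is toroidal if and only if all three of the following conditions hold: (i) $\sigma$ avoids $3412$; (ii) if $\sigma$ contains $321$, then $\ell(\sigma)=3$; (iii) $\ell(\sigma)\leq 4$.
   Context: Permutations are written in one-line notation. The length $\ell(\pi)$ of $\pi\in S_n$ is the minimum number of adjacent transpositions $(i\ i+1)$ whose product is $\pi$; equivalently, it is the number of inversions, i.e. pairs $i<j$ with $\pi(i)>\pi(j)$. For $\sigma,\tau\in S_n$ write $\sigma\prec\tau$ if $\ell(\sigma)<\ell(\tau)$ and there is a transposition $t=(i\ j)$ (not necessarily adjacent) with $\sigma=\tau t$. Bruhat order $\leq$ on $S_n$ is the reflexive transitive closure of $\prec$. The Bruhat graph of $S_n$ is the directed graph with vertex set $S_n$ and an edge $\sigma\to\tau$ whenever $\sigma\prec\tau$ (the difference $\ell(\tau)-\ell(\sigma)$ need not be $1$). For $\pi\in S_n$, the Bruhat graph $\mathcal{B}(\pi)$ is the induced subgraph on the vertices $\sigma\in S_n$ with $\sigma\leq\pi$ in Bruhat order. For $\pi\in S_k$ and $\tau\in S_n$ with $k\leq n$, $\tau$ contains $\pi$ if there are indices $1\leq i_1<\cdots<i_k\leq n$ such that for all $a,b$, $\tau(i_a)<\tau(i_b)$ if and only if $\pi(a)<\pi(b)$; otherwise (or if $k>n$) $\tau$ avoids $\pi$. A graph is toroidal if it can be drawn on the surface of a torus without edges crossing; for $\mathcal{B}(\sigma)$ this refers to the underlying undirected graph.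 (In particular planar graphs are toroidal.) *)

theory Defs
  imports
    "HOL-Analysis.Analysis"
    "HOL-Combinatorics.Permutations"
    "Graph_Theory.Graph_Theory"
begin

(* Elements of the symmetric group S_n are functions p :: nat => nat with
   p permutes {1..n}; the product is function composition. *)

(* The word i1, ..., im stands for the product (i1 i1+1) o ... o (im im+1). *)
definition adj_word :: "nat list \<Rightarrow> nat \<Rightarrow> nat" where
  "adj_word is = foldr (\<lambda>i p. Transposition.transpose i (Suc i) \<circ> p) is id"

definition perm_length :: "nat \<Rightarrow> (nat \<Rightarrow> nat) \<Rightarrow> nat" where
  "perm_length n p =
     (LEAST m. \<exists>is. length is = m \<and> set is \<subseteq> {1..<n} \<and> adj_word is = p)"

definition bruhat_step :: "nat \<Rightarrow> (nat \<Rightarrow> nat) \<Rightarrow> (nat \<Rightarrow> nat) \<Rightarrow> bool" where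
  "bruhat_step n s t \<longleftrightarrow>
     s permutes {1..n} \<and> t permutes {1..n} \<and> perm_length n s < perm_length n t \<and>
     (\<exists>i\<in>{1..n}. \<exists>j\<in>{1..n}. i \<noteq> j \<and> s = t \<circ> Transposition.transpose i j)"

definition bruhat_le :: "nat \<Rightarrow> (nat \<Rightarrow> nat) \<Rightarrow> (nat \<Rightarrow> nat) \<Rightarrow> bool" where
  "bruhat_le n = (bruhat_step n)\<^sup>*\<^sup>*"

definition bruhat_graph_Sn :: "nat \<Rightarrow> (nat \<Rightarrow> nat) pair_pre_digraph" where
  "bruhat_graph_Sn n =
     \<lparr> pverts = {p. p permutes {1..n}}, parcs = {(s, t). bruhat_step n s t} \<rparr>"

definition bruhat_graph ::
  "nat \<Rightarrow> (nat \<Rightarrow> nat) \<Rightarrow> (nat \<Rightarrow> nat, (nat \<Rightarrow> nat) \<times> (nat \<Rightarrow> nat)) pre_digraph" where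
  "bruhat_graph n p =
     induce_subgraph (with_proj (bruhat_graph_Sn n)) {s. s permutes {1..n} \<and> bruhat_le n s p}"

(* The permutation of {1..k} with one-line notation xs, where k = length xs. *)
definition one_line :: "nat list \<Rightarrow> nat \<Rightarrow> nat" where
  "one_line xs i = (if i \<in> {1..length xs} then xs ! (i - 1) else i)"

(* The permutation t of {1..n} contains the pattern p, a permutation of {1..k};
   f is the choice of indices i_1 < ... < i_k. For k > n there is no such f. *)
definition contains_pattern ::
  "nat \<Rightarrow> (nat \<Rightarrow> nat) \<Rightarrow> nat \<Rightarrow> (nat \<Rightarrow> nat) \<Rightarrow> bool" where
  "contains_pattern n t k p \<longleftrightarrow>
     (\<exists>f. strict_mono_on {1..k} f \<and> f ` {1..k} \<subseteq> {1..n} \<and>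
          (\<forall>a\<in>{1..k}. \<forall>b\<in>{1..k}. t (f a) < t (f b) \<longleftrightarrow> p a < p b))"

abbreviation avoids_pattern ::
  "nat \<Rightarrow> (nat \<Rightarrow> nat) \<Rightarrow> nat \<Rightarrow> (nat \<Rightarrow> nat) \<Rightarrow> bool" where
  "avoids_pattern n t k p \<equiv> \<not> contains_pattern n t k p"

definition torus :: "(complex \<times> complex) set" where
  "torus = sphere 0 1 \<times> sphere 0 1"

(* Edges of the underlying undirected graph, as sets of endpoints. *)
definition undirected_edges :: "('a, 'b) pre_digraph \<Rightarrow> 'a set set" where
  "undirected_edges G = {{tail G a, head G a} | a. a \<in> arcs G}"

(* A crossing-free drawing of a loop-free undirected graph (V, E) on a subset S of a
   topological space: p places the vertices and g e is a simple arc drawing the edge e.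
   An edge curve passes through no vertex other than its own endpoints, and two edge
   curves meet only in the endpoints common to the two edges. *)
definition drawing_on ::
  "'s::topological_space set \<Rightarrow> 'a set \<Rightarrow> 'a set set \<Rightarrow>
     ('a \<Rightarrow> 's) \<Rightarrow> ('a set \<Rightarrow> real \<Rightarrow> 's) \<Rightarrow> bool" where
  "drawing_on S V E p g \<longleftrightarrow>
     inj_on p V \<and> p ` V \<subseteq> S \<and>
     (\<forall>e\<in>E. arc (g e) \<and> path_image (g e) \<subseteq> S \<and>
             {pathstart (g e), pathfinish (g e)} = p ` e \<and>
             path_image (g e) \<inter> p ` V = p ` e) \<and>
     (\<forall>e\<in>E. \<forall>e'\<in>E. e \<noteq> e' \<longrightarrow>
        path_image (g e) \<inter> path_image (g e') = p ` (e \<inter> e'))"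

definition toroidal :: "('a, 'b) pre_digraph \<Rightarrow> bool" where
  "toroidal G \<longleftrightarrow> (\<exists>p g. drawing_on torus (verts G) (undirected_edges G) p g)"

end

(* A subdivided K_{3,3} drawn on the torus contains two loops whose homology classes are independent:
   otherwise it lifts to an annular cover, hence to the plane.  Disjoint loops have dependent classes
   (lift to the plane and apply Brouwer), so a theta graph disjoint from the K_{3,3} has trivial
   homology and lifts to the plane.  There one of its three arcs lies inside the cycle of the other two
   and cannot be joined to the unbounded preimage of the K_{3,3}.  Hence a graph is not toroidal if it
   contains a K_{3,3} and a disjoint theta graph whose three arcs are joined to it.

   A pattern of sigma embeds its Bruhat graph, so it suffices to find this obstruction for 3412, for
   the patterns arising from 321 and a fourth inversion, and for the 5-cube: if sigma avoids 321 and
   3412, then undoing a descent at i splits sigma at i, and by induction B(sigma) is a cube of dimension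
   l(sigma).  Conversely, the 4-cube is the product of two 4-cycles, and K_{3,3} = B(321) is a
   topological minor of it. *)

theory Submission
  imports Defs "HOL-Complex_Analysis.Winding_Numbers"
begin

text \<open>Euler's formula does not suffice: the graph of 32154 is the product of K_{3,3} with an
  edge, whose 12 vertices and 24 edges meet the bound E \<le> 2V for bipartite graphs on the torus
  with equality. Moreover, a drawing consists of arbitrary arcs, so its faces are not under control.
  This is why the argument runs through coverings, winding numbers, the Jordan curve theorem and
  Brouwer's theorem, applied only to the K_{3,3} and the theta graph.

  The same product is the model of the obstruction: one layer is the K_{3,3}, the other contains a
  K_{2,3}, and three rungs join the middle vertices of the K_{2,3} to the first layer. Up to
  subdivision this configuration occurs in every case that has a certificate, so one topological
  theorem serves all of them, and each case is reduced to explicit lists of vertices that are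
  checked by evaluation. The patterns 3421, 4312, 4231 and 4321 get no lists of their own, as they
  lie above bad ones in Bruhat order.\<close>

hide_const (open) Digraph_Component.connected

section \<open>Theta graphs in the plane\<close>

lemma simple_path_theta_cycle:
  fixes c1 c2 :: "real \<Rightarrow> 'a::real_normed_vector"
  assumes "arc c1" "pathstart c1 = u" "pathfinish c1 = v"
    and "arc c2" "pathstart c2 = u" "pathfinish c2 = v"
    and "path_image c1 \<inter> path_image c2 \<subseteq> {u, v}"
  shows "simple_path (c1 +++ reversepath c2)"
    "pathfinish (c1 +++ reversepath c2) = pathstart (c1 +++ reversepath c2)"
    "path_image (c1 +++ reversepath c2) = path_image c1 \<union> path_image c2"
  using assms by (auto simp: simple_path_join_loop_eq path_image_join arc_reversepath)

text \<open>The inside of \<open>J\<close> is a union of components of the complement of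
  \<open>J\<close>, and a connected set missing \<open>J\<close> stays within one component.\<close>

lemma connected_meets_inside_subset:
  fixes S J :: "'a::real_normed_vector set"
  assumes "connected S" "S \<inter> J = {}" "S \<inter> inside J \<noteq> {}"
  shows "S \<subseteq> inside J"
proof
  fix y assume "y \<in> S"
  obtain x where x: "x \<in> S" "x \<in> inside J" using assms by blast
  have "connected_component (- J) x y"
    unfolding connected_component_def using assms \<open>y \<in> S\<close> x by (intro exI[of _ S]) auto
  with x(2) show "y \<in> inside J" by (rule inside_same_component[rotated])
qed

text \<open>Each of the two insides misses the entire theta graph. If they met, each would contain
  the other by connectedness. Equal insides have equal frontiers, so the two Jordan curves would
  coincide and \<open>c2\<close> would consist of its two ends only.\<close>

lemma theta_insides_disjoint:
  fixes c1 c2 c3 :: "real \<Rightarrow> complex"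
  assumes c1: "arc c1" "pathstart c1 = u" "pathfinish c1 = v"
    and c2: "arc c2" "pathstart c2 = u" "pathfinish c2 = v"
    and c3: "arc c3" "pathstart c3 = u" "pathfinish c3 = v"
    and d12: "path_image c1 \<inter> path_image c2 \<subseteq> {u, v}"
    and d13: "path_image c1 \<inter> path_image c3 \<subseteq> {u, v}"
    and d23: "path_image c2 \<inter> path_image c3 \<subseteq> {u, v}"
    and n12: "path_image c3 \<inter> inside (path_image c1 \<union> path_image c2) = {}"
    and n13: "path_image c2 \<inter> inside (path_image c1 \<union> path_image c3) = {}"
  shows "inside (path_image c1 \<union> path_image c2) \<inter> inside (path_image c1 \<union> path_image c3) = {}"
proof (rule ccontr)
  assume ne: "\<not> ?thesis"
  let ?J12 = "path_image c1 \<union> path_image c2" and ?J13 = "path_image c1 \<union> path_image c3"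
  note j12 = Jordan_inside_outside[OF simple_path_theta_cycle(1,2)[OF c1 c2 d12],
      unfolded simple_path_theta_cycle(3)[OF c1 c2 d12]]
  note j13 = Jordan_inside_outside[OF simple_path_theta_cycle(1,2)[OF c1 c3 d13],
      unfolded simple_path_theta_cycle(3)[OF c1 c3 d13]]
  have "inside ?J12 \<inter> ?J13 = {}" using n12 inside_no_overlap[of ?J12] by blast
  then have "inside ?J12 \<subseteq> inside ?J13"
    using j12 ne by (intro connected_meets_inside_subset) auto
  moreover have "inside ?J13 \<inter> ?J12 = {}" using n13 inside_no_overlap[of ?J13] by blast
  then have "inside ?J13 \<subseteq> inside ?J12"
    using j13 ne by (intro connected_meets_inside_subset) auto
  ultimately have "frontier (inside ?J12) = frontier (inside ?J13)" by simp
  then have "?J12 = ?J13" using j12 j13 by metis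
  then have "path_image c2 \<subseteq> {u, v}" using d12 d23 by blast
  moreover have "infinite (path_image c2)"
  proof
    assume "finite (path_image c2)"
    then obtain x where "path_image c2 = {x}"
      using connected_finite_iff_sing[OF connected_arc_image[OF c2(1)]] by auto
    then show False
      using arc_distinct_ends[OF c2(1)] pathfinish_in_path_image[of c2] pathstart_in_path_image[of c2]
      by auto
  qed
  ultimately show False by (meson finite.intros finite_subset)
qed

text \<open>The winding numbers of the three cycles of a theta graph add up, while each of them is
  \<open>\<plusminus>1\<close> inside the cycle and \<open>0\<close> outside.  So the three insides cannot be pairwise disjoint.\<close>

lemma theta_inside:
  fixes c1 c2 c3 :: "real \<Rightarrow> complex"
  assumes c1: "arc c1" "pathstart c1 = u" "pathfinish c1 = v"
    and c2: "arc c2" "pathstart c2 = u" "pathfinish c2 = v"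
    and c3: "arc c3" "pathstart c3 = u" "pathfinish c3 = v"
    and d12: "path_image c1 \<inter> path_image c2 \<subseteq> {u, v}"
    and d13: "path_image c1 \<inter> path_image c3 \<subseteq> {u, v}"
    and d23: "path_image c2 \<inter> path_image c3 \<subseteq> {u, v}"
  shows "path_image c3 - {u, v} \<subseteq> inside (path_image c1 \<union> path_image c2)
       \<or> path_image c2 - {u, v} \<subseteq> inside (path_image c1 \<union> path_image c3)
       \<or> path_image c1 - {u, v} \<subseteq> inside (path_image c2 \<union> path_image c3)"
proof -
  \<comment> \<open>An arc without its ends is connected, so it lies inside a cycle through
    \<open>u\<close> and \<open>v\<close> as soon as it meets the inside. The negated claim
    therefore keeps every arc out of the inside of the cycle formed by the other two.\<close>
  have sub: "path_image c - {u, v} \<subseteq> inside J"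
    if "arc c" "pathstart c = u" "pathfinish c = v" "path_image c \<inter> J \<subseteq> {u, v}" "u \<in> J" "v \<in> J"
      "path_image c \<inter> inside J \<noteq> {}" for c :: "real \<Rightarrow> complex" and J
  proof (rule connected_meets_inside_subset)
    show "connected (path_image c - {u, v})"
      using that connected_simple_path_endless[of c] arc_imp_simple_path by auto
    show "(path_image c - {u, v}) \<inter> J = {}" using that by blast
    show "(path_image c - {u, v}) \<inter> inside J \<noteq> {}" using that inside_no_overlap[of J] by blast
  qed
  have uv: "u \<in> path_image c1" "v \<in> path_image c1" "u \<in> path_image c2" "v \<in> path_image c2"
     "u \<in> path_image c3" "v \<in> path_image c3"
    using c1 c2 c3 by (metis pathstart_in_path_image pathfinish_in_path_image)+
  have contra: False
    if n3: "path_image c3 \<inter> inside (path_image c1 \<union> path_image c2) = {}"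
      and n2: "path_image c2 \<inter> inside (path_image c1 \<union> path_image c3) = {}"
      and n1: "path_image c1 \<inter> inside (path_image c2 \<union> path_image c3) = {}"
  proof -
    let ?p = "c1 +++ reversepath c2"
    note sp12 = simple_path_theta_cycle[OF c1 c2 d12]
    note sp13 = simple_path_theta_cycle[OF c1 c3 d13]
    note sp23 = simple_path_theta_cycle[OF c2 c3 d23]
    obtain z where z: "z \<in> inside (path_image c1 \<union> path_image c2)"
      using Jordan_inside_outside[OF sp12(1,2)] sp12(3) by auto
    have z13: "z \<notin> inside (path_image c1 \<union> path_image c3)"
      using theta_insides_disjoint[OF c1 c2 c3 d12 d13 d23 n3 n2] z by blast
    have z23: "z \<notin> inside (path_image c2 \<union> path_image c3)"
      using theta_insides_disjoint[OF c2 c1 c3 _ d23 d13, unfolded Un_commute[of "path_image c2" "path_image c1"]]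
        n3 n1 d12 z by blast
    have z3: "z \<notin> path_image c3" using n3 z by blast
    have z12: "z \<notin> path_image c1" "z \<notin> path_image c2"
      using z inside_no_overlap[of "path_image c1 \<union> path_image c2"] by blast+
    have "z \<in> outside (path_image c1 \<union> path_image c3)"
      using z13 z3 z12 inside_Un_outside[of "path_image c1 \<union> path_image c3"] by blast
    then have w13: "winding_number (c1 +++ reversepath c3) z = 0"
      using sp13 by (intro winding_number_zero_in_outside) (auto simp: simple_path_imp_path)
    have "z \<in> outside (path_image c2 \<union> path_image c3)"
      using z23 z3 z12 inside_Un_outside[of "path_image c2 \<union> path_image c3"] by blast
    then have w23: "winding_number (c2 +++ reversepath c3) z = 0"
      using sp23 by (intro winding_number_zero_in_outside) (auto simp: simple_path_imp_path)
    have w12: "norm (winding_number (c1 +++ reversepath c2) z) = 1"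
      using sp12 z by (intro simple_closed_path_norm_winding_number_inside) auto
    have p: "path c1" "path c2" "path c3" using c1 c2 c3 arc_imp_path by blast+
    \<comment> \<open>The third difference is the first minus the second. The first two vanish, but
      the third has modulus 1.\<close>
    have "winding_number (c1 +++ reversepath c3) z = winding_number c1 z - winding_number c3 z"
      "winding_number (c2 +++ reversepath c3) z = winding_number c2 z - winding_number c3 z"
      "winding_number (c1 +++ reversepath c2) z = winding_number c1 z - winding_number c2 z"
      using p z12 z3 c1 c2 c3 by (simp_all add: winding_number_join winding_number_reversepath)
    with w12 w13 w23 show False by auto
  qed
  show ?thesis
  proof (rule ccontr)
    assume n: "\<not> ?thesis"
    have "path_image c3 \<inter> inside (path_image c1 \<union> path_image c2) = {}"
      using sub[OF c3, of "path_image c1 \<union> path_image c2"] n d13 d23 uv by blast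
    moreover have "path_image c2 \<inter> inside (path_image c1 \<union> path_image c3) = {}"
      using sub[OF c2, of "path_image c1 \<union> path_image c3"] n d12 d23 uv by blast
    moreover have "path_image c1 \<inter> inside (path_image c2 \<union> path_image c3) = {}"
      using sub[OF c1, of "path_image c2 \<union> path_image c3"] n d12 d13 uv by blast
    ultimately show False by (rule contra)
  qed
qed

text \<open>The point \<open>x\<close> lies in one of the two cells into which \<open>c3\<close> splits the inside of the outer cycle,
  and this cell is cut off from the opposite outer arc.\<close>

lemma no_planar_tripod:
  fixes c1 c2 c3 :: "real \<Rightarrow> complex"
  assumes c1: "arc c1" "pathstart c1 = u" "pathfinish c1 = v"
    and c2: "arc c2" "pathstart c2 = u" "pathfinish c2 = v"
    and c3: "arc c3" "pathstart c3 = u" "pathfinish c3 = v"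
    and d12: "path_image c1 \<inter> path_image c2 \<subseteq> {u, v}"
    and d13: "path_image c1 \<inter> path_image c3 \<subseteq> {u, v}"
    and d23: "path_image c2 \<inter> path_image c3 \<subseteq> {u, v}"
    and sub: "path_image c3 - {u, v} \<subseteq> inside (path_image c1 \<union> path_image c2)"
    and D1: "connected D1" "x \<in> D1" "w1 \<in> D1" "D1 \<inter> path_image c2 = {}" "D1 \<inter> path_image c3 = {}"
    and D2: "connected D2" "x \<in> D2" "w2 \<in> D2" "D2 \<inter> path_image c1 = {}" "D2 \<inter> path_image c3 = {}"
    and D3: "connected D3" "x \<in> D3" "w3 \<in> D3" "D3 \<inter> path_image c1 = {}" "D3 \<inter> path_image c2 = {}"
    and w: "w1 \<in> path_image c1" "w2 \<in> path_image c2" "w3 \<in> path_image c3"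
  shows False
proof -
  let ?I12 = "inside (path_image c1 \<union> path_image c2)"
  have uv: "u \<in> path_image c1" "v \<in> path_image c1" "u \<in> path_image c2" "v \<in> path_image c2"
     "u \<in> path_image c3" "v \<in> path_image c3"
    using c1 c2 c3 by (metis pathstart_in_path_image pathfinish_in_path_image)+
  \<comment> \<open>\<open>w3\<close> is an inner point of \<open>c3\<close>, and \<open>D3\<close>
    leads from it to \<open>x\<close> without touching the outer cycle.\<close>
  have "w3 \<in> ?I12" using sub w D3 uv by blast
  then have "x \<in> ?I12"
    using connected_meets_inside_subset[OF D3(1), of "path_image c1 \<union> path_image c2"] D3 by blast
  moreover have "u \<noteq> v" using c1 arc_distinct_ends by metis
  moreover have "path_image c3 \<inter> ?I12 \<noteq> {}" using \<open>w3 \<in> ?I12\<close> w by blast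
  ultimately have
    sp: "inside (path_image c1 \<union> path_image c3) \<union> inside (path_image c2 \<union> path_image c3) \<union>
        (path_image c3 - {u, v}) = ?I12"
    using split_inside_simple_closed_curve[of c1 u v c2 c3] c1 c2 c3 d12 d13 d23 uv
    by (simp add: arc_imp_simple_path) blast
  have I: "w1 \<notin> ?I12" "w2 \<notin> ?I12"
    using w inside_no_overlap[of "path_image c1 \<union> path_image c2"] by blast+
  \<comment> \<open>In this cell \<open>x\<close> would drag all of \<open>D2\<close> along,
    including \<open>w2\<close>, which lies on the outer cycle and not inside it. The other cell is
    excluded by \<open>D1\<close> and \<open>w1\<close>.\<close>
  have "x \<notin> inside (path_image c1 \<union> path_image c3)"
    using connected_meets_inside_subset[OF D2(1), of "path_image c1 \<union> path_image c3"] D2 I sp by blast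
  moreover have "x \<notin> inside (path_image c2 \<union> path_image c3)"
    using connected_meets_inside_subset[OF D1(1), of "path_image c2 \<union> path_image c3"] D1 I sp by blast
  moreover have "x \<notin> path_image c3" using D1 by blast
  ultimately show False using sp \<open>x \<in> ?I12\<close> by blast
qed

text \<open>Two curves at bounded distance from lines with independent directions must cross. By
  Cramer's rule \<open>s * m - t * k = r\<close> is solved by \<open>s = Im (cnj k * r) / D\<close>
  and \<open>t = Im (cnj m * r) / D\<close>. Here \<open>r\<close> itself depends on
  \<open>s\<close> and \<open>t\<close>, so a crossing is a fixed point of the map \<open>F\<close>
  that returns this solution, and Brouwer's theorem provides one.\<close>

lemma bounded_plane_crossing:
  fixes p q :: "real \<Rightarrow> complex" and m k :: complex
  assumes cont: "continuous_on UNIV p" "continuous_on UNIV q"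
    and bd: "\<And>x. norm (p x) \<le> M" "\<And>x. norm (q x) \<le> M"
    and D: "Im (cnj k * m) \<noteq> 0"
  obtains s t where "of_real s * m + p s = of_real t * k + q t"
proof -
  define D where "D = Im (cnj k * m)"
  have "D \<noteq> 0" using D D_def by simp
  define F where "F z = (let r = q (Im z) - p (Re z) in Complex (Im (cnj k * r) / D) (Im (cnj m * r) / D))" for z
  \<comment> \<open>Since \<open>r\<close> has norm at most \<open>2 * M\<close>, this bounds
    \<open>F\<close> everywhere, so \<open>F\<close> maps \<open>cball 0 R\<close> into
    itself.\<close>
  define R where "R = (norm k + norm m) * (2 * M) / \<bar>D\<bar>"
  have "M \<ge> 0" using bd(1)[of 0] norm_ge_zero order_trans by blast
  have Rpos: "R \<ge> 0" using \<open>M \<ge> 0\<close> unfolding R_def by auto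
  have F: "norm (F z) \<le> R" for z
  proof -
    define r where "r = q (Im z) - p (Re z)"
    have r: "norm r \<le> 2 * M" unfolding r_def using bd(1)[of "Re z"] bd(2)[of "Im z"] norm_triangle_ineq4[of "q (Im z)" "p (Re z)"] by linarith
    have "norm (F z) \<le> \<bar>Im (cnj k * r) / D\<bar> + \<bar>Im (cnj m * r) / D\<bar>"
      unfolding F_def Let_def r_def[symmetric] by (metis cmod_le complex.sel)
    also have "\<dots> = (\<bar>Im (cnj k * r)\<bar> + \<bar>Im (cnj m * r)\<bar>) / \<bar>D\<bar>"
      by (simp add: abs_divide add_divide_distrib)
    also have "\<dots> \<le> (norm k * norm r + norm m * norm r) / \<bar>D\<bar>"
      by (intro divide_right_mono add_mono)
         (metis abs_Im_le_cmod complex_mod_cnj norm_mult, metis abs_Im_le_cmod complex_mod_cnj norm_mult, simp)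
    also have "\<dots> \<le> R" unfolding R_def
      by (intro divide_right_mono) (auto simp: distrib_right[symmetric] intro!: mult_left_mono r)
    finally show ?thesis .
  qed
  have contF: "continuous_on (cball 0 R) F"
  proof -
    have *: "continuous_on (cball 0 R) (\<lambda>z. p (Re z))" "continuous_on (cball 0 R) (\<lambda>z. q (Im z))"
      by (auto intro!: continuous_on_compose2[OF cont(1)] continuous_on_compose2[OF cont(2)] continuous_intros)
    show ?thesis unfolding F_def Let_def Complex_eq using \<open>D \<noteq> 0\<close>
      by (intro continuous_intros *) auto
  qed
  obtain z where z: "F z = z"
    using brouwer[of "cball 0 R" F] contF F Rpos by (auto simp: dist_norm Pi_iff)
  define r where "r = q (Im z) - p (Re z)"
  have "Re z = Im (cnj k * r) / D" "Im z = Im (cnj m * r) / D"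
    using z unfolding F_def Let_def r_def by (metis complex.sel)+
  then have e: "Re z * D = Im (cnj k * r)" "Im z * D = Im (cnj m * r)" using \<open>D \<noteq> 0\<close> by auto
  have "D * Re (of_real (Re z) * m - of_real (Im z) * k) = (Re z * D) * Re m - (Im z * D) * Re k"
    by (simp add: algebra_simps)
  also have "\<dots> = D * Re r" unfolding e by (simp add: D_def algebra_simps)
  finally have 1: "Re (of_real (Re z) * m - of_real (Im z) * k) = Re r" using \<open>D \<noteq> 0\<close> by simp
  have "D * Im (of_real (Re z) * m - of_real (Im z) * k) = (Re z * D) * Im m - (Im z * D) * Im k"
    by (simp add: algebra_simps)
  also have "\<dots> = D * Im r" unfolding e by (simp add: D_def algebra_simps)
  finally have 2: "Im (of_real (Re z) * m - of_real (Im z) * k) = Im r" using \<open>D \<noteq> 0\<close> by simp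
  have "of_real (Re z) * m - of_real (Im z) * k = r" using 1 2 complex_eqI by blast
  then show ?thesis using that[of "Re z" "Im z"] unfolding r_def by (simp add: algebra_simps)
qed

lemma continuous_on_periodic_extension:
  fixes h :: "real \<Rightarrow> 'a::topological_space"
  assumes "continuous_on {0..1} h" "h 0 = h 1"
  shows "continuous_on UNIV (\<lambda>x. h (frac x))"
proof -
  have piece: "continuous_on {real_of_int n..real_of_int n + 1} (\<lambda>x. h (frac x))" for n
  proof -
    have "continuous_on {real_of_int n..real_of_int n + 1} (\<lambda>x. h (x - real_of_int n))"
      by (auto intro!: continuous_on_compose2[OF assms(1)] continuous_intros)
    moreover have "h (x - real_of_int n) = h (frac x)" if x: "x \<in> {real_of_int n..real_of_int n + 1}" for x
    proof (cases "x = real_of_int n + 1")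
      case True
      then have "frac x = 0" by (simp add: frac_eq_0_iff)
      then show ?thesis using True assms(2) by simp
    next
      case False
      then have "\<lfloor>x\<rfloor> = n" using x by (intro floor_unique) auto
      then show ?thesis by (simp add: frac_def)
    qed
    ultimately show ?thesis by (metis (no_types, lifting) continuous_on_cong)
  qed
  have "isCont (\<lambda>x. h (frac x)) x" for x
  proof -
    \<comment> \<open>The formula for \<open>frac\<close> changes at integers, so the two unit
      intervals on either side of \<open>n\<close> are glued to cover a neighbourhood of
      \<open>x\<close>.\<close>
    define n where "n = \<lfloor>x\<rfloor>"
    have "continuous_on ({real_of_int (n-1)..real_of_int (n-1) + 1} \<union> {real_of_int n..real_of_int n + 1}) (\<lambda>x. h (frac x))"
      by (intro continuous_on_closed_Un piece closed_atLeastAtMost)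
    then have "continuous_on {real_of_int n - 1<..<real_of_int n + 1} (\<lambda>x. h (frac x))"
      by (rule continuous_on_subset) auto
    moreover have "x \<in> {real_of_int n - 1<..<real_of_int n + 1}" unfolding n_def by simp linarith
    ultimately show ?thesis by (meson continuous_on_eq_continuous_at open_greaterThanLessThan)
  qed
  then show ?thesis by (simp add: continuous_on_eq_continuous_at)
qed

section \<open>Covering the torus\<close>

text \<open>\<open>a\<close> and \<open>b\<close> are the two sides, each indexed by 0, 1, 2.
  Distinctness of the six vertices is a consequence: two equal vertices on one side would be a
  common point of two arcs that have none.\<close>

definition K33_arcs :: "(nat \<Rightarrow> 'a::topological_space) \<Rightarrow> (nat \<Rightarrow> 'a) \<Rightarrow> (nat \<Rightarrow> nat \<Rightarrow> real \<Rightarrow> 'a) \<Rightarrow> bool" where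
  "K33_arcs a b g \<longleftrightarrow>
     (\<forall>i<3. \<forall>j<3. arc (g i j) \<and> pathstart (g i j) = a i \<and> pathfinish (g i j) = b j) \<and>
     (\<forall>i<3. \<forall>j<3. \<forall>i'<3. \<forall>j'<3. (i, j) \<noteq> (i', j') \<longrightarrow>
        path_image (g i j) \<inter> path_image (g i' j') \<subseteq>
          (if i = i' then {a i} else {}) \<union> (if j = j' then {b j} else {}))"

lemma K33_arcsD:
  assumes "K33_arcs a b g" "i < 3" "j < 3"
  shows "arc (g i j)" "pathstart (g i j) = a i" "pathfinish (g i j) = b j"
    "g i j 0 = a i" "g i j 1 = b j" "path (g i j)"
  using assms by (auto simp: K33_arcs_def pathstart_def pathfinish_def arc_imp_path)

lemma K33_arcs_Int:
  assumes "K33_arcs a b g" "i < 3" "j < 3" "i' < 3" "j' < 3" "(i, j) \<noteq> (i', j')"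
  shows "path_image (g i j) \<inter> path_image (g i' j') \<subseteq>
          (if i = i' then {a i} else {}) \<union> (if j = j' then {b j} else {})"
  using assms unfolding K33_arcs_def by blast

text \<open>Without \<open>a 0\<close>, a K_{3,3} is a theta graph with ends \<open>a 1\<close>,
  \<open>a 2\<close> and arcs through \<open>b 0\<close>, \<open>b 1\<close>, \<open>b 2\<close>.
  The removed vertex and its arcs form a tripod attached to all three of them, which
  \<open>no_planar_tripod\<close> forbids.\<close>

lemma not_K33_arcs_plane:
  fixes g :: "nat \<Rightarrow> nat \<Rightarrow> real \<Rightarrow> complex"
  shows "\<not> K33_arcs a b g"
proof
  assume K: "K33_arcs a b g"
  define c where "c j = g 1 j +++ reversepath (g 2 j)" for j
  note D = K33_arcsD[OF K]
  note I = K33_arcs_Int[OF K]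
  have im: "path_image (c j) = path_image (g 1 j) \<union> path_image (g 2 j)" if "j < 3" for j
    unfolding c_def using D[of 1 j] D[of 2 j] that by (subst path_image_join) auto
  have c: "arc (c j)" "pathstart (c j) = a 1" "pathfinish (c j) = a 2" if "j < 3" for j
  proof -
    have "path_image (g 1 j) \<inter> path_image (g 2 j) \<subseteq> {b j}" using I[of 1 j 2 j] that by auto
    then show "arc (c j)" unfolding c_def using D[of 1 j] D[of 2 j] that
      by (intro arc_join) (auto simp: arc_reversepath)
  qed (use that D[of 1 j] D[of 2 j] in \<open>auto simp: c_def\<close>)
  have cc: "path_image (c i) \<inter> path_image (c j) \<subseteq> {a 1, a 2}" if "i < 3" "j < 3" "i \<noteq> j" for i j
    using I[of 1 i 1 j] I[of 1 i 2 j] I[of 2 i 1 j] I[of 2 i 2 j] that im by auto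
  have w: "b j \<in> path_image (c j)" if "j < 3" for j
    using im[OF that] D(3)[of 1 j] pathfinish_in_path_image[of "g 1 j"] that by auto
  have conn: "connected (path_image (g 0 j))" "a 0 \<in> path_image (g 0 j)" "b j \<in> path_image (g 0 j)"
    if "j < 3" for j
    using D[of 0 j] that pathfinish_in_path_image[of "g 0 j"] pathstart_in_path_image[of "g 0 j"]
    by (auto intro: connected_arc_image)
  have dis: "path_image (g 0 i) \<inter> path_image (c j) = {}" if "i < 3" "j < 3" "i \<noteq> j" for i j
    using I[of 0 i 1 j] I[of 0 i 2 j] that im by auto
  have F: False if "i < 3" "j < 3" "k < 3" "i \<noteq> j" "i \<noteq> k" "j \<noteq> k"
    "path_image (c k) - {a 1, a 2} \<subseteq> inside (path_image (c i) \<union> path_image (c j))" for i j k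
    using that
    by (intro no_planar_tripod[of "c i" "a 1" "a 2" "c j" "c k"  "path_image (g 0 i)" "a 0" "b i"
          "path_image (g 0 j)" "b j" "path_image (g 0 k)" "b k"] c cc w conn dis) auto
  show False
    using theta_inside[of "c 0" "a 1" "a 2" "c 1" "c 2"] c cc F[of 0 1 2] F[of 0 2 1] F[of 1 2 0] by auto
qed

section \<open>The universal covering of the torus\<close>

definition tcov :: "complex \<Rightarrow> complex \<times> complex" where
  "tcov z = (cis (2 * pi * Re z), cis (2 * pi * Im z))"

text \<open>The Gaussian integers are the group of deck translations of \<open>tcov\<close>; they
  are the possible periods, that is homology classes, of loops on the torus.\<close>

definition gauss :: "complex set" where
  "gauss = {z. Re z \<in> \<int> \<and> Im z \<in> \<int>}"

lemma gauss_closed [intro]: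
  "z \<in> gauss \<Longrightarrow> w \<in> gauss \<Longrightarrow> z + w \<in> gauss"
  "z \<in> gauss \<Longrightarrow> w \<in> gauss \<Longrightarrow> z - w \<in> gauss"
  "z \<in> gauss \<Longrightarrow> - z \<in> gauss"
  "z \<in> gauss \<Longrightarrow> of_int n * z \<in> gauss"
  "0 \<in> gauss"
  by (auto simp: gauss_def)

lemma cis_2pi_eq_iff: "cis (2 * pi * x) = cis (2 * pi * y) \<longleftrightarrow> x - y \<in> \<int>"
proof -
  have "cis (2 * pi * x) = cis (2 * pi * y) \<longleftrightarrow>
      sin (2 * pi * x) = sin (2 * pi * y) \<and> cos (2 * pi * x) = cos (2 * pi * y)"
    by (auto simp: complex_eq_iff)
  also have "\<dots> \<longleftrightarrow> (\<exists>n::int. 2 * pi * x = 2 * pi * y + 2 * pi * n)"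
    by (rule sin_cos_eq_iff)
  also have "\<dots> \<longleftrightarrow> (\<exists>n::int. x - y = n)"
  proof (intro ex_cong1)
    fix n :: int
    have "2 * pi * y + 2 * pi * n = 2 * pi * (y + n)" by (simp add: distrib_left)
    then have "2 * pi * x = 2 * pi * y + 2 * pi * n \<longleftrightarrow> x = y + n" by simp
    then show "2 * pi * x = 2 * pi * y + 2 * pi * n \<longleftrightarrow> x - y = n" by auto
  qed
  finally show ?thesis by (auto simp: Ints_def)
qed

lemma tcov_eq_iff: "tcov z = tcov w \<longleftrightarrow> z - w \<in> gauss"
  by (simp add: tcov_def gauss_def cis_2pi_eq_iff)

lemma tcov_shift: "m \<in> gauss \<Longrightarrow> tcov (z + m) = tcov z" "m \<in> gauss \<Longrightarrow> tcov (z - m) = tcov z"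
  by (auto simp: tcov_eq_iff)

lemma circle_path_lift:
  fixes f :: "real \<Rightarrow> complex"
  assumes "continuous_on {0..1} f" "\<And>t. t \<in> {0..1} \<Longrightarrow> norm (f t) = 1"
  obtains h where "continuous_on {0..1} h" "\<And>t. t \<in> {0..1} \<Longrightarrow> f t = cis (2 * pi * h t)"
proof -
  have "f t \<noteq> 0" if "t \<in> {0..1}" for t using assms(2)[OF that] by auto
  then obtain g where g: "continuous_on {0..1} g" "\<And>t. t \<in> {0..1} \<Longrightarrow> f t = exp (g t)"
    using continuous_logarithm_on_contractible[OF assms(1) convex_imp_contractible] by auto
  have "f t = cis (2 * pi * (Im (g t) / (2 * pi)))" if "t \<in> {0..1}" for t
  proof -
    have "exp (Re (g t)) = 1" using assms(2)[OF that] g(2)[OF that] by simp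
    then show ?thesis using g(2)[OF that] by (simp add: exp_eq_polar)
  qed
  moreover have "continuous_on {0..1} (\<lambda>t. Im (g t) / (2 * pi))"
    by (intro continuous_intros g) auto
  ultimately show ?thesis using that by blast
qed

lemma torus_iff_norm: "z \<in> torus \<longleftrightarrow> norm (fst z) = 1 \<and> norm (snd z) = 1"
  by (cases z) (auto simp: torus_def)

definition lifts_to :: "(real \<Rightarrow> complex) \<Rightarrow> (real \<Rightarrow> complex \<times> complex) \<Rightarrow> bool" where
  "lifts_to \<delta> \<gamma> \<longleftrightarrow> path \<delta> \<and> (\<forall>t\<in>{0..1}. tcov (\<delta> t) = \<gamma> t)"

text \<open>Both coordinates are lifted by logarithms on the interval. The start so obtained differs
  from \<open>P\<close> by an element of \<open>gauss\<close>, by which the lift is then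
  translated.\<close>

lemma torus_path_lift:
  assumes "path \<gamma>" "path_image \<gamma> \<subseteq> torus" "tcov P = \<gamma> 0"
  obtains \<delta> where "lifts_to \<delta> \<gamma>" "\<delta> 0 = P"
proof -
  have n: "norm (fst (\<gamma> t)) = 1" "norm (snd (\<gamma> t)) = 1" if "t \<in> {0..1}" for t
  proof -
    have "\<gamma> t \<in> torus" using assms(2) that by (auto simp: path_image_def)
    then show "norm (fst (\<gamma> t)) = 1" "norm (snd (\<gamma> t)) = 1" by (simp_all add: torus_iff_norm)
  qed
  have c: "continuous_on {0..1} (\<lambda>t. fst (\<gamma> t))" "continuous_on {0..1} (\<lambda>t. snd (\<gamma> t))"
    using assms(1) by (auto simp: path_def intro!: continuous_intros)
  obtain h where h: "continuous_on {0..1} h" "\<And>t. t \<in> {0..1} \<Longrightarrow> fst (\<gamma> t) = cis (2 * pi * h t)"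
    using circle_path_lift[OF c(1) n(1)] by auto
  obtain k where k: "continuous_on {0..1} k" "\<And>t. t \<in> {0..1} \<Longrightarrow> snd (\<gamma> t) = cis (2 * pi * k t)"
    using circle_path_lift[OF c(2) n(2)] by auto
  define m where "m = P - Complex (h 0) (k 0)"
  have lift: "tcov (Complex (h t) (k t)) = \<gamma> t" if "t \<in> {0..1}" for t
    unfolding tcov_def using h(2)[OF that] k(2)[OF that] by (simp add: prod_eq_iff)
  have m: "m \<in> gauss"
    using lift[of 0] assms(3) by (auto simp: m_def tcov_eq_iff[symmetric])
  show ?thesis
  proof
    show "lifts_to (\<lambda>t. Complex (h t) (k t) + m) \<gamma>"
      unfolding lifts_to_def path_def Complex_eq
      using lift tcov_shift(1)[OF m] h k by (auto intro!: continuous_intros simp: Complex_eq)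
  qed (simp add: m_def)
qed

lemma tcov_surj:
  assumes "z \<in> torus" obtains P where "tcov P = z"
proof -
  obtain x y where "fst z = cis x" "snd z = cis y"
    using assms complex_norm_eq_1_exp by (metis torus_iff_norm cis_conv_exp)
  then have "tcov (Complex (x / (2 * pi)) (y / (2 * pi))) = z"
    by (simp add: tcov_def prod_eq_iff)
  then show ?thesis using that by blast
qed

text \<open>The second function is the lift of a loop traversed again and again, each turn being
  shifted by the period \<open>m\<close>. Its deviation from the line \<open>x * m\<close> is the
  first function, which is periodic and therefore continuous across the integers.\<close>

lemma path_unroll:
  fixes \<alpha> :: "real \<Rightarrow> complex"
  assumes "path \<alpha>" defines "m \<equiv> \<alpha> 1 - \<alpha> 0"
  shows "continuous_on UNIV (\<lambda>x. \<alpha> (frac x) - of_real (frac x) * m)"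
    and "continuous_on UNIV (\<lambda>x. \<alpha> (frac x) + of_int \<lfloor>x\<rfloor> * m)"
proof -
  show c: "continuous_on UNIV (\<lambda>x. \<alpha> (frac x) - of_real (frac x) * m)"
    by (rule continuous_on_periodic_extension[where h = "\<lambda>x. \<alpha> x - of_real x * m"])
       (use assms in \<open>auto simp: path_def m_def intro!: continuous_intros\<close>)
  have "continuous_on UNIV (\<lambda>x. (\<alpha> (frac x) - of_real (frac x) * m) + of_real x * m)"
    by (intro continuous_intros c)
  then show "continuous_on UNIV (\<lambda>x. \<alpha> (frac x) + of_int \<lfloor>x\<rfloor> * m)"
    by (simp add: frac_def algebra_simps)
qed

text \<open>The infinite repetitions of the lifts stay at bounded distance from the lines spanned by
  the periods, so they cross if the periods are independent, and deck translations bring the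
  crossing back to the lifts themselves. The determinant in the hypothesis is, up to sign, the
  intersection number of the two classes.\<close>

lemma torus_loops_meet:
  fixes \<alpha> \<beta> :: "real \<Rightarrow> complex"
  assumes "path \<alpha>" "path \<beta>" "\<alpha> 1 - \<alpha> 0 \<in> gauss" "\<beta> 1 - \<beta> 0 \<in> gauss"
    and D: "Im (cnj (\<beta> 1 - \<beta> 0) * (\<alpha> 1 - \<alpha> 0)) \<noteq> 0"
  obtains s t where "s \<in> {0..1}" "t \<in> {0..1}" "tcov (\<alpha> s) = tcov (\<beta> t)"
proof -
  define p where "p \<gamma> x = \<gamma> (frac x) - of_real (frac x) * (\<gamma> 1 - \<gamma> 0)" for \<gamma> :: "real \<Rightarrow> complex" and x
  have bd: "\<exists>M. \<forall>x. norm (p \<gamma> x) \<le> M" if "path \<gamma>" for \<gamma>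
  proof -
    have "compact ((\<lambda>x. \<gamma> x - of_real x * (\<gamma> 1 - \<gamma> 0)) ` {0..1})"
      using that by (intro compact_continuous_image) (auto simp: path_def intro!: continuous_intros)
    then obtain M where "\<forall>x\<in>{0..1}. norm (\<gamma> x - of_real x * (\<gamma> 1 - \<gamma> 0)) \<le> M"
      by (metis (no_types, lifting) bounded_iff compact_imp_bounded imageI)
    moreover have "frac x \<in> {0..1}" for x :: real
      using frac_lt_1[of x] by (auto simp: less_imp_le)
    ultimately show ?thesis unfolding p_def by blast
  qed
  obtain M1 M2 where M: "\<And>x. norm (p \<alpha> x) \<le> M1" "\<And>x. norm (p \<beta> x) \<le> M2"
    using bd assms by metis
  have c: "continuous_on UNIV (p \<gamma>)" if "path \<gamma>" for \<gamma>
    using path_unroll(1)[OF that] by (simp add: p_def[abs_def])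
  obtain s t where st: "of_real s * (\<alpha> 1 - \<alpha> 0) + p \<alpha> s = of_real t * (\<beta> 1 - \<beta> 0) + p \<beta> t"
  proof (rule bounded_plane_crossing)
    show "norm (p \<alpha> x) \<le> max M1 M2" "norm (p \<beta> x) \<le> max M1 M2" for x
      using M[of x] by linarith+
    show "Im (cnj (\<beta> 1 - \<beta> 0) * (\<alpha> 1 - \<alpha> 0)) \<noteq> 0" by (rule D)
  qed (use c assms in auto)
  have e: "of_real x * (\<gamma> 1 - \<gamma> 0) + p \<gamma> x = \<gamma> (frac x) + of_int \<lfloor>x\<rfloor> * (\<gamma> 1 - \<gamma> 0)" for \<gamma> x
    by (simp add: p_def frac_def algebra_simps)
  have "tcov (\<alpha> (frac s)) = tcov (\<alpha> (frac s) + of_int \<lfloor>s\<rfloor> * (\<alpha> 1 - \<alpha> 0))"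
    using assms by (intro tcov_shift(1)[symmetric]) auto
  also have "\<dots> = tcov (\<beta> (frac t) + of_int \<lfloor>t\<rfloor> * (\<beta> 1 - \<beta> 0))"
    using st e by metis
  also have "\<dots> = tcov (\<beta> (frac t))"
    using assms by (intro tcov_shift(1)) auto
  finally show ?thesis
    using that[of "frac s" "frac t"] frac_lt_1[of s] frac_lt_1[of t] by (auto simp: less_imp_le)
qed

text \<open>Pairwise dependent lattice vectors lie on one line through 0. The lattice points of this
  line are the multiples of a primitive vector, obtained from any non-zero element of
  \<open>S\<close> by dividing by the gcd of its coordinates.\<close>

lemma gauss_rank_le_1:
  assumes "S \<subseteq> gauss" "\<And>m k. m \<in> S \<Longrightarrow> k \<in> S \<Longrightarrow> Im (cnj k * m) = 0"
  obtains w where "w \<in> gauss" "w \<noteq> 0" "\<And>m. m \<in> S \<Longrightarrow> \<exists>n::int. m = of_int n * w"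
proof (cases "S \<subseteq> {0}")
  case True
  show ?thesis
    by (rule that[of 1]) (use True in \<open>auto simp: gauss_def intro!: exI[of _ 0]\<close>)
next
  case False
  then obtain m where m: "m \<in> S" "m \<noteq> 0" by blast
  then obtain x y :: int where xy: "Re m = x" "Im m = y"
    using assms(1) by (auto simp: gauss_def Ints_def)
  define d where "d = gcd x y"
  have d0: "d \<noteq> 0" using m xy by (auto simp: d_def complex_eq_iff)
  obtain p q where pq: "x = p * d" "y = q * d" "coprime p q"
    using d0 unfolding d_def by (metis gcd_coprime_exists)
  show ?thesis
  proof (rule that[of "Complex p q"])
    show "Complex p q \<in> gauss" by (simp add: gauss_def)
    show "Complex p q \<noteq> 0" using m xy pq by (auto simp: complex_eq_iff)
    fix k assume k: "k \<in> S"
    then obtain r s :: int where rs: "Re k = r" "Im k = s"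
      using assms(1) by (auto simp: gauss_def Ints_def)
    have "Im (cnj k * m) = 0" using assms(2) m k by blast
    then have "real_of_int (r * y - s * x) = 0" using xy rs by simp
    then have "r * y = s * x" by (metis eq_iff_diff_eq_0 of_int_eq_0_iff)
    then have eq: "r * q = s * p" using d0 pq by auto
    have "\<exists>n. r = n * p \<and> s = n * q"
    proof (cases "p = 0")
      case True
      \<comment> \<open>For \<open>p = 0\<close> coprimality leaves only 1 and -1 for
        \<open>q\<close>, so \<open>s * q\<close> is the multiplier.\<close>
      then have "q * q = 1" using pq(3) by (auto simp: abs_if split: if_splits)
      moreover have "r = 0" using eq True \<open>q * q = 1\<close> by auto
      ultimately show ?thesis using True by (intro exI[of _ "s * q"]) (simp add: mult.assoc)
    next
      case False
      have "p dvd r * q" using eq by simp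
      then have "p dvd r" using pq(3) coprime_dvd_mult_left_iff by blast
      then obtain n where "r = n * p" by (auto simp: dvd_def mult.commute)
      then show ?thesis using eq False by (intro exI[of _ n]) (simp add: mult.assoc mult.left_commute)
    qed
    then obtain n where n: "r = n * p" "s = n * q" by blast
    then show "\<exists>n::int. k = of_int n * Complex p q"
      using n rs by (intro exI[of _ n]) (simp add: complex_eq_iff)
  qed
qed

section \<open>Lifting a K_{3,3} from the torus to the plane\<close>

lemma lifts_toD:
  assumes "lifts_to \<delta> \<gamma>"
  shows "path \<delta>" "\<And>t. t \<in> {0..1} \<Longrightarrow> tcov (\<delta> t) = \<gamma> t" "tcov (\<delta> 0) = \<gamma> 0" "tcov (\<delta> 1) = \<gamma> 1"
    "tcov ` path_image \<delta> = path_image \<gamma>"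
  using assms by (force simp: lifts_to_def path_image_def)+

lemma lifts_to_reversepath: "lifts_to \<delta> \<gamma> \<Longrightarrow> lifts_to (reversepath \<delta>) (reversepath \<gamma>)"
  by (auto simp: lifts_to_def path_reversepath) (auto simp: reversepath_def)

lemma path_image_minus: "path_image (\<lambda>t. f t - m) = (\<lambda>z. z - m) ` path_image f" for m :: complex
  by (auto simp: path_image_def)

lemma path_minus: "path f \<Longrightarrow> path (\<lambda>t. f t - m)" for m :: complex
  by (auto simp: path_def intro!: continuous_intros)

text \<open>The arcs at \<open>a 0\<close> and those at \<open>b 0\<close> form a spanning tree,
  which lifts to the plane as it is. The other four arcs are lifted from \<open>A i\<close> and
  reach \<open>B j\<close> only up to a deck translation; these four differences are the periods of
  the graph.\<close>

lemma K33_arcs_torus_lift: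
  assumes K: "K33_arcs a b g" and T: "\<And>i j. i < 3 \<Longrightarrow> j < 3 \<Longrightarrow> path_image (g i j) \<subseteq> torus"
  obtains A B L where
    "\<And>i j. i < 3 \<Longrightarrow> j < 3 \<Longrightarrow> lifts_to (L i j) (g i j) \<and> L i j 0 = A i \<and> L i j 1 - B j \<in> gauss"
    "\<And>j. j < 3 \<Longrightarrow> L 0 j 1 = B j" "\<And>i. i < 3 \<Longrightarrow> L i 0 1 = B 0"
proof -
  note D = K33_arcsD[OF K]
  have "a 0 \<in> torus" using T[of 0 0] D(2)[of 0 0] pathstart_in_path_image[of "g 0 0"] by auto
  then obtain A0 where A0: "tcov A0 = a 0" using tcov_surj by blast
  have "\<exists>\<delta>. lifts_to \<delta> (g 0 j) \<and> \<delta> 0 = A0" if "j < 3" for j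
    using torus_path_lift[of "g 0 j" A0] D[of 0 j] T[of 0 j] A0 that by auto
  then obtain L0 where L0: "\<And>j. j < 3 \<Longrightarrow> lifts_to (L0 j) (g 0 j) \<and> L0 j 0 = A0" by metis
  have tB: "tcov (L0 j 1) = b j" if "j < 3" for j
    using L0[OF that] lifts_toD(4) D(5)[of 0 j] that by auto
  \<comment> \<open>A lift has been fixed only for the end \<open>b 0\<close> of these arcs, so they
    are traversed backwards.\<close>
  have "\<exists>\<delta>. lifts_to \<delta> (reversepath (g i 0)) \<and> \<delta> 0 = L0 0 1" if "i < 3" for i
  proof -
    have "reversepath (g i 0) 0 = b 0" using D(5)[of i 0] that by (simp add: reversepath_def)
    then show ?thesis
      using torus_path_lift[of "reversepath (g i 0)" "L0 0 1"] D(6)[of i 0] T[of i 0] tB[of 0] that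
      by (auto simp: path_reversepath)
  qed
  then obtain R where R: "\<And>i. i < 3 \<Longrightarrow> lifts_to (R i) (reversepath (g i 0)) \<and> R i 0 = L0 0 1" by metis
  define A where "A i = (if i = 0 then A0 else R i 1)" for i
  have tA: "tcov (A i) = a i" if "i < 3" for i
    using that A0 R[OF that] lifts_toD(4)[of "R i" "reversepath (g i 0)"] D(4)[of i 0]
    by (auto simp: A_def reversepath_def)
  have "\<exists>\<delta>. lifts_to \<delta> (g i j) \<and> \<delta> 0 = A i" if "i < 3" "j < 3" for i j
    using torus_path_lift[of "g i j" "A i"] D[of i j] T[of i j] tA that by metis
  then obtain M where M: "\<And>i j. i < 3 \<Longrightarrow> j < 3 \<Longrightarrow> lifts_to (M i j) (g i j) \<and> M i j 0 = A i" by metis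
  define L where "L i j = (if i = 0 then L0 j else if j = 0 then reversepath (R i) else M i j)" for i j
  have L: "lifts_to (L i j) (g i j) \<and> L i j 0 = A i" if "i < 3" "j < 3" for i j
    using that L0[of j] R[of i] M[of i j] lifts_to_reversepath[of "R i" "reversepath (g i 0)"]
    by (auto simp: L_def A_def) (auto simp: reversepath_def)
  show ?thesis
  proof (rule that)
    fix i j :: nat assume ij: "i < 3" "j < 3"
    have "tcov (L i j 1) = tcov (L0 j 1)"
      using tB[of j] ij L[of i j] lifts_toD(4)[of "L i j"] D(5)[of i j] by auto
    then have "L i j 1 - L0 j 1 \<in> gauss" by (simp add: tcov_eq_iff)
    then show "lifts_to (L i j) (g i j) \<and> L i j 0 = A i \<and> L i j 1 - L0 j 1 \<in> gauss" using L ij by blast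
  next
    show "\<And>j. j < 3 \<Longrightarrow> L 0 j 1 = L0 j 1" by (simp add: L_def)
    show "\<And>i. i < 3 \<Longrightarrow> L i 0 1 = L0 0 1" using R by (auto simp: L_def reversepath_def)
  qed
qed

text \<open>If all periods of the lifted graph are multiples of \<open>w\<close>, then \<open>exp (2\<pi>iz/w)\<close> identifies the
  endpoints of the lifted arcs but no points of the graph, giving a planar \<open>K\<^bsub>3,3\<^esub>\<close>.\<close>

lemma K33_arcs_torus_periods:
  assumes K: "K33_arcs a b g"
    and L: "\<And>i j. i < 3 \<Longrightarrow> j < 3 \<Longrightarrow> lifts_to (L i j) (g i j) \<and> L i j 0 = A i"
    and w: "w \<in> gauss" "w \<noteq> 0"
    and per: "\<And>i j. i < 3 \<Longrightarrow> j < 3 \<Longrightarrow> \<exists>n::int. L i j 1 - B j = of_int n * w"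
  shows False
proof -
  note D = K33_arcsD[OF K]
  \<comment> \<open>The quotient of the plane by the translations along \<open>w\<close>, an annulus
    realised as the punctured plane.\<close>
  define \<Phi> where "\<Phi> z = exp (2 * of_real pi * \<i> * z / w)" for z
  have \<Phi>_eq: "\<Phi> z = \<Phi> z' \<longleftrightarrow> (\<exists>n::int. z = z' + of_int n * w)" for z z'
  proof -
    have "\<Phi> z = \<Phi> z' \<longleftrightarrow> (\<exists>n::int. 2 * of_real pi * \<i> * z / w = 2 * of_real pi * \<i> * z' / w + of_int (2 * n) * of_real pi * \<i>)"
      unfolding \<Phi>_def exp_eq by (simp add: mult_ac)
    also have "\<dots> \<longleftrightarrow> (\<exists>n::int. z = z' + of_int n * w)"
    proof (intro ex_cong1)
      fix n :: int
      have "2 * of_real pi * \<i> * z' / w + of_int (2 * n) * of_real pi * \<i> = 2 * of_real pi * \<i> * (z' + of_int n * w) / w"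
        using w(2) by (simp add: field_simps)
      moreover have "2 * complex_of_real pi * \<i> * u / w = 2 * of_real pi * \<i> * v / w \<longleftrightarrow> u = v" for u v
        using w(2) by simp
      ultimately show "2 * of_real pi * \<i> * z / w = 2 * of_real pi * \<i> * z' / w + of_int (2 * n) * of_real pi * \<i>
        \<longleftrightarrow> z = z' + of_int n * w" by metis
    qed
    finally show ?thesis .
  qed
  \<comment> \<open>Points identified by \<open>\<Phi>\<close> differ by a multiple of
    \<open>w\<close> and so lie over the same point of the torus. Hence the projected arcs meet only
    where the given arcs do.\<close>
  have key: "g i j s = g i' j' t" if "i < 3" "j < 3" "i' < 3" "j' < 3" "s \<in> {0..1}" "t \<in> {0..1}"
    "\<Phi> (L i j s) = \<Phi> (L i' j' t)" for i j s i' j' t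
  proof -
    have "L i j s - L i' j' t \<in> gauss" using that(7) w(1) by (auto simp: \<Phi>_eq)
    then have "tcov (L i j s) = tcov (L i' j' t)" by (simp add: tcov_eq_iff)
    then show ?thesis using L[of i j] L[of i' j'] that lifts_toD(2) by metis
  qed
  \<comment> \<open>Here the hypothesis on the periods enters: the three lifts that end over
    \<open>b j\<close> end at the same point of the annulus.\<close>
  have B: "\<Phi> (L i j 1) = \<Phi> (B j)" if "i < 3" "j < 3" for i j
    using per[OF that] unfolding \<Phi>_eq by (metis diff_eq_eq add.commute)
  have inj: "s = t" if "i < 3" "j < 3" "s \<in> {0..1}" "t \<in> {0..1}" "g i j s = g i j t" for i j s t
    using D(1)[of i j] that by (auto simp: arc_def inj_on_def)
  have "K33_arcs (\<lambda>i. \<Phi> (A i)) (\<lambda>j. \<Phi> (B j)) (\<lambda>i j. \<Phi> \<circ> L i j)"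
    unfolding K33_arcs_def
  proof (intro conjI allI impI)
    fix i j :: nat assume ij: "i < 3" "j < 3"
    have c\<Phi>: "continuous_on UNIV \<Phi>" unfolding \<Phi>_def[abs_def] using w(2) by (intro continuous_intros) auto
    show "arc (\<Phi> \<circ> L i j)" unfolding arc_def
    proof
      show "path (\<Phi> \<circ> L i j)"
        using L[OF ij] by (intro path_continuous_image continuous_on_subset[OF c\<Phi>]) (auto dest: lifts_toD(1))
      show "inj_on (\<Phi> \<circ> L i j) {0..1}"
        unfolding inj_on_def comp_def using key[OF ij ij] inj[OF ij] by metis
    qed
    show "pathstart (\<Phi> \<circ> L i j) = \<Phi> (A i)" "pathfinish (\<Phi> \<circ> L i j) = \<Phi> (B j)"
      using L[OF ij] B[OF ij] by (auto simp: pathstart_def pathfinish_def)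
  next
    fix i j i' j' :: nat assume ij: "i < 3" "j < 3" "i' < 3" "j' < 3" "(i, j) \<noteq> (i', j')"
    show "path_image (\<Phi> \<circ> L i j) \<inter> path_image (\<Phi> \<circ> L i' j') \<subseteq>
          (if i = i' then {\<Phi> (A i)} else {}) \<union> (if j = j' then {\<Phi> (B j)} else {})"
    proof
      fix y assume "y \<in> path_image (\<Phi> \<circ> L i j) \<inter> path_image (\<Phi> \<circ> L i' j')"
      then obtain s t where st: "s \<in> {0..1}" "t \<in> {0..1}" "y = \<Phi> (L i j s)" "y = \<Phi> (L i' j' t)"
        by (auto simp: path_image_def)
      then have "g i j s = g i' j' t" using key ij by metis
      then have "g i j s \<in> (if i = i' then {a i} else {}) \<union> (if j = j' then {b j} else {})"
      proof -
        have "g i j s \<in> path_image (g i j)" using st(1) by (auto simp: path_image_def)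
        moreover have "g i j s \<in> path_image (g i' j')"
          using st(2) \<open>g i j s = g i' j' t\<close> by (auto simp: path_image_def)
        ultimately show ?thesis using K33_arcs_Int[OF K ij] by blast
      qed
      then consider "i = i'" "g i j s = g i j 0" | "j = j'" "g i j s = g i j 1"
        using D(4,5)[of i j] ij by (auto split: if_splits)
      then show "y \<in> (if i = i' then {\<Phi> (A i)} else {}) \<union> (if j = j' then {\<Phi> (B j)} else {})"
      proof cases
        case 1
        then have "s = 0" using inj[of i j s 0] ij st by auto
        then show ?thesis using 1 L[of i j] ij st by auto
      next
        case 2
        then have "s = 1" using inj[of i j s 1] ij st by auto
        then show ?thesis using 2 B[of i j] ij st by auto
      qed
    qed
  qed
  then show False using not_K33_arcs_plane by blast
qed

text \<open>If all periods were dependent, \<open>K33_arcs_torus_periods\<close> would give a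
  K_{3,3} in the plane. Two independent periods belong to arcs outside the spanning tree, and the
  fundamental cycles of these arcs, based at \<open>a 0\<close>, are the required loops.\<close>

lemma K33_arcs_torus_loops:
  assumes K: "K33_arcs a b g" and T: "\<And>i j. i < 3 \<Longrightarrow> j < 3 \<Longrightarrow> path_image (g i j) \<subseteq> torus"
  defines "X \<equiv> (\<Union>i<3. \<Union>j<3. path_image (g i j))"
  obtains \<alpha> \<beta> where "path \<alpha>" "path \<beta>" "\<alpha> 0 = \<beta> 0"
    "tcov ` path_image \<alpha> \<subseteq> X" "tcov ` path_image \<beta> \<subseteq> X"
    "\<alpha> 1 - \<alpha> 0 \<in> gauss" "\<beta> 1 - \<beta> 0 \<in> gauss" "Im (cnj (\<beta> 1 - \<beta> 0) * (\<alpha> 1 - \<alpha> 0)) \<noteq> 0"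
proof -
  obtain A B L where
    L: "\<And>i j. i < 3 \<Longrightarrow> j < 3 \<Longrightarrow> lifts_to (L i j) (g i j) \<and> L i j 0 = A i \<and> L i j 1 - B j \<in> gauss"
    and L0: "\<And>j. j < 3 \<Longrightarrow> L 0 j 1 = B j" "\<And>i. i < 3 \<Longrightarrow> L i 0 1 = B 0"
    using K33_arcs_torus_lift[OF K T] by metis
  define M where "M i j = L i j 1 - B j" for i j
  define S where "S = {M i j |i j. i < 3 \<and> j < 3}"
  have "\<exists>m\<in>S. \<exists>k\<in>S. Im (cnj k * m) \<noteq> 0"
  proof (rule ccontr)
    assume "\<not> ?thesis"
    moreover have "S \<subseteq> gauss" using L by (auto simp: S_def M_def)
    ultimately obtain w where "w \<in> gauss" "w \<noteq> 0" and n: "\<And>m. m \<in> S \<Longrightarrow> \<exists>n::int. m = of_int n * w"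
      using gauss_rank_le_1[of S] by metis
    show False
    proof -
      have "\<exists>n::int. L i j 1 - B j = of_int n * w" if "i < 3" "j < 3" for i j
        using n[of "M i j"] that by (auto simp: S_def M_def)
      then show False
        using K33_arcs_torus_periods[OF K, of L A w B] L \<open>w \<in> gauss\<close> \<open>w \<noteq> 0\<close> by metis
    qed
  qed
  then obtain i j i' j' where ij: "i < 3" "j < 3" "i' < 3" "j' < 3" "Im (cnj (M i' j') * M i j) \<noteq> 0"
    unfolding S_def by blast
  \<comment> \<open>The cycle runs from \<open>a 0\<close> to \<open>b j\<close>, back to
    \<open>a i\<close>, on to \<open>b 0\<close> and home. The first lift ends at \<open>B j\<close>
    while \<open>L i j\<close> ends at \<open>B j + M i j\<close>, so every later piece is shifted
    by \<open>- M i j\<close>, which becomes the period of the loop.\<close>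
  define \<gamma> where "\<gamma> i j = L 0 j +++ (\<lambda>t. reversepath (L i j) t - M i j) +++
     (\<lambda>t. L i 0 t - M i j) +++ (\<lambda>t. reversepath (L 0 0) t - M i j)" for i j
  have \<gamma>: "path (\<gamma> i j) \<and> \<gamma> i j 0 = A 0 \<and> \<gamma> i j 1 = A 0 - M i j \<and> tcov ` path_image (\<gamma> i j) \<subseteq> X"
    if ij: "i < 3" "j < 3" for i j
  proof -
    have p: "path (L 0 j)" "path (\<lambda>t. reversepath (L i j) t - M i j)" "path (\<lambda>t. L i 0 t - M i j)"
      "path (\<lambda>t. reversepath (L 0 0) t - M i j)"
      using L[of 0 j] L[of i j] L[of i 0] L[of 0 0] ij
      by (auto intro!: path_minus path_reversepath[THEN iffD2] dest: lifts_toD(1) simp del: path_reversepath)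
    have e: "pathfinish (L 0 j) = pathstart (\<lambda>t. reversepath (L i j) t - M i j)"
      "pathfinish (\<lambda>t. reversepath (L i j) t - M i j) = pathstart (\<lambda>t. L i 0 t - M i j)"
      "pathfinish (\<lambda>t. L i 0 t - M i j) = pathstart (\<lambda>t. reversepath (L 0 0) t - M i j)"
      using L[of i j] L[of i 0] L[of 0 0] L0 ij
      by (auto simp: pathstart_def pathfinish_def reversepath_def M_def)
    have i: "path_image (\<gamma> i j) \<subseteq> path_image (L 0 j) \<union> (\<lambda>z. z - M i j) ` path_image (L i j) \<union>
        (\<lambda>z. z - M i j) ` path_image (L i 0) \<union> (\<lambda>z. z - M i j) ` path_image (L 0 0)"
      unfolding \<gamma>_def using p e by (simp add: path_image_join path_image_minus) blast
    have M: "M i j \<in> gauss" using L ij by (simp add: M_def)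
    have X: "tcov ` path_image (L i j) \<subseteq> X" if "i < 3" "j < 3" for i j
      using L[OF that] lifts_toD(5)[of "L i j"] that unfolding X_def by blast
    have "tcov ` path_image (\<gamma> i j) \<subseteq> X"
      using i X[of 0 j] X[of i j] X[of i 0] X[of 0 0] ij tcov_shift(2)[OF M] by (auto simp: image_subset_iff)
    moreover have "path (\<gamma> i j)" unfolding \<gamma>_def using p e by (intro path_join_imp) auto
    moreover have "\<gamma> i j 0 = A 0" using L[of 0 j] ij by (simp add: \<gamma>_def joinpaths_def)
    moreover have "\<gamma> i j 1 = A 0 - M i j" using L[of 0 0] by (simp add: \<gamma>_def joinpaths_def reversepath_def)
    ultimately show ?thesis by blast
  qed
  show ?thesis
  proof (rule that[of "\<gamma> i j" "\<gamma> i' j'"])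
    have "\<gamma> i j 1 - \<gamma> i j 0 = - M i j" "\<gamma> i' j' 1 - \<gamma> i' j' 0 = - M i' j'"
      using \<gamma>[of i j] \<gamma>[of i' j'] ij by auto
    moreover have "M i j \<in> gauss" "M i' j' \<in> gauss" using L ij by (auto simp: M_def)
    ultimately show "\<gamma> i j 1 - \<gamma> i j 0 \<in> gauss" "\<gamma> i' j' 1 - \<gamma> i' j' 0 \<in> gauss"
      by (metis gauss_closed(3))+
    have "\<gamma> i j 1 - \<gamma> i j 0 = - M i j" "\<gamma> i' j' 1 - \<gamma> i' j' 0 = - M i' j'" by fact+
    then show "Im (cnj (\<gamma> i' j' 1 - \<gamma> i' j' 0) * (\<gamma> i j 1 - \<gamma> i j 0)) \<noteq> 0"
      using ij by simp
  qed (use \<gamma>[of i j] \<gamma>[of i' j'] ij in auto)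
qed

lemma K33_arcs_path_connected:
  fixes g :: "nat \<Rightarrow> nat \<Rightarrow> real \<Rightarrow> 'a::topological_space"
  assumes K: "K33_arcs a b g"
  defines "X \<equiv> (\<Union>i<3. \<Union>j<3. path_image (g i j))"
  shows "path_connected X"
proof -
  note D = K33_arcsD[OF K]
  have pc: "path_component X x y"
    if "i < 3" "j < 3" "x \<in> path_image (g i j)" "y \<in> path_image (g i j)" for i j x y
  proof -
    have "path_connected (path_image (g i j))" using D that by (intro path_connected_path_image)
    then have "path_component (path_image (g i j)) x y" using that by (simp add: path_connected_component)
    then show ?thesis by (rule path_component_of_subset[rotated]) (use that in \<open>auto simp: X_def\<close>)
  qed
  have ends: "a i \<in> path_image (g i j)" "b j \<in> path_image (g i j)" if "i < 3" "j < 3" for i j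
    using D(2,3)[OF that] pathstart_in_path_image[of "g i j"] pathfinish_in_path_image[of "g i j"] by auto
  have to_a0: "path_component X x (a 0)" if x: "x \<in> X" for x
  proof -
    obtain i j where ij: "i < 3" "j < 3" "x \<in> path_image (g i j)" using x by (auto simp: X_def)
    have "path_component X x (b j)" using pc ij ends by blast
    moreover have "path_component X (b j) (a 0)" using pc[of 0 j] ends ij by auto
    ultimately show ?thesis by (rule path_component_trans)
  qed
  then show ?thesis
    unfolding path_connected_component by (metis path_component_sym path_component_trans)
qed

text \<open>The imaginary part is the determinant of two vectors, and only 0 is parallel to each of
  two independent vectors.\<close>

lemma two_independent_periods_imp_zero:
  assumes "Im (cnj k * m) = 0" "Im (cnj k * m') = 0" "Im (cnj m' * m) \<noteq> 0"
  shows "k = 0"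
proof (rule ccontr)
  assume k: "k \<noteq> 0"
  have 1: "Re k * Im m = Im k * Re m" "Re k * Im m' = Im k * Re m'" using assms by (auto simp: algebra_simps)
  have "(Re m' * Im m - Im m' * Re m) * Re k = 0" "(Re m' * Im m - Im m' * Re m) * Im k = 0"
    using 1 by algebra+
  then show False using k assms(3) by (auto simp: complex_eq_iff algebra_simps)
qed

text \<open>The loops of the \<open>K\<^bsub>3,3\<^esub>\<close> kill all periods of the disjoint theta graph, which therefore lifts to
  the plane.  There each of its arcs is joined to infinity inside the preimage of the
  \<open>K\<^bsub>3,3\<^esub>\<close>, whereas one of the arcs lies inside the cycle formed by the other two.\<close>

lemma torus_obstruction:
  assumes K: "K33_arcs a b g" and T: "\<And>i j. i < 3 \<Longrightarrow> j < 3 \<Longrightarrow> path_image (g i j) \<subseteq> torus"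
  defines "X \<equiv> (\<Union>i<3. \<Union>j<3. path_image (g i j))"
  assumes c: "\<And>i. i < 3 \<Longrightarrow> arc (c i)" "\<And>i. i < 3 \<Longrightarrow> pathstart (c i) = u"
    "\<And>i. i < 3 \<Longrightarrow> pathfinish (c i) = v" "\<And>i::nat. i < 3 \<Longrightarrow> path_image (c i) \<subseteq> torus - X"
    and cc: "\<And>i j. i < 3 \<Longrightarrow> j < 3 \<Longrightarrow> i \<noteq> j \<Longrightarrow> path_image (c i) \<inter> path_image (c j) \<subseteq> {u, v}"
    and d: "\<And>i. i < 3 \<Longrightarrow> path (d i)" "\<And>i. i < 3 \<Longrightarrow> pathstart (d i) \<in> path_image (c i)"
    "\<And>i. i < 3 \<Longrightarrow> pathfinish (d i) \<in> X" "\<And>i. i < 3 \<Longrightarrow> path_image (d i) \<subseteq> torus"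
    and dc: "\<And>i j. i < 3 \<Longrightarrow> j < 3 \<Longrightarrow> i \<noteq> j \<Longrightarrow> path_image (d i) \<inter> path_image (c j) = {}"
  shows False
proof -
  obtain \<alpha> \<beta> where \<alpha>: "path \<alpha>" "tcov ` path_image \<alpha> \<subseteq> X" "\<alpha> 1 - \<alpha> 0 \<in> gauss"
    and \<beta>: "path \<beta>" "tcov ` path_image \<beta> \<subseteq> X" "\<beta> 1 - \<beta> 0 \<in> gauss"
    and indep: "Im (cnj (\<beta> 1 - \<beta> 0) * (\<alpha> 1 - \<alpha> 0)) \<noteq> 0"
    by (rule K33_arcs_torus_loops[OF K T, folded X_def])
  have XT: "X \<subseteq> torus" using T by (auto simp: X_def)
  have "u \<in> torus" using c(2,4)[of 0] pathstart_in_path_image[of "c 0"] by auto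
  then obtain U where U: "tcov U = u" using tcov_surj by blast
  have "\<exists>\<delta>. lifts_to \<delta> (c i) \<and> \<delta> 0 = U" if "i < 3" for i
    using torus_path_lift[of "c i" U] c[OF that] U arc_imp_path by (auto simp: pathstart_def)
  then obtain C where C: "\<And>i. i < 3 \<Longrightarrow> lifts_to (C i) (c i)" "\<And>i. i < 3 \<Longrightarrow> C i 0 = U" by metis
  note CD = lifts_toD[OF C(1)]
  have CX: "tcov ` path_image (C i) \<inter> X = {}" if "i < 3" for i
    using CD(5)[OF that] c(4)[OF that] by auto
  \<comment> \<open>\<open>c i\<close> followed by \<open>c j\<close> reversed is a loop missing
    \<open>X\<close>. By \<open>torus_loops_meet\<close> its period depends on the period of
    \<open>\<alpha>\<close> as well as on that of \<open>\<beta>\<close>, hence is 0 and the two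
    lifts end together.\<close>
  have per: "C i 1 = C j 1" if ij: "i < 3" "j < 3" for i j
  proof -
    define m where "m = C j 1 - C i 1"
    define \<gamma> where "\<gamma> = C i +++ (\<lambda>t. reversepath (C j) t - m)"
    have e: "pathfinish (C i) = pathstart (\<lambda>t. reversepath (C j) t - m)"
      by (simp add: m_def pathfinish_def pathstart_def reversepath_def)
    have p: "path (C i)" "path (\<lambda>t. reversepath (C j) t - m)"
      using CD(1) ij by (auto intro: path_minus)
    have "tcov (C i 1) = tcov (C j 1)" using CD(4) c(3) ij by (simp add: pathfinish_def)
    then have "C j 1 - C i 1 \<in> gauss" by (metis tcov_eq_iff)
    then have m: "m \<in> gauss" by (simp add: m_def)
    have \<gamma>: "path \<gamma>" unfolding \<gamma>_def using p e by (rule path_join_imp)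
    have "\<gamma> 1 - \<gamma> 0 = - m" using C(2) ij by (simp add: \<gamma>_def joinpaths_def reversepath_def)
    moreover have im: "tcov ` path_image \<gamma> \<inter> X = {}"
    proof -
      have "path_image \<gamma> = path_image (C i) \<union> (\<lambda>z. z - m) ` path_image (C j)"
        unfolding \<gamma>_def using p e by (simp add: path_image_join path_image_minus)
      then show ?thesis using CX ij tcov_shift(2)[OF m] by (auto simp: image_Un image_image)
    qed
    have "Im (cnj (\<gamma> 1 - \<gamma> 0) * (\<epsilon> 1 - \<epsilon> 0)) = 0"
      if \<epsilon>: "path \<epsilon>" "tcov ` path_image \<epsilon> \<subseteq> X" "\<epsilon> 1 - \<epsilon> 0 \<in> gauss" for \<epsilon>
    proof (rule ccontr)
      assume "Im (cnj (\<gamma> 1 - \<gamma> 0) * (\<epsilon> 1 - \<epsilon> 0)) \<noteq> 0"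
      then obtain s t where "s \<in> {0..1}" "t \<in> {0..1}" "tcov (\<epsilon> s) = tcov (\<gamma> t)"
        using torus_loops_meet[of \<epsilon> \<gamma>] \<epsilon> \<gamma> m calculation by (metis gauss_closed(3))
      moreover have "tcov (\<epsilon> s) \<in> X" using \<epsilon>(2) \<open>s \<in> {0..1}\<close> by (auto simp: path_image_def)
      moreover have "tcov (\<gamma> t) \<in> tcov ` path_image \<gamma>" using \<open>t \<in> {0..1}\<close> by (auto simp: path_image_def)
      ultimately show False using im by auto
    qed
    from two_independent_periods_imp_zero[OF this[OF \<alpha>] this[OF \<beta>] indep]
    show ?thesis using \<open>\<gamma> 1 - \<gamma> 0 = - m\<close> by (simp add: m_def)
  qed
  define V where "V = C 0 1"
  have CV: "C i 1 = V" if "i < 3" for i using per[of i 0] that by (simp add: V_def)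
  have inj: "s = t" if "i < 3" "s \<in> {0..1}" "t \<in> {0..1}" "c i s = c i t" for i s t
    using c(1)[of i] that by (auto simp: arc_def inj_on_def)
  have Carc: "arc (C i)" "pathstart (C i) = U" "pathfinish (C i) = V" if "i < 3" for i
  proof -
    show "arc (C i)" unfolding arc_def inj_on_def using CD(1,2)[OF that] inj[OF that] by metis
  qed (use that C(2) CV in \<open>auto simp: pathstart_def pathfinish_def\<close>)
  have CC: "path_image (C i) \<inter> path_image (C j) \<subseteq> {U, V}" if ij: "i < 3" "j < 3" "i \<noteq> j" for i j
  proof
    fix y assume "y \<in> path_image (C i) \<inter> path_image (C j)"
    then obtain s t where st: "s \<in> {0..1}" "t \<in> {0..1}" "y = C i s" "y = C j t"
      by (auto simp: path_image_def)
    then have "c i s = c j t" using CD(2) ij by metis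
    moreover have "c i s \<in> path_image (c i)" "c j t \<in> path_image (c j)"
      using st by (auto simp: path_image_def)
    ultimately have "c i s \<in> {u, v}" using cc[OF ij] by auto
    moreover have "u = c i 0" "v = c i 1" using c(2,3) ij by (auto simp: pathstart_def pathfinish_def)
    ultimately consider "c i s = c i 0" | "c i s = c i 1" by blast
    then show "y \<in> {U, V}"
    proof cases
      case 1
      then have "s = 0" using inj[OF ij(1) st(1), of 0] by simp
      then show ?thesis using st C(2) ij by simp
    next
      case 2
      then have "s = 1" using inj[OF ij(1) st(1), of 1] by simp
      then show ?thesis using st CV ij by simp
    qed
  qed
  \<comment> \<open>Suppose that \<open>C i\<close> is enclosed by the two other lifts. The set
    \<open>S\<close> below starts on \<open>C i\<close>, follows a lift of \<open>d i\<close>, a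
    lift of a path in \<open>X\<close>, and then \<open>\<alpha>\<close> repeated for ever. It never
    meets the enclosing cycle, and yet it is unbounded.\<close>
  have esc: False if i: "i < 3" and jk: "j < 3" "k < 3" "j \<noteq> i" "k \<noteq> i" "j \<noteq> k"
    and ins: "path_image (C i) - {U, V} \<subseteq> inside (path_image (C j) \<union> path_image (C k))" for i j k
  proof -
    obtain s where s: "s \<in> {0..1}" "pathstart (d i) = c i s" using d(2)[OF i] by (auto simp: path_image_def)
    have tW: "tcov (C i s) = d i 0" using CD(2)[OF i] s by (simp add: pathstart_def)
    obtain \<delta> where \<delta>: "lifts_to \<delta> (d i)" "\<delta> 0 = C i s"
      using torus_path_lift[OF d(1)[OF i] d(4)[OF i] tW] by blast
    have "tcov (\<alpha> 0) \<in> X" using \<alpha>(2) by (auto simp: path_image_def)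
    then obtain e where e: "path e" "path_image e \<subseteq> X" "pathstart e = pathfinish (d i)" "pathfinish e = tcov (\<alpha> 0)"
      using K33_arcs_path_connected[OF K] d(3)[OF i] unfolding X_def path_connected_def by metis
    have "tcov (\<delta> 1) = e 0" using lifts_toD(4)[OF \<delta>(1)] e(3) by (simp add: pathstart_def pathfinish_def)
    then obtain \<epsilon> where \<epsilon>: "lifts_to \<epsilon> e" "\<epsilon> 0 = \<delta> 1"
      using torus_path_lift[OF e(1)] e(2) XT by (metis order_trans)
    define h where "h = \<epsilon> 1 - \<alpha> 0"
    have "tcov (\<epsilon> 1) = tcov (\<alpha> 0)" using lifts_toD(4)[OF \<epsilon>(1)] e(4) by (simp add: pathfinish_def)
    then have h: "h \<in> gauss" by (simp add: h_def tcov_eq_iff)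
    define m where "m = \<alpha> 1 - \<alpha> 0"
    have m: "m \<in> gauss" "m \<noteq> 0" using \<alpha>(3) indep by (auto simp: m_def)
    \<comment> \<open>The loop \<open>\<alpha>\<close> repeated in both directions; the translation
      \<open>h\<close> places its point at parameter 0 on the end of
      \<open>\<epsilon>\<close>.\<close>
    define \<rho> where "\<rho> x = \<alpha> (frac x) + of_int \<lfloor>x\<rfloor> * m + h" for x :: real
    have c\<rho>: "continuous_on UNIV \<rho>"
      unfolding \<rho>_def m_def by (intro continuous_intros path_unroll(2) \<alpha>(1))
    define S where "S = path_image \<delta> \<union> (path_image \<epsilon> \<union> range \<rho>)"
    have "\<rho> 0 = \<epsilon> 1" by (simp add: \<rho>_def h_def)
    have "connected S" unfolding S_def
    proof (intro connected_Un)
      show "connected (path_image \<delta>)" "connected (path_image \<epsilon>)"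
        using lifts_toD(1) \<delta> \<epsilon> by (auto intro: connected_path_image)
      show "connected (range \<rho>)" using c\<rho> by (intro connected_continuous_image) auto
      have "\<epsilon> 1 \<in> range \<rho>" using \<open>\<rho> 0 = \<epsilon> 1\<close> by (metis rangeI)
      then have "\<epsilon> 1 \<in> path_image \<epsilon> \<inter> range \<rho>" by (auto simp: path_image_def)
      then show "path_image \<epsilon> \<inter> range \<rho> \<noteq> {}" by blast
      have "\<epsilon> 0 \<in> path_image \<epsilon>" "\<delta> 1 \<in> path_image \<delta>" by (auto simp: path_image_def)
      then have "\<delta> 1 \<in> path_image \<delta> \<inter> path_image \<epsilon>" using \<open>\<epsilon> 0 = \<delta> 1\<close> by simp
      then show "path_image \<delta> \<inter> (path_image \<epsilon> \<union> range \<rho>) \<noteq> {}" by blast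
    qed
    moreover have "S \<inter> (path_image (C j) \<union> path_image (C k)) = {}"
    proof -
      have "tcov ` range \<rho> \<subseteq> X"
      proof (rule image_subsetI)
        fix z assume "z \<in> range \<rho>"
        then obtain x where z: "z = \<rho> x" by blast
        have "\<rho> x = \<alpha> (frac x) + (of_int \<lfloor>x\<rfloor> * m + h)" by (simp add: \<rho>_def)
        then have "tcov (\<rho> x) = tcov (\<alpha> (frac x))" using m h by (auto intro!: tcov_shift)
        moreover have "\<alpha> (frac x) \<in> path_image \<alpha>" using frac_lt_1[of x] by (auto simp: path_image_def less_imp_le)
        ultimately show "tcov z \<in> X" unfolding z using \<alpha>(2) by auto
      qed
      moreover have "tcov ` path_image \<epsilon> \<subseteq> X" using lifts_toD(5)[OF \<epsilon>(1)] e(2) by simp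
      moreover have "tcov ` path_image \<delta> = path_image (d i)" using lifts_toD(5)[OF \<delta>(1)] .
      ultimately have S: "tcov ` S \<subseteq> path_image (d i) \<union> X" unfolding S_def by blast
      have "path_image (c l) \<inter> (path_image (d i) \<union> X) = {}" if "l < 3" "l \<noteq> i" for l
        using dc[OF i, of l] c(4)[of l] that by blast
      then have "tcov ` path_image (C l) \<inter> tcov ` S = {}" if "l < 3" "l \<noteq> i" for l
        using CD(5) S that by blast
      then have "path_image (C l) \<inter> S = {}" if "l < 3" "l \<noteq> i" for l using that by blast
      then show ?thesis using jk by blast
    qed
    moreover have "S \<inter> inside (path_image (C j) \<union> path_image (C k)) \<noteq> {}"
    proof -
      have "\<delta> 0 \<in> path_image \<delta>" by (auto simp: path_image_def)
      then have "C i s \<in> S" using \<delta>(2) by (simp add: S_def)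
      moreover have "C i s \<in> path_image (C i)" using s by (auto simp: path_image_def)
      \<comment> \<open>\<open>S\<close> misses \<open>C j\<close>, so the starting point on
        \<open>C i\<close> is neither \<open>U\<close> nor \<open>V\<close> and really lies inside
        the cycle.\<close>
      moreover have "U \<in> path_image (C j)" "V \<in> path_image (C j)"
        using Carc[OF jk(1)] by (metis pathstart_in_path_image, metis pathfinish_in_path_image)
      ultimately show ?thesis using ins \<open>S \<inter> (path_image (C j) \<union> path_image (C k)) = {}\<close> by blast
    qed
    ultimately have "S \<subseteq> inside (path_image (C j) \<union> path_image (C k))"
      by (rule connected_meets_inside_subset)
    moreover have "bounded (path_image (C j) \<union> path_image (C k))"
      using CD(1) jk by (auto intro: bounded_path_image)
    ultimately have "bounded S" using bounded_inside bounded_subset by metis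
    then obtain R where R: "\<And>z. z \<in> S \<Longrightarrow> norm z \<le> R" by (auto simp: bounded_iff)
    \<comment> \<open>After \<open>n\<close> turns \<open>\<rho>\<close> has advanced by
      \<open>n * m\<close> with \<open>m\<close> non-zero, which is impossible in a bounded set for
      all \<open>n\<close>.\<close>
    have "of_nat n * norm m \<le> R + norm (\<alpha> 0 + h)" for n :: nat
    proof -
      have "\<rho> (of_nat n) = of_nat n * m + (\<alpha> 0 + h)" by (simp add: \<rho>_def frac_def)
      moreover have "norm (\<rho> (of_nat n)) \<le> R" using R by (auto simp: S_def)
      ultimately show ?thesis
        using norm_triangle_ineq4[of "of_nat n * m + (\<alpha> 0 + h)" "\<alpha> 0 + h"] by (simp add: norm_mult)
    qed
    then show False using m(2) reals_Archimedean3[of "norm m"] by (metis linorder_not_less zero_less_norm_iff)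
  qed
  show False
    using theta_inside[OF Carc[of 0] Carc[of 1] Carc[of 2] CC[of 0 1] CC[of 0 2] CC[of 1 2]]
      esc[of 2 0 1] esc[of 1 0 2] esc[of 0 1 2] by auto
qed

section \<open>Graph drawings\<close>

lemma drawing_onD:
  assumes "drawing_on S V E p g"
  shows "inj_on p V" "p ` V \<subseteq> S"
    "\<And>e. e \<in> E \<Longrightarrow> arc (g e)" "\<And>e. e \<in> E \<Longrightarrow> path_image (g e) \<subseteq> S"
    "\<And>e. e \<in> E \<Longrightarrow> {pathstart (g e), pathfinish (g e)} = p ` e"
    "\<And>e. e \<in> E \<Longrightarrow> path_image (g e) \<inter> p ` V = p ` e"
    "\<And>e e'. e \<in> E \<Longrightarrow> e' \<in> E \<Longrightarrow> e \<noteq> e' \<Longrightarrow> path_image (g e) \<inter> path_image (g e') = p ` (e \<inter> e')"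
  using assms unfolding drawing_on_def by auto

text \<open>Deletion and renaming in one: this restricts a drawing to a subgraph and also transports
  it along a graph embedding \<open>\<phi>\<close>.\<close>

lemma drawing_on_subgraph:
  assumes d: "drawing_on S V E p g" and \<phi>: "inj_on \<phi> V'" "\<phi> ` V' \<subseteq> V"
    and E': "\<And>e. e \<in> E' \<Longrightarrow> e \<subseteq> V' \<and> \<phi> ` e \<in> E"
  shows "drawing_on S V' E' (p \<circ> \<phi>) (\<lambda>e. g (\<phi> ` e))"
  unfolding drawing_on_def
proof (intro conjI ballI impI)
  note D = drawing_onD[OF d]
  show "inj_on (p \<circ> \<phi>) V'" using D(1) \<phi> by (meson comp_inj_on inj_on_subset)
  show "(p \<circ> \<phi>) ` V' \<subseteq> S" using D(2) \<phi> by auto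
  fix e assume e: "e \<in> E'"
  show "arc (g (\<phi> ` e))" "path_image (g (\<phi> ` e)) \<subseteq> S"
    "{pathstart (g (\<phi> ` e)), pathfinish (g (\<phi> ` e))} = (p \<circ> \<phi>) ` e"
    using D E' e by (auto simp: image_comp)
  have "path_image (g (\<phi> ` e)) \<inter> (p \<circ> \<phi>) ` V' = (path_image (g (\<phi> ` e)) \<inter> p ` V) \<inter> p ` (\<phi> ` V')"
    using \<phi> by auto
  also have "\<dots> = p ` (\<phi> ` e)" using D(6)[of "\<phi> ` e"] E'[OF e] by auto
  finally show "path_image (g (\<phi> ` e)) \<inter> (p \<circ> \<phi>) ` V' = (p \<circ> \<phi>) ` e" by (simp add: image_comp)
next
  note D = drawing_onD[OF d]
  fix e e' assume e: "e \<in> E'" "e' \<in> E'" "e \<noteq> e'"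
  then have "\<phi> ` e \<noteq> \<phi> ` e'" "\<phi> ` (e \<inter> e') = \<phi> ` e \<inter> \<phi> ` e'"
    using E' \<phi>(1) by (metis inj_on_image_eq_iff, metis inj_on_image_Int)
  then show "path_image (g (\<phi> ` e)) \<inter> path_image (g (\<phi> ` e')) = (p \<circ> \<phi>) ` (e \<inter> e')"
    using D(7)[of "\<phi> ` e" "\<phi> ` e'"] E' e by (metis image_comp)
qed

section \<open>Walks in drawn graphs\<close>

fun path_edges :: "'a list \<Rightarrow> 'a set set" where
  "path_edges (x # y # xs) = insert {x, y} (path_edges (y # xs))"
| "path_edges _ = {}"

lemma path_edges_subset: "e \<in> path_edges xs \<Longrightarrow> e \<subseteq> set xs"
  by (induction xs rule: path_edges.induct) auto

lemma path_edges_cover: "x \<in> set xs \<Longrightarrow> 2 \<le> length xs \<Longrightarrow> \<exists>e\<in>path_edges xs. x \<in> e"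
proof (induction xs rule: path_edges.induct)
  case (1 a b zs)
  show ?case
  proof (cases "x = a \<or> x = b")
    case False
    then have "\<exists>e\<in>path_edges (b # zs). x \<in> e" using 1 by (cases zs) auto
    then show ?thesis by auto
  qed auto
qed auto

lemma path_edges_card: "distinct xs \<Longrightarrow> e \<in> path_edges xs \<Longrightarrow> \<exists>x y. x \<noteq> y \<and> e = {x, y}"
  by (induction xs rule: path_edges.induct) auto

lemma path_edges_successively:
  assumes "successively adj xs" "e \<in> path_edges xs"
  obtains x y where "x \<in> set xs" "y \<in> set xs" "adj x y" "e = {x, y}"
  using assms by (induction xs rule: path_edges.induct) auto

text \<open>Without repetitions the first vertex lies on the first edge only, so an edge joining it
  to the last vertex is the first edge and already the whole walk. This serves to exclude a common
  edge of two arcs of the theta graph.\<close>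

lemma path_edges_hd_last:
  assumes "distinct xs" "{hd xs, last xs} \<in> path_edges xs"
  shows "set xs = {hd xs, last xs}"
proof -
  obtain x y zs where xs: "xs = x # y # zs"
  proof (cases xs)
    case (Cons x ys)
    then show thesis using that assms(2) by (cases ys) auto
  qed (use assms(2) in simp)
  have "x \<notin> set (y # zs)" using assms(1) xs by simp
  then have "{x, last xs} \<notin> path_edges (y # zs)" using path_edges_subset by blast
  then have "{x, last xs} = {x, y}" using assms(2) xs by auto
  moreover have "last xs \<in> set (y # zs)" using xs by simp
  ultimately have "last (y # zs) = y" using \<open>x \<notin> set (y # zs)\<close> xs by (metis doubleton_eq_iff last_ConsR list.discI)
  moreover have "last (y # zs) \<noteq> y" if "zs \<noteq> []"
    using that assms(1) xs last_in_set[of zs] by auto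
  ultimately have "zs = []" by blast
  then show ?thesis using xs by auto
qed

definition route_image :: "('a set \<Rightarrow> real \<Rightarrow> 's) \<Rightarrow> 'a list \<Rightarrow> 's::topological_space set" where
  "route_image g xs = (\<Union>e\<in>path_edges xs. path_image (g e))"

lemma route_image_Int:
  assumes d: "drawing_on S V E p g" and "path_edges xs \<subseteq> E" "path_edges ys \<subseteq> E"
    and "path_edges xs \<inter> path_edges ys = {}"
  shows "route_image g xs \<inter> route_image g ys \<subseteq> p ` (set xs \<inter> set ys)"
proof
  fix z assume "z \<in> route_image g xs \<inter> route_image g ys"
  then obtain e e' where e: "e \<in> path_edges xs" "e' \<in> path_edges ys" "z \<in> path_image (g e) \<inter> path_image (g e')"
    by (auto simp: route_image_def)
  then have "z \<in> p ` (e \<inter> e')" using drawing_onD(7)[OF d, of e e'] assms by blast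
  then show "z \<in> p ` (set xs \<inter> set ys)" using e path_edges_subset by blast
qed

lemma route_image_subset:
  assumes d: "drawing_on S V E p g" and "path_edges xs \<subseteq> E"
  shows "route_image g xs \<subseteq> S"
  using drawing_onD(4)[OF d] assms(2) by (auto simp: route_image_def)

lemma route_arc:
  fixes g :: "'a set \<Rightarrow> real \<Rightarrow> 's::t2_space"
  assumes d: "drawing_on S V E p g" and "path_edges xs \<subseteq> E" "distinct xs" "2 \<le> length xs" "set xs \<subseteq> V"
  shows "\<exists>\<gamma>. arc \<gamma> \<and> pathstart \<gamma> = p (hd xs) \<and> pathfinish \<gamma> = p (last xs) \<and> path_image \<gamma> = route_image g xs"
  using assms(2-)
proof (induction xs rule: path_edges.induct)
  case (1 x y zs)
  note D = drawing_onD[OF d]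
  have e: "{x, y} \<in> E" "x \<noteq> y" using 1 by auto
  have pxy: "p x \<noteq> p y" using D(1) e 1(5) by (auto simp: inj_on_def)
  \<comment> \<open>A drawing leaves the direction of an edge curve open, so the curve may have to
    be reversed.\<close>
  have "\<exists>\<gamma>. arc \<gamma> \<and> pathstart \<gamma> = p x \<and> pathfinish \<gamma> = p y \<and> path_image \<gamma> = path_image (g {x, y})"
  proof (cases "pathstart (g {x, y}) = p x")
    case True
    then show ?thesis using D(3,5)[OF e(1)] pxy by (intro exI[of _ "g {x, y}"]) (auto simp: doubleton_eq_iff)
  next
    case False
    then show ?thesis using D(3,5)[OF e(1)] pxy
      by (intro exI[of _ "reversepath (g {x, y})"]) (auto simp: doubleton_eq_iff arc_reversepath)
  qed
  then obtain \<gamma> where \<gamma>: "arc \<gamma>" "pathstart \<gamma> = p x" "pathfinish \<gamma> = p y" "path_image \<gamma> = path_image (g {x, y})"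
    by blast
  show ?case
  proof (cases "zs = []")
    case True
    then show ?thesis using \<gamma> by (intro exI[of _ \<gamma>]) (auto simp: route_image_def)
  next
    case False
    then have "2 \<le> length (y # zs)" by (cases zs) auto
    then obtain \<delta> where \<delta>: "arc \<delta>" "pathstart \<delta> = p y" "pathfinish \<delta> = p (last (y # zs))"
      "path_image \<delta> = route_image g (y # zs)"
      using 1 by auto
    have "path_edges [x, y] \<inter> path_edges (y # zs) = {}"
      using path_edges_subset[of "{x, y}" "y # zs"] 1(3) by auto
    then have "route_image g [x, y] \<inter> route_image g (y # zs) \<subseteq> p ` (set [x, y] \<inter> set (y # zs))"
      using 1(2) by (intro route_image_Int[OF d]) auto
    then have "path_image \<gamma> \<inter> path_image \<delta> \<subseteq> {p y}"
      using 1(3) \<gamma>(4) \<delta>(4) by (auto simp: route_image_def)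
    then have "arc (\<gamma> +++ \<delta>)" using \<gamma> \<delta> by (intro arc_join) auto
    then show ?thesis using \<gamma> \<delta>
      by (intro exI[of _ "\<gamma> +++ \<delta>"]) (auto simp: path_image_join route_image_def)
  qed
qed auto

definition route_ok :: "('a \<Rightarrow> 'a \<Rightarrow> bool) \<Rightarrow> 'a list \<Rightarrow> bool" where
  "route_ok adj xs \<longleftrightarrow> distinct xs \<and> 2 \<le> length xs \<and> successively adj xs"

text \<open>\<open>K ! i ! j\<close> is the route in place of the edge from vertex \<open>i\<close>
  of one side to vertex \<open>j\<close> of the other. The quantifiers run through explicit lists so
  that the predicate can be evaluated on concrete data.\<close>

definition K33_routes :: "('a \<Rightarrow> 'a \<Rightarrow> bool) \<Rightarrow> 'a list list list \<Rightarrow> bool" where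
  "K33_routes adj K \<longleftrightarrow>
     (\<forall>i\<in>set [0..<3]. \<forall>j\<in>set [0..<3]. route_ok adj (K ! i ! j) \<and>
        hd (K ! i ! j) = hd (K ! i ! 0) \<and> last (K ! i ! j) = last (K ! 0 ! j)) \<and>
     (\<forall>i\<in>set [0..<3]. \<forall>j\<in>set [0..<3]. \<forall>i'\<in>set [0..<3]. \<forall>j'\<in>set [0..<3]. (i = i' \<and> j = j') \<or>
        (\<forall>x\<in>set (K ! i ! j). x \<in> set (K ! i' ! j') \<longrightarrow>
           (i = i' \<and> x = hd (K ! i ! 0)) \<or> (j = j' \<and> x = last (K ! 0 ! j))))"

text \<open>Besides the subdivided \<open>K\<^bsub>3,3\<^esub>\<close> given by \<open>K\<close>, there are disjoint routes \<open>C ! i\<close> forming a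
  subdivided \<open>K\<^bsub>2,3\<^esub>\<close>, and for each \<open>i\<close> a route \<open>D ! i\<close> from an inner vertex of \<open>C ! i\<close> to the
  \<open>K\<^bsub>3,3\<^esub>\<close>.\<close>

definition torus_obstruction_in ::
    "('a \<Rightarrow> 'a \<Rightarrow> bool) \<Rightarrow> 'a list list list \<Rightarrow> 'a list list \<Rightarrow> 'a list list \<Rightarrow> bool" where
  "torus_obstruction_in adj K C D \<longleftrightarrow> K33_routes adj K \<and>
     (\<forall>i\<in>set [0..<3]. route_ok adj (C ! i) \<and> hd (C ! i) = hd (C ! 0) \<and> last (C ! i) = last (C ! 0) \<and>
        (\<forall>j\<in>set [0..<3]. \<forall>k\<in>set [0..<3]. \<forall>x\<in>set (K ! j ! k). x \<notin> set (C ! i)) \<and>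
        (\<forall>j\<in>set [0..<3]. i = j \<or> (\<forall>x\<in>set (C ! i). x \<in> set (C ! j) \<longrightarrow> x = hd (C ! 0) \<or> x = last (C ! 0)))) \<and>
     (\<forall>i\<in>set [0..<3]. route_ok adj (D ! i) \<and> hd (D ! i) \<in> set (C ! i) \<and>
        (\<exists>j\<in>set [0..<3]. \<exists>k\<in>set [0..<3]. last (D ! i) \<in> set (K ! j ! k)) \<and>
        (\<forall>j\<in>set [0..<3]. i = j \<or> (\<forall>x\<in>set (C ! j). x \<notin> set (D ! i))))"

lemma ball_upt_3: "(\<forall>i\<in>set [0..<3]. P i) \<longleftrightarrow> (\<forall>i<3. P i)"
  and bex_upt_3: "(\<exists>i\<in>set [0..<3]. P i) \<longleftrightarrow> (\<exists>i<3. P i)"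
  by auto

lemma route_okD:
  assumes "route_ok adj xs" "set xs \<subseteq> V" "\<And>x y. x \<in> V \<Longrightarrow> y \<in> V \<Longrightarrow> adj x y \<Longrightarrow> {x, y} \<in> E"
  shows "path_edges xs \<subseteq> E" "distinct xs" "2 \<le> length xs"
  using assms by (auto simp: route_ok_def elim!: path_edges_successively)

lemma disjoint_path_edges:
  assumes "distinct xs"
    and "\<And>x y. x \<noteq> y \<Longrightarrow> {x, y} \<in> path_edges xs \<Longrightarrow> {x, y} \<subseteq> set xs \<inter> set ys \<Longrightarrow> {x, y} \<notin> path_edges ys"
  shows "path_edges xs \<inter> path_edges ys = {}"
proof (rule ccontr)
  assume "path_edges xs \<inter> path_edges ys \<noteq> {}"
  then obtain e where e: "e \<in> path_edges xs" "e \<in> path_edges ys" by blast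
  then obtain x y where "x \<noteq> y" "e = {x, y}" using path_edges_card[OF assms(1)] by metis
  then show False using e assms(2)[of x y] path_edges_subset[OF e(1)] path_edges_subset[OF e(2)] by auto
qed

lemma K33_routesD:
  assumes "K33_routes adj K"
  shows "\<And>i j. i < 3 \<Longrightarrow> j < 3 \<Longrightarrow> route_ok adj (K ! i ! j)"
    "\<And>i j. i < 3 \<Longrightarrow> j < 3 \<Longrightarrow> hd (K ! i ! j) = hd (K ! i ! 0)"
    "\<And>i j. i < 3 \<Longrightarrow> j < 3 \<Longrightarrow> last (K ! i ! j) = last (K ! 0 ! j)"
    "\<And>i j i' j'. i < 3 \<Longrightarrow> j < 3 \<Longrightarrow> i' < 3 \<Longrightarrow> j' < 3 \<Longrightarrow> (i, j) \<noteq> (i', j') \<Longrightarrow>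
      set (K ! i ! j) \<inter> set (K ! i' ! j') \<subseteq>
        (if i = i' then {hd (K ! i ! 0)} else {}) \<union> (if j = j' then {last (K ! 0 ! j)} else {})"
proof -
  note ob = assms[unfolded K33_routes_def ball_upt_3]
  note ob1 = ob[THEN conjunct1] and ob2 = ob[THEN conjunct2]
  fix i j :: nat assume ij: "i < 3" "j < 3"
  show "route_ok adj (K ! i ! j)" "hd (K ! i ! j) = hd (K ! i ! 0)" "last (K ! i ! j) = last (K ! 0 ! j)"
    using ob1 ij by blast+
  fix i' j' assume ij': "i' < 3" "j' < 3" "(i, j) \<noteq> (i', j')"
  show "set (K ! i ! j) \<inter> set (K ! i' ! j') \<subseteq>
        (if i = i' then {hd (K ! i ! 0)} else {}) \<union> (if j = j' then {last (K ! 0 ! j)} else {})"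
  proof
    fix x assume "x \<in> set (K ! i ! j) \<inter> set (K ! i' ! j')"
    then have "(i = i' \<and> x = hd (K ! i ! 0)) \<or> (j = j' \<and> x = last (K ! 0 ! j))"
      using ob2 ij ij' by blast
    then show "x \<in> (if i = i' then {hd (K ! i ! 0)} else {}) \<union> (if j = j' then {last (K ! 0 ! j)} else {})"
      by auto
  qed
qed

lemma K33_routes_arcs:
  fixes g :: "'a set \<Rightarrow> real \<Rightarrow> 's::t2_space"
  assumes d: "drawing_on S V E p g" and K: "K33_routes adj K"
    and V: "\<And>i j. i < 3 \<Longrightarrow> j < 3 \<Longrightarrow> set (K ! i ! j) \<subseteq> V"
    and E: "\<And>x y. x \<in> V \<Longrightarrow> y \<in> V \<Longrightarrow> adj x y \<Longrightarrow> {x, y} \<in> E"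
  obtains k where "K33_arcs (\<lambda>i. p (hd (K ! i ! 0))) (\<lambda>j. p (last (K ! 0 ! j))) k"
    "\<And>i j. i < 3 \<Longrightarrow> j < 3 \<Longrightarrow> path_image (k i j) = route_image g (K ! i ! j)"
proof -
  note KD = K33_routesD[OF K]
  note r = route_okD[OF KD(1) V E]
  have "\<exists>\<gamma>. arc \<gamma> \<and> pathstart \<gamma> = p (hd (K ! i ! 0)) \<and> pathfinish \<gamma> = p (last (K ! 0 ! j)) \<and>
      path_image \<gamma> = route_image g (K ! i ! j)" if "i < 3" "j < 3" for i j
    using route_arc[OF d r[OF that that] V[OF that]] KD(2,3)[OF that] by simp
  then obtain k where k: "\<And>i j. i < 3 \<Longrightarrow> j < 3 \<Longrightarrow> arc (k i j) \<and> pathstart (k i j) = p (hd (K ! i ! 0)) \<and>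
     pathfinish (k i j) = p (last (K ! 0 ! j)) \<and> path_image (k i j) = route_image g (K ! i ! j)" by metis
  have "K33_arcs (\<lambda>i. p (hd (K ! i ! 0))) (\<lambda>j. p (last (K ! 0 ! j))) k"
    unfolding K33_arcs_def
  proof (intro conjI allI impI)
    fix i j i' j' :: nat assume ij: "i < 3" "j < 3" "i' < 3" "j' < 3" "(i, j) \<noteq> (i', j')"
    \<comment> \<open>At most one of \<open>i = i'\<close> and \<open>j = j'\<close> holds, so the
      two routes share at most one vertex and in particular no edge.\<close>
    obtain z where "set (K ! i ! j) \<inter> set (K ! i' ! j') \<subseteq> {z}"
      using KD(4)[OF ij] ij(5) by (cases "i = i'"; cases "j = j'") auto
    then have "path_edges (K ! i ! j) \<inter> path_edges (K ! i' ! j') = {}"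
    proof (intro disjoint_path_edges r(2)[OF ij(1,2,1,2)])
      fix x y assume "x \<noteq> y" "{x, y} \<subseteq> set (K ! i ! j) \<inter> set (K ! i' ! j')"
      with \<open>_ \<subseteq> {z}\<close> have "x = z" "y = z" by auto
      then show "{x, y} \<notin> path_edges (K ! i' ! j')" using \<open>x \<noteq> y\<close> by simp
    qed
    then have "route_image g (K ! i ! j) \<inter> route_image g (K ! i' ! j') \<subseteq> p ` (set (K ! i ! j) \<inter> set (K ! i' ! j'))"
      using ij r(1) by (intro route_image_Int[OF d]) auto
    also have "\<dots> \<subseteq> p ` ((if i = i' then {hd (K ! i ! 0)} else {}) \<union> (if j = j' then {last (K ! 0 ! j)} else {}))"
      using KD(4)[OF ij] by (rule image_mono)
    finally show "path_image (k i j) \<inter> path_image (k i' j') \<subseteq>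
        (if i = i' then {p (hd (K ! i ! 0))} else {}) \<union> (if j = j' then {p (last (K ! 0 ! j))} else {})"
      using k ij by (auto split: if_splits)
  qed (use k in auto)
  then show ?thesis using that k by blast
qed

lemma torus_obstruction_no_drawing:
  assumes d: "drawing_on torus V E p g" and ob: "torus_obstruction_in adj K C D"
    and V: "\<And>i j. i < 3 \<Longrightarrow> j < 3 \<Longrightarrow> set (K ! i ! j) \<subseteq> V"
      "\<And>i. i < 3 \<Longrightarrow> set (C ! i) \<subseteq> V" "\<And>i. i < 3 \<Longrightarrow> set (D ! i) \<subseteq> V"
    and E: "\<And>x y. x \<in> V \<Longrightarrow> y \<in> V \<Longrightarrow> adj x y \<Longrightarrow> {x, y} \<in> E"
  shows False
proof -
  note r = route_okD[OF _ _ E]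
  have arc: "\<exists>\<gamma>. arc \<gamma> \<and> pathstart \<gamma> = p (hd xs) \<and> pathfinish \<gamma> = p (last xs) \<and> path_image \<gamma> = route_image g xs"
    if "route_ok adj xs" "set xs \<subseteq> V" for xs
    using route_arc[OF d r[OF that] that(2)] .
  have I: "route_image g xs \<inter> route_image g ys \<subseteq> p ` (set xs \<inter> set ys)"
    if h: "route_ok adj xs" "set xs \<subseteq> V" "route_ok adj ys" "set ys \<subseteq> V"
      "\<And>x y. x \<noteq> y \<Longrightarrow> {x, y} \<in> path_edges xs \<Longrightarrow> {x, y} \<subseteq> set xs \<inter> set ys \<Longrightarrow> {x, y} \<notin> path_edges ys" for xs ys
    using route_image_Int[OF d r(1)[OF h(1,2)] r(1)[OF h(3,4)] disjoint_path_edges[OF r(2)[OF h(1,2)] h(5)]] .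
  note ob' = ob[unfolded torus_obstruction_in_def ball_upt_3 bex_upt_3]
  note ob1 = ob'[THEN conjunct1] and ob3 = ob'[THEN conjunct2, THEN conjunct1]
    and ob4 = ob'[THEN conjunct2, THEN conjunct2]
  note K = K33_routesD(1)[OF ob1]
  have C: "route_ok adj (C ! i)" "hd (C ! i) = hd (C ! 0)" "last (C ! i) = last (C ! 0)" if "i < 3" for i
    using ob3 that by blast+
  have CK: "set (K ! j ! k) \<inter> set (C ! i) = {}" if "i < 3" "j < 3" "k < 3" for i j k
    using ob3 that by blast
  have CC: "set (C ! i) \<inter> set (C ! j) \<subseteq> {hd (C ! 0), last (C ! 0)}" if "i < 3" "j < 3" "i \<noteq> j" for i j
    using ob3 that by blast
  have D: "route_ok adj (D ! i)" "hd (D ! i) \<in> set (C ! i)" "\<exists>j<3. \<exists>k<3. last (D ! i) \<in> set (K ! j ! k)" if "i < 3" for i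
    using ob4 that by blast+
  have CD: "set (C ! j) \<inter> set (D ! i) = {}" if "i < 3" "j < 3" "i \<noteq> j" for i j
    using ob4 that by blast
  have "\<exists>k. K33_arcs (\<lambda>i. p (hd (K ! i ! 0))) (\<lambda>j. p (last (K ! 0 ! j))) k \<and>
      (\<forall>i<3. \<forall>j<3. path_image (k i j) = route_image g (K ! i ! j))"
    by (rule K33_routes_arcs[OF d ob1 V(1) E]) auto
  then obtain k where kK: "K33_arcs (\<lambda>i. p (hd (K ! i ! 0))) (\<lambda>j. p (last (K ! 0 ! j))) k"
    and k: "\<And>i j. i < 3 \<Longrightarrow> j < 3 \<Longrightarrow> path_image (k i j) = route_image g (K ! i ! j)"
    by blast
  have "\<exists>\<gamma>. arc \<gamma> \<and> pathstart \<gamma> = p (hd (C ! 0)) \<and> pathfinish \<gamma> = p (last (C ! 0)) \<and>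
      path_image \<gamma> = route_image g (C ! i)" if "i < 3" for i
    using arc[OF C(1)[OF that] V(2)[OF that]] C(2,3)[OF that] by simp
  then obtain c where c: "\<And>i. i < 3 \<Longrightarrow> arc (c i) \<and> pathstart (c i) = p (hd (C ! 0)) \<and>
     pathfinish (c i) = p (last (C ! 0)) \<and> path_image (c i) = route_image g (C ! i)" by metis
  obtain e where e: "\<And>i. i < 3 \<Longrightarrow> arc (e i) \<and> pathstart (e i) = p (hd (D ! i)) \<and>
     pathfinish (e i) = p (last (D ! i)) \<and> path_image (e i) = route_image g (D ! i)"
    using arc[OF D(1) V(3)] by metis
  have on_route: "p x \<in> route_image g xs" if h: "route_ok adj xs" "set xs \<subseteq> V" "x \<in> set xs" for xs x
  proof -
    obtain e where "e \<in> path_edges xs" "x \<in> e"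
      using path_edges_cover[OF h(3) r(3)[OF h(1,2)]] by blast
    moreover have "p ` e \<subseteq> path_image (g e)"
      using drawing_onD(6)[OF d, of e] r(1)[OF h(1,2)] calculation by blast
    ultimately show ?thesis by (auto simp: route_image_def)
  qed
  define X where "X = (\<Union>i<3. \<Union>j<3. path_image (k i j))"
  show False
  proof (rule torus_obstruction[of "\<lambda>i. p (hd (K ! i ! 0))" "\<lambda>j. p (last (K ! 0 ! j))" k c
        "p (hd (C ! 0))" "p (last (C ! 0))" e, folded X_def])
    show "K33_arcs (\<lambda>i. p (hd (K ! i ! 0))) (\<lambda>j. p (last (K ! 0 ! j))) k"
      by (rule kK)
    show "path_image (k i j) \<subseteq> torus" if "i < 3" "j < 3" for i j
      using k[OF that] route_image_subset[OF d r(1)[OF K(1) V(1)]] that by auto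
    fix i :: nat assume i: "i < 3"
    show "arc (c i)" "pathstart (c i) = p (hd (C ! 0))" "pathfinish (c i) = p (last (C ! 0))"
      using c[OF i] by auto
    have "route_image g (K ! j ! l) \<inter> route_image g (C ! i) \<subseteq> p ` {}" if "j < 3" "l < 3" for j l
      using I[OF K(1)[OF that] V(1)[OF that] C(1)[OF i] V(2)[OF i]] CK[OF i that] by auto
    then have "path_image (k j l) \<inter> path_image (c i) = {}" if "j < 3" "l < 3" for j l
      using k[OF that] c[OF i] that by auto
    moreover have "path_image (c i) \<subseteq> torus"
      using c[OF i] route_image_subset[OF d r(1)[OF C(1) V(2)]] i by auto
    ultimately show "path_image (c i) \<subseteq> torus - X" unfolding X_def by blast
    show "path (e i)" using e[OF i] arc_imp_path by blast
    show "pathstart (e i) \<in> path_image (c i)"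
      using e[OF i] c[OF i] on_route[OF C(1) V(2) D(2)] i by auto
    show "pathfinish (e i) \<in> X"
    proof -
      obtain j l where jl: "j < 3" "l < 3" "last (D ! i) \<in> set (K ! j ! l)" using D(3)[OF i] by blast
      then have "p (last (D ! i)) \<in> path_image (k j l)"
        using on_route[OF K(1) V(1) jl(3)] k by auto
      then show ?thesis using e[OF i] jl unfolding X_def by auto
    qed
    show "path_image (e i) \<subseteq> torus"
      using e[OF i] route_image_subset[OF d r(1)[OF D(1) V(3)]] i by auto
    fix j :: nat assume j: "j < 3" "i \<noteq> j"
    \<comment> \<open>The ends of the theta graph lie on \<open>C ! j\<close>, which
      \<open>D ! i\<close> avoids, so \<open>D ! i\<close> starts at an inner vertex of
      \<open>C ! i\<close>. Hence \<open>C ! i\<close> is not a single edge, and it has no edge in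
      common with \<open>C ! j\<close> although they share both ends.\<close>
    have w: "hd (D ! i) \<in> set (C ! i)" "hd (D ! i) \<notin> {hd (C ! 0), last (C ! 0)}"
    proof -
      show "hd (D ! i) \<in> set (C ! i)" using D(2) i by auto
      have "C ! j \<noteq> []" "D ! i \<noteq> []" using C(1)[OF j(1)] D(1)[OF i] by (auto simp: route_ok_def)
      then have "hd (C ! 0) \<in> set (C ! j)" "last (C ! 0) \<in> set (C ! j)" "hd (D ! i) \<in> set (D ! i)"
        using C(2,3)[OF j(1)] by (metis hd_in_set, metis last_in_set, simp)
      then show "hd (D ! i) \<notin> {hd (C ! 0), last (C ! 0)}" using CD[OF i j] by auto
    qed
    have "{hd (C ! 0), last (C ! 0)} \<notin> path_edges (C ! i)"
      using path_edges_hd_last[OF r(2)[OF C(1) V(2)], of i] C(2,3)[OF i] w i by auto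
    moreover have "{x, y} = {hd (C ! 0), last (C ! 0)}"
      if "x \<noteq> y" "{x, y} \<subseteq> set (C ! i) \<inter> set (C ! j)" for x y
      using that CC[OF i j] by blast
    ultimately have "route_image g (C ! i) \<inter> route_image g (C ! j) \<subseteq> p ` (set (C ! i) \<inter> set (C ! j))"
      using i j by (intro I C V) metis+
    then show "path_image (c i) \<inter> path_image (c j) \<subseteq> {p (hd (C ! 0)), p (last (C ! 0))}"
      using CC[OF i j] c i j by auto
    have "route_image g (C ! j) \<inter> route_image g (D ! i) \<subseteq> p ` {}"
      using I[OF C(1) V(2) D(1) V(3), of j i] CD[OF i j] i j by auto
    then show "path_image (e i) \<inter> path_image (c j) = {}"
      using e c i j by auto
  qed
qed

lemma torus_obstruction_not_toroidal:
  assumes ob: "torus_obstruction_in adj K C D"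
    and W: "\<And>i j. i < 3 \<Longrightarrow> j < 3 \<Longrightarrow> set (K ! i ! j) \<subseteq> W"
      "\<And>i. i < 3 \<Longrightarrow> set (C ! i) \<subseteq> W" "\<And>i. i < 3 \<Longrightarrow> set (D ! i) \<subseteq> W"
    and \<phi>: "inj_on \<phi> W" "\<phi> ` W \<subseteq> verts G"
    and E: "\<And>x y. x \<in> W \<Longrightarrow> y \<in> W \<Longrightarrow> adj x y \<Longrightarrow> {\<phi> x, \<phi> y} \<in> undirected_edges G"
  shows "\<not> toroidal G"
proof
  assume "toroidal G"
  then obtain p g where d: "drawing_on torus (verts G) (undirected_edges G) p g"
    unfolding toroidal_def by blast
  have "drawing_on torus W {{x, y} |x y. x \<in> W \<and> y \<in> W \<and> adj x y} (p \<circ> \<phi>) (\<lambda>e. g (\<phi> ` e))"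
    by (rule drawing_on_subgraph[OF d \<phi>]) (use E in auto)
  then show False by (rule torus_obstruction_no_drawing[OF _ ob W]) auto
qed

section \<open>Inversions and Bruhat intervals\<close>

text \<open>The positions are arbitrary natural numbers: a permutation of {1..n} fixes all other
  points and has no inversion involving them.\<close>

definition inversions :: "(nat \<Rightarrow> nat) \<Rightarrow> (nat \<times> nat) set" where
  "inversions p = {(a, b). a < b \<and> p b < p a}"

lemma inversion_range:
  fixes p :: "nat \<Rightarrow> nat"
  assumes "p permutes {1..n}" "i < j" "p j < p i"
  shows "i \<in> {1..n}" "j \<in> {1..n}"
proof -
  have in_iff: "p x \<in> {1..n} \<longleftrightarrow> x \<in> {1..n}" for x using permutes_in_image[OF assms(1)] .
  have out: "p x = x" if "x \<notin> {1..n}" for x using permutes_not_in[OF assms(1) that] .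
  have "i \<noteq> 0" using out[of 0] assms by (auto intro!: gr0I)
  moreover have "j \<le> n"
  proof (rule ccontr)
    assume j: "\<not> j \<le> n"
    then have "p j = j" using out by simp
    then show False using in_iff[of i] out[of i] assms j by (cases "i \<in> {1..n}") auto
  qed
  ultimately show "i \<in> {1..n}" "j \<in> {1..n}" using assms by auto
qed

lemma finite_inversions:
  assumes "p permutes {1..n}" shows "finite (inversions p)"
proof (rule finite_subset)
  show "inversions p \<subseteq> {1..n} \<times> {1..n}"
    using inversion_range[OF assms] by (auto simp: inversions_def simp del: atLeastAtMost_iff)
qed simp

text \<open>\<open>F\<close> injects the inversions of \<open>p \<circ> t\<close> into those of
  \<open>p\<close> other than \<open>(i, j)\<close>. A pair whose order \<open>t\<close> respects is
  moved by \<open>t\<close>; any other pair is kept. A kept pair is \<open>(i, b)\<close> or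
  \<open>(a, j)\<close> with its other entry between \<open>i\<close> and \<open>j\<close>, and
  \<open>p j < p i\<close> makes it an inversion of \<open>p\<close> too.\<close>

lemma card_inversions_transpose_less:
  assumes fin: "finite (inversions p)" and ij: "i < j" "p j < p i"
  shows "card (inversions (p \<circ> Transposition.transpose i j)) < card (inversions p)"
proof -
  define t where "t = Transposition.transpose i j"
  define F where "F = (\<lambda>(a, b). if t a < t b then (t a, t b) else (a, b))"
  have tt: "t (t x) = x" for x by (simp add: t_def)
  have t: "t i = j" "t j = i" "\<And>x. x \<noteq> i \<Longrightarrow> x \<noteq> j \<Longrightarrow> t x = x" by (auto simp: t_def)
  have t_eq: "t x = t y \<longleftrightarrow> x = y" for x y by (metis tt)
  have inj: "inj_on F {(a, b). a < b}"
  proof (rule inj_onI, clarsimp)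
    fix a b c d :: nat
    assume "F (a, b) = F (c, d)" "a < b" "c < d"
    then show "a = c \<and> b = d"
      by (cases "t a < t b"; cases "t c < t d") (auto simp: F_def t_eq tt)
  qed
  have "F ` inversions (p \<circ> t) \<subseteq> inversions p - {(i, j)}"
  proof clarsimp
    fix a b assume ab: "(a, b) \<in> inversions (p \<circ> t)"
    then have l: "a < b" "p (t b) < p (t a)" by (auto simp: inversions_def)
    show "F (a, b) \<in> inversions p \<and> F (a, b) \<noteq> (i, j)"
    proof (cases "t a < t b")
      case True
      have "(t a, t b) \<noteq> (i, j)" using l(1) ij(1) t(1,2) tt by (metis less_asym prod.inject)
      then show ?thesis using True l by (auto simp: F_def inversions_def)
    next
      case False
      consider "a = i" "b = j" | "a = i" "b \<noteq> j" | "a \<noteq> i" "b = j" | "a \<noteq> i" "b \<noteq> j" by blast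
      then show ?thesis
      proof cases
        case 1
        then show ?thesis using l ij t(1,2) by simp
      next
        case 2
        then have b: "t a = j" "t b = b" using l t(1) t(3)[of b] by auto
        then show ?thesis using 2 False l ij by (auto simp: F_def inversions_def)
      next
        case 3
        then have a: "t b = i" "t a = a" using l t(2) t(3)[of a] by auto
        then show ?thesis using 3 False l ij by (auto simp: F_def inversions_def)
      next
        case 4
        have "t a \<le> a"
        proof (cases "a = j")
          case False
          then show ?thesis using 4 t(3)[of a] by simp
        qed (use t(2) ij in simp)
        moreover have "b \<le> t b"
        proof (cases "b = i")
          case False
          then show ?thesis using 4 t(3)[of b] by simp
        qed (use t(1) ij in simp)
        ultimately show ?thesis using False l by linarith
      qed
    qed
  qed
  moreover have "(i, j) \<in> inversions p" using ij by (auto simp: inversions_def)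
  ultimately have sub: "F ` inversions (p \<circ> t) \<subset> inversions p" by blast
  have "card (inversions (p \<circ> t)) = card (F ` inversions (p \<circ> t))"
    by (rule card_image[symmetric], rule inj_on_subset[OF inj]) (auto simp: inversions_def)
  also have "\<dots> < card (inversions p)" using fin sub by (rule psubset_card_mono)
  finally show ?thesis by (simp add: t_def)
qed

text \<open>The transposition reverses the order of no pair except \<open>(i, Suc i)\<close>, so it
  matches all remaining inversions one to one.\<close>

lemma card_inversions_adjacent:
  assumes fin: "finite (inversions p)" and d: "p (Suc i) < p i"
  shows "card (inversions p) = Suc (card (inversions (p \<circ> Transposition.transpose i (Suc i))))"
proof -
  define t where "t = Transposition.transpose i (Suc i)"
  have tt: "t (t x) = x" for x by (simp add: t_def)
  have t: "t x = (if x = i then Suc i else if x = Suc i then i else x)" for x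
    by (auto simp: t_def Transposition.transpose_def)
  have mono: "t a < t b" if "a < b" "(a, b) \<noteq> (i, Suc i)" for a b
    using that unfolding t by (auto split: if_splits)
  have "bij_betw (map_prod t t) (inversions (p \<circ> t)) (inversions p - {(i, Suc i)})"
  proof (rule bij_betw_byWitness[where f' = "map_prod t t"])
    show "map_prod t t ` inversions (p \<circ> t) \<subseteq> inversions p - {(i, Suc i)}"
    proof clarsimp
      fix a b assume "(a, b) \<in> inversions (p \<circ> t)"
      then have l: "a < b" "p (t b) < p (t a)" by (auto simp: inversions_def)
      then have ne: "(a, b) \<noteq> (i, Suc i)" using t[of i] t[of "Suc i"] d by auto
      have "t b \<noteq> Suc i" if "t a = i"
      proof
        assume "t b = Suc i"
        then have "a = Suc i" "b = i" using that tt[of a] tt[of b] t[of i] t[of "Suc i"] by auto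
        then show False using l(1) by simp
      qed
      then show "(t a, t b) \<in> inversions p \<and> (t a = i \<longrightarrow> t b \<noteq> Suc i)"
        using mono[OF l(1) ne] l(2) by (auto simp: inversions_def)
    qed
    show "map_prod t t ` (inversions p - {(i, Suc i)}) \<subseteq> inversions (p \<circ> t)"
    proof (rule image_subsetI)
      fix x assume "x \<in> inversions p - {(i, Suc i)}"
      then show "map_prod t t x \<in> inversions (p \<circ> t)"
        using mono[of "fst x" "snd x"] by (auto simp: inversions_def tt)
    qed
  qed (auto simp: tt)
  then have "card (inversions (p \<circ> t)) = card (inversions p - {(i, Suc i)})" by (rule bij_betw_same_card)
  moreover have "(i, Suc i) \<in> inversions p" using d by (auto simp: inversions_def)
  ultimately show ?thesis using card_Suc_Diff1[OF fin, of "(i, Suc i)"] by (simp add: t_def)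
qed

section \<open>Length as the number of inversions\<close>

lemma adj_word_append: "adj_word (xs @ ys) = adj_word xs \<circ> adj_word ys"
  by (induction xs) (auto simp: adj_word_def)

lemma adj_word_snoc: "adj_word (xs @ [i]) = adj_word xs \<circ> Transposition.transpose i (Suc i)"
  by (simp add: adj_word_append) (simp add: adj_word_def)

lemma adjacent_transpose_permutes:
  "i \<in> {1..<n} \<Longrightarrow> Transposition.transpose i (Suc i) permutes {1..n}"
  by (intro permutes_swap_id) auto

lemma adj_word_permutes: "set is \<subseteq> {1..<n} \<Longrightarrow> adj_word is permutes {1..n}"
proof (induction "is" rule: rev_induct)
  case Nil
  have "adj_word [] = id" by (simp add: adj_word_def)
  then show ?case by (simp only: permutes_id)
next
  case (snoc i "is")
  then show ?case unfolding adj_word_snoc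
    by (intro permutes_compose adjacent_transpose_permutes) auto
qed

text \<open>Either \<open>p\<close> or \<open>p \<circ> t\<close> has a descent at \<open>i\<close>,
  so one more letter changes the number of inversions by exactly one, up or down.\<close>

lemma card_inversions_adj_word_le:
  "set is \<subseteq> {1..<n} \<Longrightarrow> card (inversions (adj_word is)) \<le> length is"
proof (induction "is" rule: rev_induct)
  case Nil
  have "inversions (adj_word []) = {}" by (auto simp: inversions_def adj_word_def)
  then show ?case by simp
next
  case (snoc i "is")
  define p where "p = adj_word is"
  define t where "t = Transposition.transpose i (Suc i)"
  have p: "p permutes {1..n}" unfolding p_def using snoc.prems by (intro adj_word_permutes) auto
  have pt: "p \<circ> t permutes {1..n}" unfolding t_def using p snoc.prems by (intro permutes_compose adjacent_transpose_permutes) auto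
  have "p i \<noteq> p (Suc i)" by (simp add: inj_eq[OF permutes_inj[OF p]])
  then have "p (Suc i) < p i \<or> (p \<circ> t) (Suc i) < (p \<circ> t) i" by (simp add: t_def) linarith
  then consider "p (Suc i) < p i" | "(p \<circ> t) (Suc i) < (p \<circ> t) i" by blast
  then have "card (inversions (p \<circ> t)) \<le> Suc (card (inversions p))"
  proof cases
    case 1
    then show ?thesis using card_inversions_adjacent[OF finite_inversions[OF p] 1] by (simp add: t_def)
  next
    case 2
    have tt: "p \<circ> t \<circ> t = p" by (rule ext) (simp add: t_def)
    have "card (inversions (p \<circ> t)) = Suc (card (inversions p))"
      using card_inversions_adjacent[OF finite_inversions[OF pt] 2, folded t_def] unfolding tt .
    then show ?thesis by simp
  qed
  moreover have "card (inversions p) \<le> length is" using snoc by (simp add: p_def)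
  ultimately have "card (inversions (p \<circ> t)) \<le> Suc (length is)" by linarith
  then show ?case by (simp only: adj_word_snoc length_append_singleton p_def t_def)
qed

text \<open>\<open>p\<close> and its inverse are increasing, so \<open>x\<close> is at most
  \<open>p x\<close> and at most \<open>inv p x\<close>; applying \<open>p\<close> to the second
  inequality gives the reverse of the first.\<close>

lemma permutes_strict_mono_eq_id:
  fixes p :: "nat \<Rightarrow> nat"
  assumes "p permutes S" "strict_mono p"
  shows "p = id"
proof
  fix x
  have "strict_mono (inv p)"
  proof (rule strict_monoI)
    fix a b :: nat assume "a < b"
    have "p (inv p a) = a" "p (inv p b) = b" using permutes_inverses[OF assms(1)] by auto
    then show "inv p a < inv p b" using \<open>a < b\<close> strict_mono_less[OF assms(2)] by metis
  qed
  then have "x \<le> inv p x" by (rule strict_mono_imp_increasing)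
  then have "p x \<le> p (inv p x)" using strict_mono_less_eq[OF assms(2)] by blast
  then have "p x \<le> x" using permutes_inverses[OF assms(1)] by simp
  then show "p x = id x" using strict_mono_imp_increasing[OF assms(2), of x] by simp
qed

lemma ex_descent:
  assumes p: "p permutes {1..n}" and ne: "p \<noteq> id"
  obtains i where "i \<in> {1..<n}" "p (Suc i) < p i"
proof -
  have "\<not> strict_mono p" using permutes_strict_mono_eq_id[OF p] ne by blast
  then obtain i where "\<not> p i < p (Suc i)" unfolding strict_mono_Suc_iff by blast
  moreover have "p i \<noteq> p (Suc i)" using permutes_inj[OF p] by (metis injD n_not_Suc_n)
  ultimately have d: "p (Suc i) < p i" by simp
  have "i \<in> {1..n}" "Suc i \<in> {1..n}" using inversion_range[OF p lessI d] .
  then show ?thesis using that[OF _ d] by simp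
qed

text \<open>Sorting by adjacent swaps: each descent undone removes one inversion and contributes one
  letter.\<close>

lemma ex_adj_word:
  assumes "p permutes {1..n}"
  shows "\<exists>is. length is = card (inversions p) \<and> set is \<subseteq> {1..<n} \<and> adj_word is = p"
  using assms
proof (induction "card (inversions p)" arbitrary: p)
  case 0
  then have "inversions p = {}" using finite_inversions by auto
  then have "p = id" using ex_descent[OF 0(2)] by (force simp: inversions_def)
  then show ?case using 0 by (intro exI[of _ "[]"]) (auto simp: adj_word_def)
next
  case (Suc m)
  have "p \<noteq> id"
  proof
    assume "p = id"
    then have "inversions p = {}" by (auto simp: inversions_def)
    then show False using Suc(2) by simp
  qed
  then obtain i where i: "i \<in> {1..<n}" "p (Suc i) < p i" using ex_descent[OF Suc(3)] by blast
  define t where "t = Transposition.transpose i (Suc i)"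
  have pt: "p \<circ> t permutes {1..n}"
    unfolding t_def using Suc(3) i by (intro permutes_compose adjacent_transpose_permutes) auto
  have "m = card (inversions (p \<circ> t))"
    using card_inversions_adjacent[OF finite_inversions[OF Suc(3)] i(2)] Suc(2) by (simp add: t_def)
  then obtain js where js: "length js = card (inversions (p \<circ> t))" "set js \<subseteq> {1..<n}" "adj_word js = p \<circ> t"
    using Suc(1)[OF _ pt] by blast
  have "adj_word (js @ [i]) = p" unfolding adj_word_snoc js(3) by (simp add: t_def comp_assoc)
  then show ?case using js i Suc(2) \<open>m = _\<close> by (intro exI[of _ "js @ [i]"]) auto
qed

lemma perm_length_eq_card_inversions:
  assumes "p permutes {1..n}"
  shows "perm_length n p = card (inversions p)"
  unfolding perm_length_def
proof (rule Least_equality)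
  show "\<exists>is. length is = card (inversions p) \<and> set is \<subseteq> {1..<n} \<and> adj_word is = p"
    using ex_adj_word[OF assms] .
  show "card (inversions p) \<le> m" if "\<exists>is. length is = m \<and> set is \<subseteq> {1..<n} \<and> adj_word is = p" for m
    using that card_inversions_adj_word_le by blast
qed

lemma transpose_permutes_range:
  assumes "t permutes {1..n}" "t \<circ> Transposition.transpose i j permutes {1..n}" "i \<noteq> j"
  shows "i \<in> {1..n}"
proof (rule ccontr)
  assume "i \<notin> {1..n}"
  then have "t i = i" "t j = i"
    using permutes_not_in[OF assms(1), of i] permutes_not_in[OF assms(2), of i] by auto
  then have "t i = t j" by simp
  then show False using assms(3) by (simp add: inj_eq[OF permutes_inj[OF assms(1)]])
qed

text \<open>This trades the comparison of lengths for a single inversion. If \<open>(i, j)\<close>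
  were not an inversion of \<open>t\<close>, it would be one of \<open>s\<close>, and swapping it
  back would make \<open>t\<close> the shorter of the two.\<close>

lemma bruhat_step_iff:
  "bruhat_step n s t \<longleftrightarrow> t permutes {1..n} \<and> (\<exists>i j. i < j \<and> t j < t i \<and> s = t \<circ> Transposition.transpose i j)"
proof
  assume L: "bruhat_step n s t"
  then obtain i j where ij: "i \<noteq> j" "s = t \<circ> Transposition.transpose i j"
    and p: "t permutes {1..n}" "s permutes {1..n}" and l: "perm_length n s < perm_length n t"
    unfolding bruhat_step_def by blast
  have l': "card (inversions s) < card (inversions t)"
    using l p by (simp add: perm_length_eq_card_inversions)
  have "\<exists>i j. i < j \<and> s = t \<circ> Transposition.transpose i j"
    using ij by (metis linorder_neqE_nat transpose_commute)
  then obtain i j where ij: "i < j" "s = t \<circ> Transposition.transpose i j" by blast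
  have "t j < t i"
  proof (rule ccontr)
    assume "\<not> t j < t i"
    moreover have "t i \<noteq> t j" using ij by (simp add: inj_eq[OF permutes_inj[OF p(1)]])
    ultimately have "s j < s i" using ij by simp
    then have "card (inversions (s \<circ> Transposition.transpose i j)) < card (inversions s)"
      by (rule card_inversions_transpose_less[OF finite_inversions[OF p(2)] ij(1)])
    then show False using l' ij by (simp add: comp_assoc)
  qed
  then show "t permutes {1..n} \<and> (\<exists>i j. i < j \<and> t j < t i \<and> s = t \<circ> Transposition.transpose i j)"
    using ij p by blast
next
  assume "t permutes {1..n} \<and> (\<exists>i j. i < j \<and> t j < t i \<and> s = t \<circ> Transposition.transpose i j)"
  then obtain i j where t: "t permutes {1..n}" and ij: "i < j" "t j < t i" "s = t \<circ> Transposition.transpose i j" by blast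
  note r = inversion_range[OF t ij(1,2)]
  have s: "s permutes {1..n}" unfolding ij(3) using t r by (intro permutes_compose permutes_swap_id) auto
  have "card (inversions s) < card (inversions t)"
    unfolding ij(3) by (rule card_inversions_transpose_less[OF finite_inversions[OF t] ij(1,2)])
  then show "bruhat_step n s t"
    unfolding bruhat_step_def
  proof (intro conjI)
    show "\<exists>i\<in>{1..n}. \<exists>j\<in>{1..n}. i \<noteq> j \<and> s = t \<circ> Transposition.transpose i j"
      using r ij by (intro bexI[of _ i] bexI[of _ j]) auto
  qed (use s t in \<open>simp_all add: perm_length_eq_card_inversions\<close>)
qed

section \<open>Bruhat intervals and the underlying undirected graph\<close>

definition bruhat_interval :: "nat \<Rightarrow> (nat \<Rightarrow> nat) \<Rightarrow> (nat \<Rightarrow> nat) set" where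
  "bruhat_interval n \<sigma> = {s. s permutes {1..n} \<and> bruhat_le n s \<sigma>}"

text \<open>Adjacency without direction: of two permutations that differ by a transposition one is
  always a Bruhat step below the other, so lengths no longer occur.\<close>

definition reflection_adj :: "(nat \<Rightarrow> nat) \<Rightarrow> (nat \<Rightarrow> nat) \<Rightarrow> bool" where
  "reflection_adj u v \<longleftrightarrow> (\<exists>i j. i \<noteq> j \<and> u = v \<circ> Transposition.transpose i j)"

lemma reflection_adj_sym: "reflection_adj u v \<Longrightarrow> reflection_adj v u"
  unfolding reflection_adj_def by (metis comp_assoc comp_id transpose_comp_involutory)

lemma bruhat_le_refl: "bruhat_le n s s"
  by (simp add: bruhat_le_def)

lemma bruhat_le_step: "bruhat_step n s t \<Longrightarrow> bruhat_le n t u \<Longrightarrow> bruhat_le n s u"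
  unfolding bruhat_le_def by (rule converse_rtranclp_into_rtranclp)

lemma bruhat_le_trans: "bruhat_le n s t \<Longrightarrow> bruhat_le n t u \<Longrightarrow> bruhat_le n s u"
  unfolding bruhat_le_def by (rule rtranclp_trans)

lemma bruhat_le_induct [consumes 1, case_names refl step]:
  assumes "bruhat_le n s u" "P u" "\<And>s t. bruhat_step n s t \<Longrightarrow> bruhat_le n t u \<Longrightarrow> P t \<Longrightarrow> P s"
  shows "P s"
  using assms unfolding bruhat_le_def by (induction rule: converse_rtranclp_induct) blast+

lemma bruhat_step_permutes: "bruhat_step n s t \<Longrightarrow> s permutes {1..n}" "bruhat_step n s t \<Longrightarrow> t permutes {1..n}"
  unfolding bruhat_step_def by auto

lemma bruhat_le_permutes: "bruhat_le n s u \<Longrightarrow> u permutes {1..n} \<Longrightarrow> s permutes {1..n}"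
  by (induction rule: bruhat_le_induct) (auto dest: bruhat_step_permutes)

lemma verts_bruhat_graph [simp]: "verts (bruhat_graph n \<sigma>) = bruhat_interval n \<sigma>"
  by (simp add: bruhat_graph_def bruhat_interval_def)

lemma undirected_edges_bruhat_graph:
  "undirected_edges (bruhat_graph n \<sigma>) =
     {{u, v} |u v. u \<in> bruhat_interval n \<sigma> \<and> v \<in> bruhat_interval n \<sigma> \<and> reflection_adj u v}"
proof -
  have "undirected_edges (bruhat_graph n \<sigma>) =
     {{u, v} |u v. u \<in> bruhat_interval n \<sigma> \<and> v \<in> bruhat_interval n \<sigma> \<and> bruhat_step n u v}"
    unfolding undirected_edges_def bruhat_graph_def bruhat_graph_Sn_def bruhat_interval_def
    by (auto simp: induce_subgraph_def)
  also have "\<dots> = {{u, v} |u v. u \<in> bruhat_interval n \<sigma> \<and> v \<in> bruhat_interval n \<sigma> \<and> reflection_adj u v}"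
  proof (intro equalityI subsetI)
    fix e assume "e \<in> {{u, v} |u v. u \<in> bruhat_interval n \<sigma> \<and> v \<in> bruhat_interval n \<sigma> \<and> bruhat_step n u v}"
    then show "e \<in> {{u, v} |u v. u \<in> bruhat_interval n \<sigma> \<and> v \<in> bruhat_interval n \<sigma> \<and> reflection_adj u v}"
      unfolding bruhat_step_def reflection_adj_def by blast
  next
    fix e assume "e \<in> {{u, v} |u v. u \<in> bruhat_interval n \<sigma> \<and> v \<in> bruhat_interval n \<sigma> \<and> reflection_adj u v}"
    then obtain u v where e: "e = {u, v}" and uv: "u \<in> bruhat_interval n \<sigma>" "v \<in> bruhat_interval n \<sigma>"
      and "reflection_adj u v" by blast
    then obtain i j where ij: "i < j" "u = v \<circ> Transposition.transpose i j"
      unfolding reflection_adj_def by (metis linorder_neqE_nat transpose_commute)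
    have p: "u permutes {1..n}" "v permutes {1..n}" using uv by (auto simp: bruhat_interval_def)
    have "v i \<noteq> v j" using ij by (simp add: inj_eq[OF permutes_inj[OF p(2)]])
    then consider "v j < v i" | "v i < v j" by linarith
    then have "bruhat_step n u v \<or> bruhat_step n v u"
    proof cases
      case 1
      then show ?thesis using p ij unfolding bruhat_step_iff by blast
    next
      case 2
      then have "u j < u i" using ij by simp
      moreover have "v = u \<circ> Transposition.transpose i j" using ij by (simp add: comp_assoc)
      ultimately show ?thesis using p ij unfolding bruhat_step_iff by blast
    qed
    then show "e \<in> {{u, v} |u v. u \<in> bruhat_interval n \<sigma> \<and> v \<in> bruhat_interval n \<sigma> \<and> bruhat_step n u v}"
      using e uv by (auto simp: insert_commute)
  qed
  finally show ?thesis .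
qed

section \<open>Embeddings between Bruhat graphs\<close>

lemma toroidal_embed:
  assumes "toroidal G" "inj_on \<phi> (verts H)" "\<phi> ` verts H \<subseteq> verts G"
    and "\<And>e. e \<in> undirected_edges H \<Longrightarrow> e \<subseteq> verts H \<and> \<phi> ` e \<in> undirected_edges G"
  shows "toroidal H"
  using assms drawing_on_subgraph unfolding toroidal_def by metis

lemma toroidal_bruhat_embed:
  assumes t: "toroidal (bruhat_graph n \<sigma>)"
    and R: "inj_on R (bruhat_interval k \<pi>)" "\<And>u. u \<in> bruhat_interval k \<pi> \<Longrightarrow> R u \<in> bruhat_interval n \<sigma>"
    and adj: "\<And>u v. u \<in> bruhat_interval k \<pi> \<Longrightarrow> v \<in> bruhat_interval k \<pi> \<Longrightarrow> reflection_adj u v \<Longrightarrow> reflection_adj (R u) (R v)"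
  shows "toroidal (bruhat_graph k \<pi>)"
proof (rule toroidal_embed[OF t, of R])
  show "inj_on R (verts (bruhat_graph k \<pi>))" "R ` verts (bruhat_graph k \<pi>) \<subseteq> verts (bruhat_graph n \<sigma>)"
    using R by auto
  fix e assume "e \<in> undirected_edges (bruhat_graph k \<pi>)"
  then obtain u v where e: "e = {u, v}" "u \<in> bruhat_interval k \<pi>" "v \<in> bruhat_interval k \<pi>" "reflection_adj u v"
    unfolding undirected_edges_bruhat_graph by blast
  then have "R ` e = {R u, R v}" "R u \<in> bruhat_interval n \<sigma>" "R v \<in> bruhat_interval n \<sigma>" "reflection_adj (R u) (R v)"
    using R adj by auto
  then show "e \<subseteq> verts (bruhat_graph k \<pi>) \<and> R ` e \<in> undirected_edges (bruhat_graph n \<sigma>)"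
    using e unfolding undirected_edges_bruhat_graph by auto
qed

lemma toroidal_bruhat_le:
  assumes "toroidal (bruhat_graph n \<sigma>)" "bruhat_le n \<pi> \<sigma>"
  shows "toroidal (bruhat_graph n \<pi>)"
  by (rule toroidal_bruhat_embed[OF assms(1), of id])
     (use assms(2) in \<open>auto simp: bruhat_interval_def intro: bruhat_le_trans\<close>)

text \<open>\<open>h w\<close> acts on the chosen positions \<open>f 1, ..., f k\<close> as
  \<open>w\<close> acts on {1..k} and fixes the rest. So \<open>R u\<close> rearranges the values of
  \<open>\<sigma>\<close> at the chosen positions into the relative order \<open>u\<close>, with
  \<open>R \<pi> = \<sigma>\<close>. A transposition of \<open>a\<close> and \<open>b\<close>
  becomes that of \<open>f a\<close> and \<open>f b\<close>, and inversions are preserved, so Bruhat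
  steps go to Bruhat steps.\<close>

lemma toroidal_bruhat_pattern:
  assumes t: "toroidal (bruhat_graph n \<sigma>)" and c: "contains_pattern n \<sigma> k \<pi>"
    and \<sigma>: "\<sigma> permutes {1..n}" and \<pi>: "\<pi> permutes {1..k}"
  shows "toroidal (bruhat_graph k \<pi>)"
proof -
  obtain f where f: "strict_mono_on {1..k} f" "f ` {1..k} \<subseteq> {1..n}"
    and ord: "\<And>a b. a \<in> {1..k} \<Longrightarrow> b \<in> {1..k} \<Longrightarrow> \<sigma> (f a) < \<sigma> (f b) \<longleftrightarrow> \<pi> a < \<pi> b"
    using c unfolding contains_pattern_def by blast
  have inj: "inj_on f {1..k}" using f(1) strict_mono_on_imp_inj_on by blast
  have fi: "the_inv_into {1..k} f (f a) = a" if "a \<in> {1..k}" for a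
    using the_inv_into_f_f[OF inj that] .
  define h where "h w x = (if x \<in> f ` {1..k} then f (w (the_inv_into {1..k} f x)) else x)" for w :: "nat \<Rightarrow> nat" and x
  have h: "h w (f a) = f (w a)" if "a \<in> {1..k}" for w a using that fi by (simp add: h_def)
  have h_out: "h w x = x" if "x \<notin> f ` {1..k}" for w x using that by (simp add: h_def)
  have h_perm: "h w permutes {1..n}" if w: "w permutes {1..k}" for w
  proof (rule bij_imp_permutes)
    have w_in: "w a \<in> {1..k}" if "a \<in> {1..k}" for a using permutes_in_image[OF w] that by blast
    have "h w x \<in> {1..n}" if x: "x \<in> {1..n}" for x
    proof (cases "x \<in> f ` {1..k}")
      case True
      then obtain a where a: "a \<in> {1..k}" "x = f a" by blast
      then have "h w x = f (w a)" using h by simp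
      then show ?thesis using w_in[OF a(1)] f(2) by blast
    qed (use h_out x in simp)
    moreover have "inj_on (h w) {1..n}"
    proof (rule inj_onI)
      fix x y assume xy: "h w x = h w y"
      have *: "h w x \<in> f ` {1..k} \<longleftrightarrow> x \<in> f ` {1..k}" for x
      proof (cases "x \<in> f ` {1..k}")
        case True
        then obtain a where a: "a \<in> {1..k}" "x = f a" by blast
        then have "h w x = f (w a)" using h by simp
        then show ?thesis using w_in[OF a(1)] True by blast
      qed (use h_out in auto)
      show "x = y"
      proof (cases "x \<in> f ` {1..k}")
        case True
        then obtain a b where a: "a \<in> {1..k}" "b \<in> {1..k}" "x = f a" "y = f b" using * xy by (metis imageE)
        then have "f (w a) = f (w b)" using xy h by simp
        then have "w a = w b" using inj_onD[OF inj] w_in a by blast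
        then show ?thesis using a by (simp add: inj_eq[OF permutes_inj[OF w]])
      qed (use * xy h_out in metis)
    qed
    ultimately show "bij_betw (h w) {1..n} {1..n}"
      unfolding bij_betw_def by (intro conjI endo_inj_surj image_subsetI) auto
    show "h w x = x" if "x \<notin> {1..n}" for x using h_out f(2) that by blast
  qed
  have h_comp: "h (w \<circ> Transposition.transpose a b) = h w \<circ> Transposition.transpose (f a) (f b)"
    if ab: "a \<in> {1..k}" "b \<in> {1..k}" for w a b
  proof
    fix x
    show "h (w \<circ> Transposition.transpose a b) x = (h w \<circ> Transposition.transpose (f a) (f b)) x"
    proof (cases "x \<in> f ` {1..k}")
      case True
      then obtain c where c: "c \<in> {1..k}" "x = f c" by blast
      have e: "f c = f a \<longleftrightarrow> c = a" "f c = f b \<longleftrightarrow> c = b" using inj_on_eq_iff[OF inj] c(1) ab by blast+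
      consider "c = a" | "c = b" "c \<noteq> a" | "c \<noteq> a" "c \<noteq> b" by blast
      then show ?thesis
      proof cases
        case 1
        then show ?thesis using c(2) h[OF ab(1)] h[OF ab(2)] by simp
      next
        case 2
        then show ?thesis using c(2) h[OF ab(1)] h[OF ab(2)] by simp
      next
        case 3
        then show ?thesis using e c(2) h[OF c(1)] by simp
      qed
    next
      case False
      then have "x \<noteq> f a" "x \<noteq> f b" using ab by auto
      then show ?thesis using h_out[OF False] by simp
    qed
  qed
  define R where "R u = \<sigma> \<circ> h (inv \<pi> \<circ> u)" for u
  have inv_in: "inv \<pi> a \<in> {1..k} \<longleftrightarrow> a \<in> {1..k}" for a
    using permutes_in_image[OF permutes_inv[OF \<pi>]] .
  have inv\<pi>: "\<pi> (inv \<pi> a) = a" for a using permutes_inverses[OF \<pi>] by simp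
  have R_perm: "R u permutes {1..n}" if "u permutes {1..k}" for u
    unfolding R_def using that \<sigma> \<pi> by (intro permutes_compose h_perm permutes_inv) auto
  have R_comp: "R (u \<circ> Transposition.transpose a b) = R u \<circ> Transposition.transpose (f a) (f b)"
    if "a \<in> {1..k}" "b \<in> {1..k}" for u a b
    unfolding R_def using h_comp[OF that, of "inv \<pi> \<circ> u"] by (simp add: comp_assoc)
  have R\<pi>: "R \<pi> = \<sigma>"
  proof -
    have "h id x = x" for x
    proof (cases "x \<in> f ` {1..k}")
      case True
      then obtain c where "c \<in> {1..k}" "x = f c" by blast
      then show ?thesis using h by simp
    qed (use h_out in simp)
    then have "h id = id" by auto
    moreover have "inv \<pi> \<circ> \<pi> = id" using permutes_inv_o[OF \<pi>] by simp
    ultimately show ?thesis by (simp add: R_def)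
  qed
  have R_less: "R u (f a) < R u (f b) \<longleftrightarrow> u a < u b"
    if u: "u permutes {1..k}" and ab: "a \<in> {1..k}" "b \<in> {1..k}" for u a b
  proof -
    have "u a \<in> {1..k}" "u b \<in> {1..k}" using permutes_in_image[OF u] ab by blast+
    then show ?thesis using ab h ord inv_in inv\<pi> by (simp add: R_def del: atLeastAtMost_iff)
  qed
  have step: "bruhat_step n (R u) (R v)" if s: "bruhat_step k u v" for u v
  proof -
    obtain i j where v: "v permutes {1..k}" and ij: "i < j" "v j < v i" "u = v \<circ> Transposition.transpose i j"
      using s unfolding bruhat_step_iff by blast
    note r = inversion_range[OF v ij(1,2)]
    have "f i < f j" using f(1) r ij by (auto simp: strict_mono_on_def simp del: atLeastAtMost_iff)
    moreover have "R v (f j) < R v (f i)" using R_less[OF v] r ij by blast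
    ultimately show ?thesis
      unfolding bruhat_step_iff ij(3) R_comp[OF r] using R_perm[OF v] by blast
  qed
  have le: "bruhat_le n (R u) \<sigma>" if "bruhat_le k u \<pi>" for u
    using that
  proof (induction rule: bruhat_le_induct)
    case refl
    show ?case by (simp add: R\<pi> bruhat_le_refl)
  qed (use step bruhat_le_step in blast)
  show ?thesis
  proof (rule toroidal_bruhat_embed[OF t, of R])
    show "inj_on R (bruhat_interval k \<pi>)"
    proof (rule inj_onI)
      fix u v assume "u \<in> bruhat_interval k \<pi>" "v \<in> bruhat_interval k \<pi>" and eq: "R u = R v"
      then have p: "u permutes {1..k}" "v permutes {1..k}" by (auto simp: bruhat_interval_def)
      show "u = v"
      proof
        fix a
        show "u a = v a"
        proof (cases "a \<in> {1..k}")
          case True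
          have "\<sigma> (f (inv \<pi> (u a))) = \<sigma> (f (inv \<pi> (v a)))"
            using fun_cong[OF eq, of "f a"] h[OF True] by (simp add: R_def)
          then have "f (inv \<pi> (u a)) = f (inv \<pi> (v a))" by (simp add: inj_eq[OF permutes_inj[OF \<sigma>]])
          moreover have "inv \<pi> (u a) \<in> {1..k}" "inv \<pi> (v a) \<in> {1..k}"
            using inv_in permutes_in_image[OF p(1)] permutes_in_image[OF p(2)] True by blast+
          ultimately show ?thesis using inj inv\<pi> by (metis inj_on_eq_iff)
        qed (use p permutes_not_in in metis)
      qed
    qed
    show "R u \<in> bruhat_interval n \<sigma>" if "u \<in> bruhat_interval k \<pi>" for u
      using that le R_perm by (auto simp: bruhat_interval_def)
    fix u v assume "u \<in> bruhat_interval k \<pi>" "v \<in> bruhat_interval k \<pi>" "reflection_adj u v"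
    then obtain i j where p: "u permutes {1..k}" "v permutes {1..k}" and ij: "i \<noteq> j" "u = v \<circ> Transposition.transpose i j"
      unfolding bruhat_interval_def reflection_adj_def by blast
    have r: "i \<in> {1..k}" "j \<in> {1..k}"
      using transpose_permutes_range[OF p(2), of i j] transpose_permutes_range[OF p(2), of j i]
        p(1) ij transpose_commute[of i j] by metis+
    have "f i \<noteq> f j" using inj_on_eq_iff[OF inj r] ij(1) by simp
    then show "reflection_adj (R u) (R v)"
      unfolding reflection_adj_def ij(2) R_comp[OF r] by blast
  qed
qed

section \<open>Small permutations with non-toroidal Bruhat graphs\<close>

definition list_swap :: "'a list \<Rightarrow> nat \<Rightarrow> nat \<Rightarrow> 'a list" where
  "list_swap xs i j = xs[i := xs ! j, j := xs ! i]"

text \<open>Entries of a list are counted from 0 and points from 1, whence the shift by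
  \<open>Suc\<close>.\<close>

lemma one_line_list_swap:
  assumes "i < length xs" "j < length xs"
  shows "one_line (list_swap xs i j) = one_line xs \<circ> Transposition.transpose (Suc i) (Suc j)"
proof
  fix x
  consider "x = Suc i" | "x = Suc j" "x \<noteq> Suc i" | "x \<noteq> Suc i" "x \<noteq> Suc j" by blast
  then show "one_line (list_swap xs i j) x = (one_line xs \<circ> Transposition.transpose (Suc i) (Suc j)) x"
  proof cases
    case 3
    then have "x - 1 \<noteq> i" "x - 1 \<noteq> j" if "x \<ge> 1" using that by auto
    then show ?thesis using 3 assms by (auto simp: one_line_def list_swap_def)
  qed (use assms in \<open>auto simp: one_line_def list_swap_def nth_list_update\<close>)
qed

lemma one_line_nth: "i < length xs \<Longrightarrow> one_line xs (Suc i) = xs ! i"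
  by (simp add: one_line_def)

lemma one_line_permutes:
  assumes "distinct xs" "set xs = {1..length xs}"
  shows "one_line xs permutes {1..length xs}"
proof (rule bij_imp_permutes)
  have "one_line xs ` {1..length xs} = set xs"
  proof -
    have "one_line xs ` {1..length xs} = one_line xs ` Suc ` {..<length xs}"
      by (simp add: image_Suc_lessThan)
    also have "\<dots> = (!) xs ` {..<length xs}"
      unfolding image_image by (intro image_cong) (auto simp: one_line_nth)
    also have "\<dots> = set xs" by (auto simp: set_conv_nth)
    finally show ?thesis .
  qed
  then show "bij_betw (one_line xs) {1..length xs} {1..length xs}"
    using assms by (simp add: bij_betw_def eq_card_imp_inj_on)
qed (auto simp: one_line_def)

text \<open>Sorting to \<open>[1..<Suc n]\<close> is an executable test for being the one-line word
  of an element of S_n.\<close>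

lemma sort_eq_upt_permutes:
  assumes "sort xs = [1..<Suc n]"
  shows "length xs = n" "distinct xs" "set xs = {1..n}" "one_line xs permutes {1..n}"
proof -
  have "length xs = Suc n - 1" using arg_cong[OF assms, of length] by (simp only: length_sort length_upt)
  then show l: "length xs = n" by simp
  show d: "distinct xs" using arg_cong[OF assms, of distinct] by (simp only: distinct_sort distinct_upt)
  have "set xs = {1..<Suc n}" using arg_cong[OF assms, of set] by (simp only: set_sort set_upt)
  then show s: "set xs = {1..n}" by (simp only: atLeastLessThanSuc_atLeastAtMost)
  have "set xs = {1..length xs}" unfolding l by (rule s)
  from one_line_permutes[OF d this] show "one_line xs permutes {1..n}" unfolding l .
qed

lemma one_line_inject:
  assumes "length xs = length ys" "one_line xs = one_line ys"
  shows "xs = ys"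
  using assms by (intro nth_equalityI) (auto simp: one_line_nth[symmetric])

lemma length_list_swap [simp]: "length (list_swap xs i j) = length xs"
  by (simp add: list_swap_def)

text \<open>Executable counterpart of \<open>reflection_adj\<close> on one-line words, as
  \<open>list_below\<close> is of a Bruhat step.\<close>

definition list_adj :: "nat list \<Rightarrow> nat list \<Rightarrow> bool" where
  "list_adj xs ys \<longleftrightarrow> (\<exists>i\<in>set [0..<length ys]. \<exists>j\<in>set [0..<length ys]. i \<noteq> j \<and> xs = list_swap ys i j)"

definition list_below :: "nat list \<Rightarrow> nat list \<Rightarrow> bool" where
  "list_below xs ys \<longleftrightarrow>
     (\<exists>i\<in>set [0..<length ys]. \<exists>j\<in>set [0..<length ys]. i < j \<and> ys ! j < ys ! i \<and> xs = list_swap ys i j)"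

lemma list_adj_imp_reflection_adj: "list_adj xs ys \<Longrightarrow> reflection_adj (one_line xs) (one_line ys)"
proof -
  assume "list_adj xs ys"
  then obtain i j where ij: "i < length ys" "j < length ys" "i \<noteq> j" "xs = list_swap ys i j"
    by (auto simp: list_adj_def)
  then show ?thesis unfolding reflection_adj_def ij(4) one_line_list_swap[OF ij(1,2)]
    by (intro exI[of _ "Suc i"] exI[of _ "Suc j"]) auto
qed

lemma list_below_imp_bruhat_step:
  assumes "list_below xs ys" "one_line ys permutes {1..n}"
  shows "bruhat_step n (one_line xs) (one_line ys)"
proof -
  obtain i j where ij: "i < length ys" "j < length ys" "i < j" "ys ! j < ys ! i" "xs = list_swap ys i j"
    using assms(1) by (auto simp: list_below_def)
  then have "one_line ys (Suc j) < one_line ys (Suc i)" by (simp add: one_line_nth)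
  then show ?thesis unfolding bruhat_step_iff ij(5) one_line_list_swap[OF ij(1,2)]
    using assms(2) ij(3) by (intro conjI exI[of _ "Suc i"] exI[of _ "Suc j"]) auto
qed

text \<open>Each word is one step below some earlier word, which certifies that all of them are in
  the interval below the head without any computation of that interval.\<close>

definition list_chain :: "nat list list \<Rightarrow> bool" where
  "list_chain ws \<longleftrightarrow> (\<forall>m\<in>set [1..<length ws]. \<exists>l\<in>set [0..<m]. list_below (ws ! m) (ws ! l))"

lemma list_chain_bruhat_le:
  assumes "list_chain ws" "one_line (ws ! 0) permutes {1..n}" "length (ws ! 0) = n" "m < length ws"
  shows "bruhat_le n (one_line (ws ! m)) (one_line (ws ! 0)) \<and> length (ws ! m) = n"
  using assms(4)
proof (induction m rule: less_induct)
  case (less m)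
  show ?case
  proof (cases "m = 0")
    case True
    then show ?thesis using assms(3) by (simp add: bruhat_le_refl)
  next
    case False
    then have "m \<in> set [1..<length ws]" using less.prems by simp
    then obtain l where l: "l < m" "list_below (ws ! m) (ws ! l)"
      using assms(1) unfolding list_chain_def by (metis atLeastLessThan_iff set_upt)
    then have IH: "bruhat_le n (one_line (ws ! l)) (one_line (ws ! 0))" "length (ws ! l) = n"
      using less by auto
    have "bruhat_step n (one_line (ws ! m)) (one_line (ws ! l))"
      using list_below_imp_bruhat_step[OF l(2) bruhat_le_permutes[OF IH(1) assms(2)]] .
    moreover have "length (ws ! m) = n" using l(2) IH(2) by (auto simp: list_below_def)
    ultimately show ?thesis using bruhat_le_step IH by blast
  qed
qed

text \<open>All permutations are in one-line notation.  The list \<open>ws\<close> runs through elements below \<open>w\<close>, the lists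
  \<open>as\<close> and \<open>bs\<close> are the two sides of a \<open>K\<^bsub>3,3\<^esub>\<close>, and \<open>C\<close>, \<open>D\<close> are as in \<open>torus_obstruction_in\<close>.\<close>

definition list_obstruction ::
    "nat \<Rightarrow> nat list \<Rightarrow> nat list list \<Rightarrow> nat list list \<Rightarrow> nat list list \<Rightarrow> nat list list list \<Rightarrow>
     nat list list list \<Rightarrow> bool" where
  "list_obstruction n w ws as bs C D \<longleftrightarrow>
     sort w = [1..<Suc n] \<and> list_chain (w # ws) \<and>
     torus_obstruction_in list_adj (map (\<lambda>x. map (\<lambda>y. [x, y]) bs) as) C D \<and>
     length as = 3 \<and> length bs = 3 \<and> length C = 3 \<and> length D = 3 \<and>
     (\<forall>xs\<in>set (as # bs # C @ D). \<forall>x\<in>set xs. x \<in> set (w # ws))"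

lemma not_toroidal_bruhat_list:
  assumes "list_obstruction n w ws as bs C D"
  shows "\<not> toroidal (bruhat_graph n (one_line w))"
proof -
  note ob = assms[unfolded list_obstruction_def]
  \<comment> \<open>In these certificates the K_{3,3} is an actual subgraph, so each route is a
    single edge.\<close>
  let ?K = "map (\<lambda>x. map (\<lambda>y. [x, y]) bs) as"
  have w: "sort w = [1..<Suc n]" using ob by blast
  note len = sort_eq_upt_permutes(1)[OF w] and pw = sort_eq_upt_permutes(4)[OF w]
  have le: "bruhat_le n (one_line v) (one_line w) \<and> length v = n" if v: "v \<in> set (w # ws)" for v
  proof -
    obtain m where "m < length (w # ws)" "v = (w # ws) ! m" using v by (metis in_set_conv_nth)
    then show ?thesis using list_chain_bruhat_le[of "w # ws" n m] ob pw len by auto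
  qed
  have sub: "xs \<in> set (as # bs # C @ D) \<Longrightarrow> set xs \<subseteq> set (w # ws)" for xs using ob by blast
  show ?thesis
  proof (rule torus_obstruction_not_toroidal[of list_adj ?K C D "set (w # ws)" one_line])
    show "torus_obstruction_in list_adj ?K C D" using ob by blast
    show "set (?K ! i ! j) \<subseteq> set (w # ws)" if "i < 3" "j < 3" for i j
      using that ob sub[of as] sub[of bs] nth_mem[of i as] nth_mem[of j bs] by auto
    show "set (C ! i) \<subseteq> set (w # ws)" "set (D ! i) \<subseteq> set (w # ws)" if "i < 3" for i
      using that ob sub[of "C ! i"] sub[of "D ! i"] nth_mem[of i C] nth_mem[of i D] by auto
    show "inj_on one_line (set (w # ws))" using le one_line_inject by (metis inj_onI)
    show "one_line ` set (w # ws) \<subseteq> verts (bruhat_graph n (one_line w))"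
      using le bruhat_le_permutes[OF _ pw] by (auto simp: bruhat_interval_def simp del: list.set)
    show "{one_line x, one_line y} \<in> undirected_edges (bruhat_graph n (one_line w))"
      if "x \<in> set (w # ws)" "y \<in> set (w # ws)" "list_adj x y" for x y
      using that le[of x] le[of y] bruhat_le_permutes[OF _ pw] list_adj_imp_reflection_adj[of x y]
      unfolding undirected_edges_bruhat_graph bruhat_interval_def by blast
  qed
qed

text \<open>The K_{3,3} is formed by the six words that begin with 1. The theta graph lives on the
  other words; its ends 3412 and 2134 have opposite signs, so its arcs have three edges, and it is
  joined to the K_{3,3} by moving 1 to the front.\<close>

lemma not_toroidal_bruhat_3412: "\<not> toroidal (bruhat_graph 4 (one_line [3, 4, 1, 2]))"
  by (rule not_toroidal_bruhat_list[where
      ws = "[[1,4,3,2], [2,4,1,3], [3,1,4,2], [3,2,1,4], [1,3,4,2], [1,2,3,4], [1,4,2,3],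
            [2,1,4,3], [2,3,1,4], [3,1,2,4], [1,2,4,3], [1,3,2,4], [2,1,3,4]]" and
      as = "[[1,4,3,2], [1,2,4,3], [1,3,2,4]]" and
      bs = "[[1,2,3,4], [1,3,4,2], [1,4,2,3]]" and
      C = "[[[3,4,1,2], [2,4,1,3], [2,3,1,4], [2,1,3,4]], [[3,4,1,2], [3,2,1,4], [3,1,2,4],
           [2,1,3,4]], [[3,4,1,2], [3,1,4,2], [2,1,4,3], [2,1,3,4]]]" and
      D = "[[[2,4,1,3], [1,4,2,3]], [[3,2,1,4], [1,2,3,4]], [[3,1,4,2], [1,3,4,2]]]"]) code_simp

text \<open>The listed words form two copies of K_{3,3}, one with 4 in third and one with 4 in last
  position, matched by swapping the last two positions. The first copy is the K_{3,3} of the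
  certificate, \<open>C\<close> is a K_{2,3} in the second, and \<open>D\<close> consists of three
  matching edges.\<close>

lemma not_toroidal_bruhat_3241: "\<not> toroidal (bruhat_graph 4 (one_line [3, 2, 4, 1]))"
  by (rule not_toroidal_bruhat_list[where
      ws = "[[2,3,4,1], [1,2,4,3], [3,1,4,2], [3,2,1,4], [1,3,4,2], [2,1,4,3], [2,3,1,4],
            [1,2,3,4], [3,1,2,4], [1,3,2,4], [2,1,3,4]]" and
      as = "[[3,2,4,1], [1,3,4,2], [2,1,4,3]]" and
      bs = "[[1,2,4,3], [2,3,4,1], [3,1,4,2]]" and
      C = "[[[3,2,1,4], [1,2,3,4], [1,3,2,4]], [[3,2,1,4], [3,1,2,4], [1,3,2,4]],
           [[3,2,1,4], [2,3,1,4], [1,3,2,4]]]" and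
      D = "[[[1,2,3,4], [1,2,4,3]], [[3,1,2,4], [3,1,4,2]], [[2,3,1,4], [2,3,4,1]]]"]) code_simp

text \<open>The two copies of K_{3,3} are the words beginning with 2 and with 1, matched by
  exchanging the values 1 and 2.\<close>

lemma not_toroidal_bruhat_2431: "\<not> toroidal (bruhat_graph 4 (one_line [2, 4, 3, 1]))"
  by (rule not_toroidal_bruhat_list[where
      ws = "[[1,4,3,2], [2,3,4,1], [2,1,3,4], [2,4,1,3], [1,3,4,2], [1,2,3,4], [1,4,2,3],
            [2,1,4,3], [2,3,1,4], [1,2,4,3], [1,3,2,4]]" and
      as = "[[2,4,3,1], [2,1,4,3], [2,3,1,4]]" and
      bs = "[[2,1,3,4], [2,3,4,1], [2,4,1,3]]" and
      C = "[[[1,4,3,2], [1,2,3,4], [1,2,4,3]], [[1,4,3,2], [1,4,2,3], [1,2,4,3]],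
           [[1,4,3,2], [1,3,4,2], [1,2,4,3]]]" and
      D = "[[[1,2,3,4], [2,1,3,4]], [[1,4,2,3], [2,4,1,3]], [[1,3,4,2], [2,3,4,1]]]"]) code_simp

text \<open>The two copies of K_{3,3} have 1 in second and in first position, matched by swapping
  the first two positions.\<close>

lemma not_toroidal_bruhat_4132: "\<not> toroidal (bruhat_graph 4 (one_line [4, 1, 3, 2]))"
  by (rule not_toroidal_bruhat_list[where
      ws = "[[1,4,3,2], [3,1,4,2], [2,1,3,4], [4,1,2,3], [1,3,4,2], [1,2,3,4], [1,4,2,3],
            [2,1,4,3], [3,1,2,4], [1,2,4,3], [1,3,2,4]]" and
      as = "[[4,1,3,2], [2,1,4,3], [3,1,2,4]]" and
      bs = "[[2,1,3,4], [3,1,4,2], [4,1,2,3]]" and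
      C = "[[[1,4,3,2], [1,2,3,4], [1,2,4,3]], [[1,4,3,2], [1,4,2,3], [1,2,4,3]],
           [[1,4,3,2], [1,3,4,2], [1,2,4,3]]]" and
      D = "[[[1,2,3,4], [2,1,3,4]], [[1,4,2,3], [4,1,2,3]], [[1,3,4,2], [3,1,4,2]]]"]) code_simp

text \<open>The two copies of K_{3,3} are the words ending in 3 and in 4, matched by exchanging the
  values 3 and 4.\<close>

lemma not_toroidal_bruhat_4213: "\<not> toroidal (bruhat_graph 4 (one_line [4, 2, 1, 3]))"
  by (rule not_toroidal_bruhat_list[where
      ws = "[[2,4,1,3], [1,2,4,3], [3,2,1,4], [4,1,2,3], [1,4,2,3], [2,1,4,3], [2,3,1,4],
            [1,2,3,4], [3,1,2,4], [1,3,2,4], [2,1,3,4]]" and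
      as = "[[4,2,1,3], [1,4,2,3], [2,1,4,3]]" and
      bs = "[[1,2,4,3], [2,4,1,3], [4,1,2,3]]" and
      C = "[[[3,2,1,4], [1,2,3,4], [1,3,2,4]], [[3,2,1,4], [3,1,2,4], [1,3,2,4]],
           [[3,2,1,4], [2,3,1,4], [1,3,2,4]]]" and
      D = "[[[1,2,3,4], [1,2,4,3]], [[3,1,2,4], [4,1,2,3]], [[2,3,1,4], [2,4,1,3]]]"]) code_simp

text \<open>The model case, the product of K_{3,3} with an edge: the layers are the words ending in
  5, 4 and in 4, 5. In 21543 the same happens at the other end of the word.\<close>

lemma not_toroidal_bruhat_32154: "\<not> toroidal (bruhat_graph 5 (one_line [3, 2, 1, 5, 4]))"
  by (rule not_toroidal_bruhat_list[where
      ws = "[[2,3,1,5,4], [1,2,3,5,4], [3,1,2,5,4], [3,2,1,4,5], [1,3,2,5,4], [2,1,3,5,4],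
            [2,3,1,4,5], [1,2,3,4,5], [3,1,2,4,5], [1,3,2,4,5], [2,1,3,4,5]]" and
      as = "[[3,2,1,5,4], [1,3,2,5,4], [2,1,3,5,4]]" and
      bs = "[[1,2,3,5,4], [2,3,1,5,4], [3,1,2,5,4]]" and
      C = "[[[3,2,1,4,5], [1,2,3,4,5], [1,3,2,4,5]], [[3,2,1,4,5], [2,3,1,4,5],
           [1,3,2,4,5]], [[3,2,1,4,5], [3,1,2,4,5], [1,3,2,4,5]]]" and
      D = "[[[1,2,3,4,5], [1,2,3,5,4]], [[2,3,1,4,5], [2,3,1,5,4]], [[3,1,2,4,5],
           [3,1,2,5,4]]]"]) code_simp

lemma not_toroidal_bruhat_21543: "\<not> toroidal (bruhat_graph 5 (one_line [2, 1, 5, 4, 3]))"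
  by (rule not_toroidal_bruhat_list[where
      ws = "[[1,2,5,4,3], [2,1,4,5,3], [2,1,3,4,5], [2,1,5,3,4], [1,2,4,5,3], [1,2,3,4,5],
            [1,2,5,3,4], [2,1,3,5,4], [2,1,4,3,5], [1,2,3,5,4], [1,2,4,3,5]]" and
      as = "[[2,1,5,4,3], [2,1,3,5,4], [2,1,4,3,5]]" and
      bs = "[[2,1,3,4,5], [2,1,4,5,3], [2,1,5,3,4]]" and
      C = "[[[1,2,5,4,3], [1,2,5,3,4], [1,2,3,5,4]], [[1,2,5,4,3], [1,2,3,4,5],
           [1,2,3,5,4]], [[1,2,5,4,3], [1,2,4,5,3], [1,2,3,5,4]]]" and
      D = "[[[1,2,5,3,4], [2,1,5,3,4]], [[1,2,3,4,5], [2,1,3,4,5]], [[1,2,4,5,3],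
           [2,1,4,5,3]]]"]) code_simp

section \<open>Transfer along Bruhat order and along patterns\<close>

lemma toroidal_list_below:
  assumes "toroidal (bruhat_graph n (one_line ys))" "list_below xs ys" "sort ys = [1..<Suc n]"
  shows "toroidal (bruhat_graph n (one_line xs))"
  using toroidal_bruhat_le[OF assms(1)] bruhat_le_refl bruhat_le_step
    list_below_imp_bruhat_step[OF assms(2) sort_eq_upt_permutes(4)[OF assms(3)]] by blast

text \<open>A smaller element spans a smaller subgraph, so the obstruction persists upwards.
  Swapping the last two letters leads down to 3412; in the next three lemmas it is the first two
  letters that are swapped.\<close>

lemma not_toroidal_bruhat_3421: "\<not> toroidal (bruhat_graph 4 (one_line [3, 4, 2, 1]))"
  by (rule contrapos_nn[OF not_toroidal_bruhat_3412], erule toroidal_list_below; code_simp)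

lemma not_toroidal_bruhat_4312: "\<not> toroidal (bruhat_graph 4 (one_line [4, 3, 1, 2]))"
  by (rule contrapos_nn[OF not_toroidal_bruhat_3412], erule toroidal_list_below; code_simp)

lemma not_toroidal_bruhat_4231: "\<not> toroidal (bruhat_graph 4 (one_line [4, 2, 3, 1]))"
  by (rule contrapos_nn[OF not_toroidal_bruhat_2431], erule toroidal_list_below; code_simp)

lemma not_toroidal_bruhat_4321: "\<not> toroidal (bruhat_graph 4 (one_line [4, 3, 2, 1]))"
  by (rule contrapos_nn[OF not_toroidal_bruhat_3421], erule toroidal_list_below; code_simp)

text \<open>Comparing the pairs \<open>i < j\<close> is enough, as \<open>\<sigma>\<close> is
  injective and \<open>xs\<close> has no repetition.\<close>

lemma contains_patternI:
  assumes \<sigma>: "inj \<sigma>" and ps: "sorted_wrt (<) ps" "set ps \<subseteq> {1..n}" "length ps = k"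
    and xs: "distinct xs" "length xs = k"
    and ord: "\<And>i j. j < k \<Longrightarrow> i < j \<Longrightarrow> \<sigma> (ps ! i) < \<sigma> (ps ! j) \<longleftrightarrow> xs ! i < xs ! j"
  shows "contains_pattern n \<sigma> k (one_line xs)"
  unfolding contains_pattern_def
proof (intro exI[of _ "\<lambda>a. ps ! (a - 1)"] conjI ballI)
  show "strict_mono_on {1..k} (\<lambda>a. ps ! (a - 1))"
    by (rule strict_mono_onI) (use ps sorted_wrt_nth_less[OF ps(1)] in auto)
  show "(\<lambda>a. ps ! (a - 1)) ` {1..k} \<subseteq> {1..n}"
  proof (rule image_subsetI)
    fix a assume "a \<in> {1..k}"
    then have "a - 1 < length ps" using ps(3) by auto
    then show "ps ! (a - 1) \<in> {1..n}" using ps(2) nth_mem by blast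
  qed
  have ord': "\<sigma> (ps ! i) < \<sigma> (ps ! j) \<longleftrightarrow> xs ! i < xs ! j" if ij: "i < k" "j < k" for i j
  proof (cases i j rule: linorder_cases)
    case greater
    have "\<sigma> (ps ! i) \<noteq> \<sigma> (ps ! j)"
      using inj_eq[OF \<sigma>] sorted_wrt_nth_less[OF ps(1) greater] ij ps(3) by simp
    moreover have "xs ! i \<noteq> xs ! j" using xs greater ij by (simp add: nth_eq_iff_index_eq)
    ultimately show ?thesis using ord[OF ij(1) greater] by linarith
  qed (use ord ij in auto)
  fix a b assume "a \<in> {1..k}" "b \<in> {1..k}"
  then obtain i j where "a = Suc i" "b = Suc j" "i < k" "j < k"
    by (metis Suc_le_eq Suc_pred atLeastAtMost_iff less_eq_Suc_le One_nat_def)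
  then show "\<sigma> (ps ! (a - 1)) < \<sigma> (ps ! (b - 1)) \<longleftrightarrow> one_line xs a < one_line xs b"
    using ord' xs by (simp add: one_line_nth)
qed

lemma not_toroidal_pattern:
  assumes "\<sigma> permutes {1..n}" "contains_pattern n \<sigma> k (one_line xs)"
    and "\<not> toroidal (bruhat_graph k (one_line xs))" "sort xs = [1..<Suc k]"
  shows "\<not> toroidal (bruhat_graph n \<sigma>)"
  using toroidal_bruhat_pattern[OF _ assms(2,1) sort_eq_upt_permutes(4)[OF assms(4)]] assms(3) by blast

lemma not_toroidal_pattern4:
  assumes \<sigma>: "\<sigma> permutes {1..n}" and "\<not> toroidal (bruhat_graph 4 (one_line [x, y, z, w]))"
    and srt: "sort [x, y, z, w] = [1..<Suc 4]"
    and "p < q" "q < s" "s < t" "{p, q, s, t} \<subseteq> {1..n}"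
    and "\<sigma> p < \<sigma> q \<longleftrightarrow> x < y" "\<sigma> p < \<sigma> s \<longleftrightarrow> x < z" "\<sigma> p < \<sigma> t \<longleftrightarrow> x < w"
      "\<sigma> q < \<sigma> s \<longleftrightarrow> y < z" "\<sigma> q < \<sigma> t \<longleftrightarrow> y < w" "\<sigma> s < \<sigma> t \<longleftrightarrow> z < w"
  shows "\<not> toroidal (bruhat_graph n \<sigma>)"
proof (rule not_toroidal_pattern[OF \<sigma> _ assms(2) srt])
  show "contains_pattern n \<sigma> 4 (one_line [x, y, z, w])"
  proof (rule contains_patternI[OF permutes_inj[OF \<sigma>], of "[p, q, s, t]"])
    fix i j :: nat assume "j < 4" "i < j"
    then consider "i = 0" "j = 1" | "i = 0" "j = 2" | "i = 0" "j = 3" | "i = 1" "j = 2" | "i = 1" "j = 3" | "i = 2" "j = 3"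
      by linarith
    then show "\<sigma> ([p, q, s, t] ! i) < \<sigma> ([p, q, s, t] ! j) \<longleftrightarrow> [x, y, z, w] ! i < [x, y, z, w] ! j"
      by cases (use assms in simp_all)
  next
    show "sorted_wrt (<) [p, q, s, t]" using assms by simp
    show "distinct [x, y, z, w]" using sort_eq_upt_permutes(2)[OF srt] .
  qed (use assms in simp_all)
qed

text \<open>Four places for the position \<open>d\<close> and four for its value make sixteen cases.
  The two excluded by \<open>cross\<close> are 1432 and 3214, where \<open>d\<close> has no
  inversion with the 321; the other fourteen lead to eight patterns, all of them
  non-toroidal.\<close>

lemma not_toroidal_321_crossing:
  assumes \<sigma>: "\<sigma> permutes {1..n}"
    and abc: "a < b" "b < c" "\<sigma> b < \<sigma> a" "\<sigma> c < \<sigma> b"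
    and d: "d \<in> {1..n}" "d \<notin> {a, b, c}"
    and cross: "\<not> (d < a \<and> \<sigma> d < \<sigma> c)" "\<not> (c < d \<and> \<sigma> a < \<sigma> d)"
  shows "\<not> toroidal (bruhat_graph n \<sigma>)"
proof -
  have inj: "inj \<sigma>" using permutes_inj[OF \<sigma>] .
  have ne: "\<sigma> d \<noteq> \<sigma> a" "\<sigma> d \<noteq> \<sigma> b" "\<sigma> d \<noteq> \<sigma> c" using d(2) by (simp_all add: inj_eq[OF inj])
  have r: "a \<in> {1..n}" "b \<in> {1..n}" "c \<in> {1..n}"
    using inversion_range[OF \<sigma> abc(1,3)] inversion_range[OF \<sigma> abc(2,4)] by blast+
  have sort: "sort [2, 4, 3, 1::nat] = [1..<Suc 4]" "sort [3, 4, 2, 1::nat] = [1..<Suc 4]"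
    "sort [4, 3, 2, 1::nat] = [1..<Suc 4]" "sort [4, 1, 3, 2::nat] = [1..<Suc 4]"
    "sort [4, 2, 3, 1::nat] = [1..<Suc 4]" "sort [4, 3, 1, 2::nat] = [1..<Suc 4]"
    "sort [3, 2, 4, 1::nat] = [1..<Suc 4]" "sort [4, 2, 1, 3::nat] = [1..<Suc 4]"
    by code_simp+
  note bad2431 = not_toroidal_pattern4[OF \<sigma> not_toroidal_bruhat_2431 sort(1)]
    and bad3421 = not_toroidal_pattern4[OF \<sigma> not_toroidal_bruhat_3421 sort(2)]
    and bad4321 = not_toroidal_pattern4[OF \<sigma> not_toroidal_bruhat_4321 sort(3)]
    and bad4132 = not_toroidal_pattern4[OF \<sigma> not_toroidal_bruhat_4132 sort(4)]
    and bad4231 = not_toroidal_pattern4[OF \<sigma> not_toroidal_bruhat_4231 sort(5)]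
    and bad4312 = not_toroidal_pattern4[OF \<sigma> not_toroidal_bruhat_4312 sort(6)]
    and bad3241 = not_toroidal_pattern4[OF \<sigma> not_toroidal_bruhat_3241 sort(7)]
    and bad4213 = not_toroidal_pattern4[OF \<sigma> not_toroidal_bruhat_4213 sort(8)]
  \<comment> \<open>The case name is the position whose value lies just above that of
    \<open>d\<close>, or \<open>t\<close> if \<open>d\<close> carries the top value.\<close>
  consider (c) "\<sigma> d < \<sigma> c" | (b) "\<sigma> c < \<sigma> d" "\<sigma> d < \<sigma> b" | (a) "\<sigma> b < \<sigma> d" "\<sigma> d < \<sigma> a" | (t) "\<sigma> a < \<sigma> d"
    using ne by linarith
  note rank = this
  have dd: "d \<noteq> a" "d \<noteq> b" "d \<noteq> c" using d(2) by auto
  consider "d < a" | "a < d" "d < b" | "b < d" "d < c" | "c < d" using dd by linarith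
  then show ?thesis
  proof cases
    case p: 1
    show ?thesis using rank
    proof cases
      case c
      then show ?thesis using p cross by blast
    next
      case b
      show ?thesis by (rule bad2431[of d a b c]) (use b p abc d r in auto)
    next
      case a
      show ?thesis by (rule bad3421[of d a b c]) (use a p abc d r in auto)
    next
      case t
      show ?thesis by (rule bad4321[of d a b c]) (use t p abc d r in auto)
    qed
  next
    case p: 2
    show ?thesis using rank
    proof cases
      case c
      show ?thesis by (rule bad4132[of a d b c]) (use c p abc d r in auto)
    next
      case b
      show ?thesis by (rule bad4231[of a d b c]) (use b p abc d r in auto)
    next
      case a
      show ?thesis by (rule bad4321[of a d b c]) (use a p abc d r in auto)
    next
      case t
      show ?thesis by (rule bad3421[of a d b c]) (use t p abc d r in auto)
    qed
  next
    case p: 3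
    show ?thesis using rank
    proof cases
      case c
      show ?thesis by (rule bad4312[of a b d c]) (use c p abc d r in auto)
    next
      case b
      show ?thesis by (rule bad4321[of a b d c]) (use b p abc d r in auto)
    next
      case a
      show ?thesis by (rule bad4231[of a b d c]) (use a p abc d r in auto)
    next
      case t
      show ?thesis by (rule bad3241[of a b d c]) (use t p abc d r in auto)
    qed
  next
    case p: 4
    show ?thesis using rank
    proof cases
      case c
      show ?thesis by (rule bad4321[of a b c d]) (use c p abc d r in auto)
    next
      case b
      show ?thesis by (rule bad4312[of a b c d]) (use b p abc d r in auto)
    next
      case a
      show ?thesis by (rule bad4213[of a b c d]) (use a p abc d r in auto)
    next
      case t
      then show ?thesis using p cross by blast
    qed
  qed
qed

lemma not_toroidal_pattern5:
  assumes \<sigma>: "\<sigma> permutes {1..n}" and "\<not> toroidal (bruhat_graph 5 (one_line [x, y, z, w, v]))"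
    and srt: "sort [x, y, z, w, v] = [1..<Suc 5]"
    and "p < q" "q < s" "s < t" "t < u" "{p, q, s, t, u} \<subseteq> {1..n}"
    and "\<sigma> p < \<sigma> q \<longleftrightarrow> x < y" "\<sigma> p < \<sigma> s \<longleftrightarrow> x < z" "\<sigma> p < \<sigma> t \<longleftrightarrow> x < w" "\<sigma> p < \<sigma> u \<longleftrightarrow> x < v"
      "\<sigma> q < \<sigma> s \<longleftrightarrow> y < z" "\<sigma> q < \<sigma> t \<longleftrightarrow> y < w" "\<sigma> q < \<sigma> u \<longleftrightarrow> y < v"
      "\<sigma> s < \<sigma> t \<longleftrightarrow> z < w" "\<sigma> s < \<sigma> u \<longleftrightarrow> z < v" "\<sigma> t < \<sigma> u \<longleftrightarrow> w < v"
  shows "\<not> toroidal (bruhat_graph n \<sigma>)"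
proof (rule not_toroidal_pattern[OF \<sigma> _ assms(2) srt])
  show "contains_pattern n \<sigma> 5 (one_line [x, y, z, w, v])"
  proof (rule contains_patternI[OF permutes_inj[OF \<sigma>], of "[p, q, s, t, u]"])
    fix i j :: nat assume "j < 5" "i < j"
    then have "i = 0 \<or> i = 1 \<or> i = 2 \<or> i = 3" "j = 1 \<or> j = 2 \<or> j = 3 \<or> j = 4" by linarith+
    then show "\<sigma> ([p, q, s, t, u] ! i) < \<sigma> ([p, q, s, t, u] ! j) \<longleftrightarrow> [x, y, z, w, v] ! i < [x, y, z, w, v] ! j"
      using \<open>i < j\<close> by (elim disjE) (use assms in simp_all)
  next
    show "sorted_wrt (<) [p, q, s, t, u]" using assms by simp
    show "distinct [x, y, z, w, v]" using sort_eq_upt_permutes(2)[OF srt] .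
  qed (use assms in simp_all)
qed

text \<open>If no other position crosses the 321, each lies to its lower left or to its upper right.
  A fourth inversion then involves none of \<open>a\<close>, \<open>b\<close>, \<open>c\<close>, nor
  one position of each kind, so it lies on one side: before the 321 it gives 21543, after it
  32154.\<close>

lemma not_toroidal_321_length_4:
  assumes \<sigma>: "\<sigma> permutes {1..n}"
    and abc: "a < b" "b < c" "\<sigma> b < \<sigma> a" "\<sigma> c < \<sigma> b"
    and len: "4 \<le> card (inversions \<sigma>)"
  shows "\<not> toroidal (bruhat_graph n \<sigma>)"
proof (cases "\<exists>d\<in>{1..n} - {a, b, c}. \<not> (d < a \<and> \<sigma> d < \<sigma> c) \<and> \<not> (c < d \<and> \<sigma> a < \<sigma> d)")
  case True
  then show ?thesis using not_toroidal_321_crossing[OF \<sigma> abc] by blast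
next
  case False
  then have out: "(d < a \<and> \<sigma> d < \<sigma> c) \<or> (c < d \<and> \<sigma> a < \<sigma> d)" if "d \<in> {1..n}" "d \<notin> {a, b, c}" for d
    using that by blast
  have "\<not> inversions \<sigma> \<subseteq> {(a, b), (a, c), (b, c)}"
  proof
    assume "inversions \<sigma> \<subseteq> {(a, b), (a, c), (b, c)}"
    then have "card (inversions \<sigma>) \<le> card {(a, b), (a, c), (b, c)}" by (intro card_mono) auto
    also have "\<dots> \<le> 3" by (simp add: card_insert_if)
    finally show False using len by simp
  qed
  then obtain i j where ij: "i < j" "\<sigma> j < \<sigma> i" "(i, j) \<notin> {(a, b), (a, c), (b, c)}"
    by (auto simp: inversions_def)
  have ir: "i \<in> {1..n}" "j \<in> {1..n}" using inversion_range[OF \<sigma> ij(1,2)] .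
  have r: "a \<in> {1..n}" "b \<in> {1..n}" "c \<in> {1..n}"
    using inversion_range[OF \<sigma> abc(1,3)] inversion_range[OF \<sigma> abc(2,4)] by blast+
  have i: "i \<notin> {a, b, c}"
  proof
    assume i: "i \<in> {a, b, c}"
    then have "j \<notin> {a, b, c}" using ij abc by auto
    then show False using out[OF ir(2)] i ij abc by auto
  qed
  have j: "j \<notin> {a, b, c}"
  proof
    assume "j \<in> {a, b, c}"
    then show False using out[OF ir(1) i] ij abc by auto
  qed
  have sort: "sort [3, 2, 1, 5, 4::nat] = [1..<Suc 5]" "sort [2, 1, 5, 4, 3::nat] = [1..<Suc 5]"
    by code_simp+
  consider "i < a" "\<sigma> i < \<sigma> c" "j < a" "\<sigma> j < \<sigma> c" | "c < i" "\<sigma> a < \<sigma> i" "c < j" "\<sigma> a < \<sigma> j"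
    using out[OF ir(1) i] out[OF ir(2) j] ij abc by linarith
  then show ?thesis
  proof cases
    case 1
    show ?thesis
      by (rule not_toroidal_pattern5[OF \<sigma> not_toroidal_bruhat_21543 sort(2), of i j a b c])
         (use 1 ij abc r ir in auto)
  next
    case 2
    show ?thesis
      by (rule not_toroidal_pattern5[OF \<sigma> not_toroidal_bruhat_32154 sort(1), of a b c i j])
         (use 2 ij abc r ir in auto)
  qed
qed

section \<open>Bruhat intervals that are hypercubes\<close>

text \<open>The cut between \<open>i\<close> and \<open>Suc i\<close> is respected. For permutations
  this is membership in the parabolic subgroup generated by all adjacent transpositions except the
  one across the cut.\<close>

definition preserves_upto :: "nat \<Rightarrow> (nat \<Rightarrow> nat) \<Rightarrow> bool" where
  "preserves_upto i p \<longleftrightarrow> (\<forall>k. p k \<le> i \<longleftrightarrow> k \<le> i)"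

text \<open>Positions are unrestricted because every entry of either pattern takes part in an
  inversion, which puts its position into {1..n}.\<close>

definition avoids_321_3412 :: "(nat \<Rightarrow> nat) \<Rightarrow> bool" where
  "avoids_321_3412 \<sigma> \<longleftrightarrow>
     (\<forall>a b c. a < b \<longrightarrow> b < c \<longrightarrow> \<not> (\<sigma> b < \<sigma> a \<and> \<sigma> c < \<sigma> b)) \<and>
     (\<forall>a b c d. a < b \<longrightarrow> b < c \<longrightarrow> c < d \<longrightarrow> \<not> (\<sigma> c < \<sigma> d \<and> \<sigma> d < \<sigma> a \<and> \<sigma> a < \<sigma> b))"

lemma avoids_321: "avoids_321_3412 \<sigma> \<Longrightarrow> a < b \<Longrightarrow> b < c \<Longrightarrow> \<sigma> b < \<sigma> a \<Longrightarrow> \<sigma> c < \<sigma> b \<Longrightarrow> False"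
  and avoids_3412: "avoids_321_3412 \<sigma> \<Longrightarrow> a < b \<Longrightarrow> b < c \<Longrightarrow> c < d \<Longrightarrow> \<sigma> c < \<sigma> d \<Longrightarrow> \<sigma> d < \<sigma> a \<Longrightarrow>
    \<sigma> a < \<sigma> b \<Longrightarrow> False"
  unfolding avoids_321_3412_def by blast+

text \<open>Any second entry crossing the cut at \<open>i\<close> would give a pattern \<open>321\<close> or \<open>3412\<close> together with the
  descent, so undoing the descent splits the permutation at \<open>i\<close>.\<close>

lemma undo_descent_preserves_upto:
  assumes \<sigma>: "\<sigma> permutes {1..n}" and av: "avoids_321_3412 \<sigma>" and d: "\<sigma> (Suc i) < \<sigma> i"
  shows "preserves_upto i (\<sigma> \<circ> Transposition.transpose i (Suc i))"
proof -
  have inj: "inj \<sigma>" using permutes_inj[OF \<sigma>] .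
  have neq: "\<sigma> x \<noteq> \<sigma> y" if "x \<noteq> y" for x y using that by (simp add: inj_eq[OF inj])
  have lo: "\<sigma> k < \<sigma> i" if "k < i" for k
  proof (rule ccontr)
    assume "\<not> \<sigma> k < \<sigma> i"
    then have "\<sigma> i < \<sigma> k" using neq[of k i] that by simp
    then show False using avoids_321[OF av that lessI _ d] by blast
  qed
  have hi: "\<sigma> (Suc i) < \<sigma> k" if "Suc i < k" for k
  proof (rule ccontr)
    assume "\<not> \<sigma> (Suc i) < \<sigma> k"
    then have "\<sigma> k < \<sigma> (Suc i)" using neq[of k "Suc i"] that by simp
    then show False using avoids_321[OF av lessI that d] by blast
  qed
  \<comment> \<open>The positions from 0 to \<open>i - 1\<close> together with \<open>Suc i\<close>
    carry \<open>i + 1\<close> distinct values below \<open>\<sigma> i\<close>.\<close>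
  have i_up: "i < \<sigma> i"
  proof -
    have "\<sigma> ` insert (Suc i) {..<i} \<subseteq> {..<\<sigma> i}" using lo d by auto
    then have "card (\<sigma> ` insert (Suc i) {..<i}) \<le> card {..<\<sigma> i}" by (intro card_mono) auto
    moreover have "card (\<sigma> ` insert (Suc i) {..<i}) = Suc i"
      using inj by (subst card_image) (auto simp: inj_on_def inj_def)
    ultimately show ?thesis by simp
  qed
  \<comment> \<open>Dually, each value below \<open>\<sigma> (Suc i)\<close> occurs at one of the
    \<open>i\<close> positions before \<open>i\<close>.\<close>
  have Suc_down: "\<sigma> (Suc i) \<le> i"
  proof -
    have "{..<\<sigma> (Suc i)} \<subseteq> \<sigma> ` {..<i}"
    proof
      fix v assume v: "v \<in> {..<\<sigma> (Suc i)}"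
      obtain k where k: "v = \<sigma> k" using permutes_surj[OF \<sigma>] by (metis surjD)
      have "\<not> Suc i < k" using hi[of k] v k by auto
      moreover have "k \<noteq> Suc i" "k \<noteq> i" using v k d by auto
      ultimately show "v \<in> \<sigma> ` {..<i}" using k by auto
    qed
    then have "card {..<\<sigma> (Suc i)} \<le> card (\<sigma> ` {..<i})" by (intro card_mono) auto
    also have "\<dots> \<le> i" using card_image_le[of "{..<i}" \<sigma>] by simp
    finally show ?thesis by simp
  qed
  have down: "\<sigma> k \<le> i" if k: "k < i" for k
  proof (rule ccontr)
    assume up: "\<not> \<sigma> k \<le> i"
    \<comment> \<open>Both sets have \<open>i + 1\<close> elements, so their two differences are
      equally large. Since \<open>i\<close> and \<open>k\<close> are in \<open>A - B\<close>, the
      set \<open>B - A\<close> has some \<open>k'\<close> other than \<open>Suc i\<close>, and then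
      \<open>k\<close>, \<open>i\<close>, \<open>Suc i\<close>, \<open>k'\<close> form a
      3412.\<close>
    define A B where "A = {..i}" and "B = {x. \<sigma> x \<le> i}"
    have B: "\<sigma> ` B = {..i}" using permutes_surj[OF \<sigma>] by (force simp: B_def image_iff surj_def)
    have cB: "card B = card A" using card_image[of \<sigma> B] inj B by (simp add: A_def inj_on_subset)
    have "card B = Suc i" using cB by (simp add: A_def)
    then have fin: "finite A" "finite B" by (auto simp: A_def intro: card_ge_0_finite)
    have "card (A - B) = card (B - A)"
      using cB card_Diff_subset_Int[of A B] card_Diff_subset_Int[of B A] fin by (simp add: Int_commute)
    moreover have "card {i, k} \<le> card (A - B)"
      using fin up i_up k by (intro card_mono) (auto simp: A_def B_def)
    ultimately have "\<not> card (B - A) \<le> card {Suc i}" using k by simp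
    then have "\<not> B - A \<subseteq> {Suc i}" using card_mono[of "{Suc i}" "B - A"] by auto
    then obtain k' where "k' \<in> B - A" "k' \<noteq> Suc i" by blast
    then have k': "\<sigma> k' \<le> i" "i < k'" "k' \<noteq> Suc i" by (auto simp: A_def B_def)
    then show False using avoids_3412[OF av k lessI _ hi[of k'] _ lo[OF k]] up by auto
  qed
  define p where "p = \<sigma> \<circ> Transposition.transpose i (Suc i)"
  have p_le: "p k \<le> i" if "k \<le> i" for k
    using that down Suc_down by (cases "k = i") (auto simp: p_def)
  have "inj p" unfolding p_def using inj by (intro inj_compose) auto
  then have "p ` {..i} = {..i}" using p_le by (intro endo_inj_surj) (auto simp: inj_on_def inj_def)
  then have "k \<le> i" if "p k \<le> i" for k
    using that \<open>inj p\<close> by (metis atMost_iff imageE injD)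
  then show ?thesis unfolding preserves_upto_def p_def[symmetric] using p_le by blast
qed

lemma inversion_same_side:
  assumes "preserves_upto i v" "p < q" "v q < v p"
  shows "p \<le> i \<longleftrightarrow> q \<le> i"
  using assms unfolding preserves_upto_def by (meson le_trans less_imp_le_nat not_le)

lemma adjacent_transpose_mono:
  assumes "p < q" "p \<le> i \<longleftrightarrow> q \<le> i"
  shows "Transposition.transpose i (Suc i) p < Transposition.transpose i (Suc i) q"
  using assms by (auto simp: Transposition.transpose_def)

text \<open>No inversion straddles the cut, so either pattern would lie on one side of it. On each
  side the transposition is increasing, so it would carry the pattern to one in
  \<open>\<sigma>\<close>.\<close>

lemma undo_descent_avoids:
  assumes av: "avoids_321_3412 \<sigma>" and pr: "preserves_upto i (\<sigma> \<circ> Transposition.transpose i (Suc i))"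
  shows "avoids_321_3412 (\<sigma> \<circ> Transposition.transpose i (Suc i))"
proof -
  let ?t = "Transposition.transpose i (Suc i)"
  note side = inversion_same_side[OF pr]
  show ?thesis
    unfolding avoids_321_3412_def
  proof (intro conjI allI impI notI)
    fix a b c assume l: "a < b" "b < c" "(\<sigma> \<circ> ?t) b < (\<sigma> \<circ> ?t) a \<and> (\<sigma> \<circ> ?t) c < (\<sigma> \<circ> ?t) b"
    have "?t a < ?t b" "?t b < ?t c"
      using l side[of a b] side[of b c] by (auto intro!: adjacent_transpose_mono)
    then show False using avoids_321[OF av] l by auto
  next
    fix a b c d
    assume l: "a < b" "b < c" "c < d" "(\<sigma> \<circ> ?t) c < (\<sigma> \<circ> ?t) d \<and> (\<sigma> \<circ> ?t) d < (\<sigma> \<circ> ?t) a \<and> (\<sigma> \<circ> ?t) a < (\<sigma> \<circ> ?t) b"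
    have s: "a \<le> i \<longleftrightarrow> c \<le> i" "a \<le> i \<longleftrightarrow> d \<le> i" "b \<le> i \<longleftrightarrow> c \<le> i"
      using l by (intro side; simp)+
    have "?t a < ?t b" "?t b < ?t c" "?t c < ?t d"
      using l s by (auto intro!: adjacent_transpose_mono)
    then show False using avoids_3412[OF av] l by auto
  qed
qed

lemma involution_conj_transpose:
  assumes "\<And>x. s (s x) = x"
  shows "s \<circ> Transposition.transpose p q = Transposition.transpose (s p) (s q) \<circ> s"
proof
  fix x
  have "s x = s y \<longleftrightarrow> x = y" for y using assms by metis
  then show "(s \<circ> Transposition.transpose p q) x = (Transposition.transpose (s p) (s q) \<circ> s) x"
    by (auto simp: Transposition.transpose_def)
qed

text \<open>Everything below \<open>\<sigma> \<circ> t\<close> respects the cut, so multiplication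
  by \<open>t\<close> on the right carries its inversions along and turns downward steps into
  downward steps. This embeds the translated interval into the interval of \<open>\<sigma>\<close>;
  together the two copies are closed under going down.\<close>

lemma undo_descent_interval:
  assumes \<sigma>: "\<sigma> permutes {1..n}" and d: "\<sigma> (Suc i) < \<sigma> i"
  defines "t \<equiv> Transposition.transpose i (Suc i)"
  assumes pr: "preserves_upto i (\<sigma> \<circ> t)"
  shows "\<And>v. v \<in> bruhat_interval n (\<sigma> \<circ> t) \<Longrightarrow> preserves_upto i v"
    and "bruhat_interval n \<sigma> = bruhat_interval n (\<sigma> \<circ> t) \<union> (\<lambda>v. v \<circ> t) ` bruhat_interval n (\<sigma> \<circ> t)"
proof -
  have ir: "i \<in> {1..n}" "Suc i \<in> {1..n}" using inversion_range[OF \<sigma> lessI d] .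
  have tp: "t permutes {1..n}" unfolding t_def using ir by (intro permutes_swap_id)
  have \<sigma>t: "\<sigma> \<circ> t permutes {1..n}" using permutes_compose[OF tp \<sigma>] .
  have tt: "t (t x) = x" for x by (simp add: t_def)
  have tt': "v \<circ> t \<circ> t = v" for v :: "nat \<Rightarrow> nat" by (rule ext) (simp add: tt)
  have conj: "v \<circ> Transposition.transpose p q \<circ> t = v \<circ> t \<circ> Transposition.transpose (t p) (t q)" for v :: "nat \<Rightarrow> nat" and p q
    using involution_conj_transpose[of t "t p" "t q"] tt by (simp add: comp_assoc)
  have step\<sigma>: "bruhat_step n (\<sigma> \<circ> t) \<sigma>"
    unfolding bruhat_step_iff using \<sigma> d t_def by blast
  have pres: "preserves_upto i v" if "bruhat_le n v (\<sigma> \<circ> t)" for v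
    using that
  proof (induction rule: bruhat_le_induct)
    case refl
    show ?case by (rule pr)
  next
    case (step u v)
    obtain p q where pq: "p < q" "v q < v p" "u = v \<circ> Transposition.transpose p q"
      using step(1) unfolding bruhat_step_iff by blast
    have "p \<le> i \<longleftrightarrow> q \<le> i" using inversion_same_side[OF step(3) pq(1,2)] .
    then have "Transposition.transpose p q x \<le> i \<longleftrightarrow> x \<le> i" for x by (auto simp: Transposition.transpose_def)
    then show ?case using step(3) unfolding preserves_upto_def pq(3) by simp
  qed
  show "preserves_upto i v" if "v \<in> bruhat_interval n (\<sigma> \<circ> t)" for v
    using pres that by (simp add: bruhat_interval_def)
  have up: "bruhat_le n (v \<circ> t) \<sigma>" if "bruhat_le n v (\<sigma> \<circ> t)" for v
    using that
  proof (induction rule: bruhat_le_induct)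
    case refl
    show ?case unfolding tt' by (rule bruhat_le_refl)
  next
    case (step u v)
    obtain p q where pq: "p < q" "v q < v p" "u = v \<circ> Transposition.transpose p q"
      using step(1) unfolding bruhat_step_iff by blast
    have "p \<le> i \<longleftrightarrow> q \<le> i" using inversion_same_side[OF pres[OF step(2)] pq(1,2)] .
    then have "t p < t q" unfolding t_def using pq(1) by (intro adjacent_transpose_mono)
    moreover have "(v \<circ> t) (t q) < (v \<circ> t) (t p)" using pq(2) tt by simp
    moreover have "v \<circ> t permutes {1..n}"
      using permutes_compose[OF tp bruhat_step_permutes(2)[OF step(1)]] .
    ultimately have "bruhat_step n (u \<circ> t) (v \<circ> t)"
      unfolding bruhat_step_iff pq(3) conj by blast
    then show ?case using step(3) by (rule bruhat_le_step)
  qed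
  \<comment> \<open>Only the pair \<open>(i, Suc i)\<close> is reversed by \<open>t\<close>. The
    step that swaps it leads from \<open>v \<circ> t\<close> to \<open>v\<close>; any other step
    from \<open>v \<circ> t\<close> is the translate of a step below \<open>v\<close>.\<close>
  have split: "bruhat_le n u (\<sigma> \<circ> t) \<or> (\<exists>v. bruhat_le n v (\<sigma> \<circ> t) \<and> u = v \<circ> t)" if "bruhat_le n u \<sigma>" for u
    using that
  proof (induction rule: bruhat_le_induct)
    case refl
    have "\<sigma> = \<sigma> \<circ> t \<circ> t" by (simp only: tt')
    then show ?case using bruhat_le_refl by blast
  next
    case (step u w)
    show ?case
    proof (cases "bruhat_le n w (\<sigma> \<circ> t)")
      case True
      then show ?thesis using bruhat_le_step[OF step(1)] by blast
    next
      case False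
      then obtain v where v: "bruhat_le n v (\<sigma> \<circ> t)" "w = v \<circ> t" using step(3) by blast
      obtain p q where pq: "p < q" "w q < w p" "u = w \<circ> Transposition.transpose p q"
        using step(1) unfolding bruhat_step_iff by blast
      have u: "u = (v \<circ> Transposition.transpose (t p) (t q)) \<circ> t"
        unfolding pq(3) v(2) conj by (simp add: tt)
      show ?thesis
      proof (cases "p = i \<and> q = Suc i")
        case True
        then have "u = v \<circ> t \<circ> t" using pq(3) v(2) by (simp only: t_def)
        then have "u = v" by (simp only: tt')
        then show ?thesis using v by blast
      next
        case False
        then have "t p < t q" using pq(1) by (auto simp: t_def Transposition.transpose_def)
        moreover have "v (t q) < v (t p)" using pq(2) v(2) by simp
        ultimately have "bruhat_step n (v \<circ> Transposition.transpose (t p) (t q)) v"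
          unfolding bruhat_step_iff using bruhat_le_permutes[OF v(1) \<sigma>t] by blast
        then show ?thesis using bruhat_le_step[OF _ v(1)] u by blast
      qed
    qed
  qed
  show "bruhat_interval n \<sigma> = bruhat_interval n (\<sigma> \<circ> t) \<union> (\<lambda>v. v \<circ> t) ` bruhat_interval n (\<sigma> \<circ> t)"
  proof (intro equalityI subsetI)
    fix u assume "u \<in> bruhat_interval n \<sigma>"
    then show "u \<in> bruhat_interval n (\<sigma> \<circ> t) \<union> (\<lambda>v. v \<circ> t) ` bruhat_interval n (\<sigma> \<circ> t)"
      using split bruhat_le_permutes[OF _ \<sigma>t] unfolding bruhat_interval_def by blast
  next
    fix u assume "u \<in> bruhat_interval n (\<sigma> \<circ> t) \<union> (\<lambda>v. v \<circ> t) ` bruhat_interval n (\<sigma> \<circ> t)"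
    then show "u \<in> bruhat_interval n \<sigma>"
      using up bruhat_le_trans[OF _ bruhat_le_step[OF step\<sigma> bruhat_le_refl]] permutes_compose[OF tp]
      unfolding bruhat_interval_def by blast
  qed
qed

fun hamming_adj :: "bool list \<Rightarrow> bool list \<Rightarrow> bool" where
  "hamming_adj (x # xs) (y # ys) \<longleftrightarrow> (if x = y then hamming_adj xs ys else xs = ys)"
| "hamming_adj _ _ \<longleftrightarrow> False"

text \<open>Conjugation by \<open>s\<close> turns a transposition into the transposition of the two
  images.\<close>

lemma reflection_adj_comp_involution:
  assumes "\<And>x. s (s x) = x"
  shows "reflection_adj (u \<circ> s) (v \<circ> s) \<longleftrightarrow> reflection_adj u v"
proof -
  have *: "reflection_adj (u \<circ> s) (v \<circ> s)" if uv: "reflection_adj u v" for u v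
  proof -
    obtain i j where ij: "i \<noteq> j" "u = v \<circ> Transposition.transpose i j"
      using uv unfolding reflection_adj_def by blast
    have "s \<circ> Transposition.transpose (s i) (s j) = Transposition.transpose i j \<circ> s"
      using involution_conj_transpose[of s "s i" "s j", OF assms] unfolding assms .
    then have "u \<circ> s = v \<circ> s \<circ> Transposition.transpose (s i) (s j)"
      unfolding ij(2) comp_assoc by simp
    moreover have "s i \<noteq> s j" using ij(1) assms by metis
    ultimately show ?thesis unfolding reflection_adj_def by blast
  qed
  have "w \<circ> s \<circ> s = w" for w :: "nat \<Rightarrow> nat" by (rule ext) (simp add: assms)
  then show ?thesis using *[of u v] *[of "u \<circ> s" "v \<circ> s"] by metis
qed

text \<open>Evaluated at \<open>i\<close> and \<open>Suc i\<close>, the transposition relating the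
  two must move \<open>i\<close> above the cut and \<open>Suc i\<close> below it, and only the
  transposition of these two points does both.\<close>

lemma reflection_adj_across_cut:
  assumes a: "preserves_upto i a" and b: "preserves_upto i b"
  shows "reflection_adj (a \<circ> Transposition.transpose i (Suc i)) b \<longleftrightarrow> a = b"
proof
  let ?t = "Transposition.transpose i (Suc i)"
  have a_iff: "a k \<le> i \<longleftrightarrow> k \<le> i" and b_iff: "b k \<le> i \<longleftrightarrow> k \<le> i" for k
    using a b by (auto simp: preserves_upto_def)
  assume "reflection_adj (a \<circ> ?t) b"
  then obtain p q where pq: "p \<noteq> q" and eq: "a \<circ> ?t = b \<circ> Transposition.transpose p q"
    unfolding reflection_adj_def by blast
  have "\<not> Transposition.transpose p q i \<le> i" using fun_cong[OF eq, of i] a_iff[of "Suc i"] b_iff by auto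
  moreover have "Transposition.transpose p q (Suc i) \<le> i"
    using fun_cong[OF eq, of "Suc i"] a_iff[of i] b_iff by auto
  ultimately have "Transposition.transpose p q = ?t"
    by (auto simp: Transposition.transpose_def fun_eq_iff split: if_splits)
  then have "a \<circ> ?t \<circ> ?t = b \<circ> ?t \<circ> ?t" using eq by simp
  then show "a = b" by (simp add: comp_assoc)
next
  assume "a = b"
  then show "reflection_adj (a \<circ> Transposition.transpose i (Suc i)) b"
    unfolding reflection_adj_def by (intro exI[of _ i] exI[of _ "Suc i"]) auto
qed

lemma bruhat_interval_id: "bruhat_interval n id = {id}"
proof -
  have "u = id" if "bruhat_le n u id" for u
    using that
  proof (induction rule: bruhat_le_induct)
    case (step s t)
    then show ?case by (auto simp: bruhat_step_iff)
  qed simp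
  then show ?thesis by (auto simp: bruhat_interval_def bruhat_le_refl permutes_id)
qed

lemma bruhat_interval_hypercube:
  assumes "\<sigma> permutes {1..n}" "avoids_321_3412 \<sigma>" "card (inversions \<sigma>) = m"
  shows "\<exists>\<phi>. bij_betw \<phi> {xs. length xs = m} (bruhat_interval n \<sigma>) \<and>
    (\<forall>xs ys. length xs = m \<longrightarrow> length ys = m \<longrightarrow> (reflection_adj (\<phi> xs) (\<phi> ys) \<longleftrightarrow> hamming_adj xs ys))"
  using assms
proof (induction m arbitrary: \<sigma>)
  case 0
  then have "inversions \<sigma> = {}" using finite_inversions by auto
  then have id: "\<sigma> = id" using ex_descent[OF 0(1)] by (force simp: inversions_def)
  have "\<not> reflection_adj id id"
  proof
    assume "reflection_adj id id"
    then obtain i j :: nat where "i \<noteq> j" "id = id \<circ> Transposition.transpose i j"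
      unfolding reflection_adj_def by blast
    then show False by (metis comp_id id_apply id_comp transpose_apply_first)
  qed
  moreover have "bij_betw (\<lambda>_. id) {xs::bool list. length xs = 0} {id}" by (simp add: bij_betw_def)
  ultimately show ?case unfolding id bruhat_interval_id
    by (intro exI[of _ "\<lambda>_. id"] conjI allI impI) (simp_all add: id_def)
next
  case (Suc m)
  have "inversions id = {}" by (auto simp: inversions_def)
  then have "\<sigma> \<noteq> id" using Suc(4) by (metis card.empty nat.distinct(1))
  then obtain i where d: "\<sigma> (Suc i) < \<sigma> i" using ex_descent[OF Suc(2)] by metis
  define t where "t = Transposition.transpose i (Suc i)"
  define \<sigma>' where "\<sigma>' = \<sigma> \<circ> t"
  have ir: "i \<in> {1..n}" "Suc i \<in> {1..n}" using inversion_range[OF Suc(2) lessI d] .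
  have \<sigma>': "\<sigma>' permutes {1..n}" unfolding \<sigma>'_def t_def
    using ir by (intro permutes_compose[OF permutes_swap_id] Suc(2))
  have pr: "preserves_upto i \<sigma>'"
    unfolding \<sigma>'_def t_def using undo_descent_preserves_upto[OF Suc(2,3) d] .
  have av: "avoids_321_3412 \<sigma>'"
    using undo_descent_avoids[OF Suc(3)] pr by (simp add: \<sigma>'_def t_def)
  have "card (inversions \<sigma>') = m"
    using card_inversions_adjacent[OF finite_inversions[OF Suc(2)] d] Suc(4) by (simp add: \<sigma>'_def t_def)
  then obtain \<phi> where \<phi>: "bij_betw \<phi> {xs. length xs = m} (bruhat_interval n \<sigma>')"
    and adj: "\<And>xs ys. length xs = m \<Longrightarrow> length ys = m \<Longrightarrow> reflection_adj (\<phi> xs) (\<phi> ys) \<longleftrightarrow> hamming_adj xs ys"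
    using Suc(1)[OF \<sigma>' av] by blast
  note split = undo_descent_interval[OF Suc(2) d, folded t_def, folded \<sigma>'_def, OF pr]
  have tt: "t (t x) = x" for x by (simp add: t_def)
  have tt': "v \<circ> t \<circ> t = v" for v :: "nat \<Rightarrow> nat" by (rule ext) (simp add: tt)
  have pres: "preserves_upto i (\<phi> xs)" if "length xs = m" for xs
    using split(1) bij_betwE[OF \<phi>] that by blast
  \<comment> \<open>\<open>v \<circ> t\<close> sends \<open>i\<close> across the cut and
    \<open>w\<close> does not, so the two halves of the interval are disjoint.\<close>
  have cross: "v \<circ> t \<noteq> w" if "preserves_upto i v" "preserves_upto i w" for v w
  proof
    assume "v \<circ> t = w"
    then have "v (t i) = w i" by auto
    then show False using that unfolding preserves_upto_def t_def by (metis lessI not_le order_refl transpose_apply_first)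
  qed
  \<comment> \<open>The new coordinate, put in front, records whether the descent is still
    present.\<close>
  define \<psi> where "\<psi> xs = (if hd xs then \<phi> (tl xs) \<circ> t else \<phi> (tl xs))" for xs
  have lists: "{xs::bool list. length xs = Suc m} = (#) False ` {xs. length xs = m} \<union> (#) True ` {xs. length xs = m}"
  proof -
    have "xs \<in> (#) False ` {xs. length xs = m} \<union> (#) True ` {xs. length xs = m}" if "length xs = Suc m" for xs
      using that by (cases xs; cases "hd xs") auto
    then show ?thesis by auto
  qed
  have im: "\<psi> ` {xs. length xs = Suc m} = bruhat_interval n \<sigma>"
  proof -
    have "\<psi> ` {xs. length xs = Suc m} = \<phi> ` {xs. length xs = m} \<union> (\<lambda>v. v \<circ> t) ` \<phi> ` {xs. length xs = m}"
      unfolding lists image_Un image_image by (simp add: \<psi>_def)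
    then show ?thesis using bij_betw_imp_surj_on[OF \<phi>] split(2) by simp
  qed
  have inj: "inj_on \<psi> {xs. length xs = Suc m}"
  proof (rule inj_onI, clarsimp)
    fix xs ys :: "bool list" assume len: "length xs = Suc m" "length ys = Suc m" and eq: "\<psi> xs = \<psi> ys"
    obtain x xs' y ys' where xy: "xs = x # xs'" "ys = y # ys'" "length xs' = m" "length ys' = m"
      using len by (metis length_Suc_conv)
    have inj\<phi>: "\<phi> xs' = \<phi> ys' \<Longrightarrow> xs' = ys'" using inj_onD[OF bij_betw_imp_inj_on[OF \<phi>]] xy by blast
    show "xs = ys"
    proof (cases "x = y")
      case True
      then have "\<phi> xs' = \<phi> ys'" using eq xy tt' by (auto simp: \<psi>_def split: if_splits) metis
      then show ?thesis using True xy inj\<phi> by simp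
    next
      case False
      then show ?thesis using eq xy cross[OF pres[OF xy(3)] pres[OF xy(4)]] cross[OF pres[OF xy(4)] pres[OF xy(3)]]
        by (auto simp: \<psi>_def split: if_splits)
    qed
  qed
  have "reflection_adj (\<psi> xs) (\<psi> ys) \<longleftrightarrow> hamming_adj xs ys"
    if len: "length xs = Suc m" "length ys = Suc m" for xs ys
  proof -
    obtain x xs' y ys' where xy: "xs = x # xs'" "ys = y # ys'" "length xs' = m" "length ys' = m"
      using len by (metis length_Suc_conv)
    have inj\<phi>: "\<phi> xs' = \<phi> ys' \<longleftrightarrow> xs' = ys'" using inj_onD[OF bij_betw_imp_inj_on[OF \<phi>]] xy by blast
    note a = reflection_adj_across_cut[OF pres[OF xy(3)] pres[OF xy(4)], folded t_def]
      reflection_adj_across_cut[OF pres[OF xy(4)] pres[OF xy(3)], folded t_def]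
    consider "x = y" | "x" "\<not> y" | "\<not> x" "y" by blast
    then show ?thesis
    proof cases
      case 1
      then show ?thesis using xy adj reflection_adj_comp_involution[of t, OF tt] by (simp add: \<psi>_def)
    next
      case 2
      then show ?thesis using xy a inj\<phi> by (simp add: \<psi>_def)
    next
      case 3
      have "reflection_adj (\<psi> xs) (\<psi> ys) \<longleftrightarrow> reflection_adj (\<psi> ys) (\<psi> xs)" using reflection_adj_sym by blast
      then show ?thesis using 3 xy a inj\<phi> by (auto simp: \<psi>_def)
    qed
  qed
  then show ?case using im inj by (intro exI[of _ \<psi>]) (auto simp: bij_betw_def)
qed

text \<open>The last coordinate separates the layers: \<open>K\<close> is a subdivided K_{3,3} in
  layer 0, \<open>C\<close> a subdivided K_{2,3} in layer 1, and each route of \<open>D\<close>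
  flips the last coordinate. In \<open>K\<close> only the routes from 00110 leave the 3-cube of the
  first three coordinates. \<open>odd\<close> converts digits to truth values.\<close>

lemma hypercube_5_not_toroidal:
  assumes inj: "inj_on \<phi> {xs. length xs = 5}" and V: "\<phi> ` {xs. length xs = 5} \<subseteq> verts G"
    and E: "\<And>xs ys. length xs = 5 \<Longrightarrow> length ys = 5 \<Longrightarrow> hamming_adj xs ys \<Longrightarrow> {\<phi> xs, \<phi> ys} \<in> undirected_edges G"
  shows "\<not> toroidal G"
proof -
  define K where "K = map (map (map (map odd)))
    [[[[0,0,1,1,0], [1,0,1,1,0], [1,1,1,1,0], [1,1,1,0,0]], [[0,0,1,1,0], [0,0,1,0,0]],
      [[0,0,1,1,0], [0,0,0,1,0], [0,0,0,0,0]]],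
     [[[0,1,1,0,0], [1,1,1,0,0]], [[0,1,1,0,0], [0,0,1,0,0]], [[0,1,1,0,0], [0,1,0,0,0], [0,0,0,0,0]]],
     [[[1,0,1,0,0], [1,1,1,0,0]], [[1,0,1,0,0], [0,0,1,0,0]], [[1,0,1,0,0], [1,0,0,0,0], [0,0,0,0,0::nat]]]]"
  define C where "C = map (map (map odd))
    [[[0,0,0,0,1], [0,0,1,0,1], [0,0,1,1,1], [0,0,0,1,1]], [[0,0,0,0,1], [0,1,0,0,1], [0,1,0,1,1], [0,0,0,1,1]],
     [[0,0,0,0,1], [1,0,0,0,1], [1,0,0,1,1], [0,0,0,1,1::nat]]]"
  define D where "D = map (map (map odd))
    [[[0,0,1,0,1], [0,0,1,0,0]], [[0,1,0,0,1], [0,1,0,0,0]], [[1,0,0,0,1], [1,0,0,0,0::nat]]]"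
  have ob: "torus_obstruction_in hamming_adj K C D" unfolding K_def C_def D_def by code_simp
  have "\<forall>i\<in>set [0..<3]. \<forall>j\<in>set [0..<3]. \<forall>xs\<in>set (K ! i ! j). length xs = 5"
    "\<forall>i\<in>set [0..<3]. \<forall>xs\<in>set (C ! i). length xs = 5" "\<forall>i\<in>set [0..<3]. \<forall>xs\<in>set (D ! i). length xs = 5"
    unfolding K_def C_def D_def by code_simp+
  then show ?thesis
    by (intro torus_obstruction_not_toroidal[OF ob _ _ _ inj V]) (use E in auto)
qed

section \<open>Drawings on the torus\<close>

definition prod_edges :: "'a set \<Rightarrow> 'a set set \<Rightarrow> 'b set \<Rightarrow> 'b set set \<Rightarrow> ('a \<times> 'b) set set" where
  "prod_edges V E W F = {e \<times> {w} |e w. e \<in> E \<and> w \<in> W} \<union> {{v} \<times> f |v f. v \<in> V \<and> f \<in> F}"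

text \<open>Each edge of the product is constant in one coordinate and follows the given curve in
  the other, so curves of different directions meet in at most one point, and only over a
  vertex.\<close>

lemma drawing_on_product:
  fixes g :: "'a set \<Rightarrow> real \<Rightarrow> 's::topological_space" and h :: "'b set \<Rightarrow> real \<Rightarrow> 't::topological_space"
  assumes d1: "drawing_on S V E p g" and d2: "drawing_on T W F q h"
    and E: "\<And>e. e \<in> E \<Longrightarrow> e \<subseteq> V \<and> card e = 2" and F: "\<And>f. f \<in> F \<Longrightarrow> f \<subseteq> W \<and> card f = 2"
  shows "\<exists>k. drawing_on (S \<times> T) (V \<times> W) (prod_edges V E W F) (map_prod p q) k"
proof -
  note D1 = drawing_onD[OF d1] and D2 = drawing_onD[OF d2]
  \<comment> \<open>The direction of an edge is read off from its number of second coordinates: 1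
    for \<open>e \<times> {w}\<close> and 2 for \<open>{v} \<times> f\<close>.\<close>
  define k where "k e = (if card (snd ` e) = 1 then (\<lambda>t. (g (fst ` e) t, q (the_elem (snd ` e))))
      else (\<lambda>t. (p (the_elem (fst ` e)), h (snd ` e) t)))" for e :: "('a \<times> 'b) set"
  have kH: "k (e \<times> {w}) = (\<lambda>t. (g e t, q w))" if "e \<in> E" for e w
  proof -
    have "e \<noteq> {}" using E[OF that] by auto
    then show ?thesis by (simp add: k_def)
  qed
  have kV: "k ({v} \<times> f) = (\<lambda>t. (p v, h f t))" if "f \<in> F" for v f
  proof -
    have "f \<noteq> {}" "card f \<noteq> 1" using F[OF that] by auto
    then show ?thesis by (simp add: k_def)
  qed
  have imH: "path_image (k (e \<times> {w})) = path_image (g e) \<times> {q w}" if "e \<in> E" for e w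
    unfolding kH[OF that] by (auto simp: path_image_def)
  have imV: "path_image (k ({v} \<times> f)) = {p v} \<times> path_image (h f)" if "f \<in> F" for v f
    unfolding kV[OF that] by (auto simp: path_image_def)
  have arcH: "arc (k (e \<times> {w}))" if "e \<in> E" for e w
    using D1(3)[OF that] unfolding kH[OF that] arc_def path_def by (auto intro!: continuous_intros simp: inj_on_def)
  have arcV: "arc (k ({v} \<times> f))" if "f \<in> F" for v f
    using D2(3)[OF that] unfolding kV[OF that] arc_def path_def by (auto intro!: continuous_intros simp: inj_on_def)
  have endsH: "{pathstart (k (e \<times> {w})), pathfinish (k (e \<times> {w}))} = map_prod p q ` (e \<times> {w})" if "e \<in> E" for e w
  proof -
    have "{pathstart (k (e \<times> {w})), pathfinish (k (e \<times> {w}))} = {pathstart (g e), pathfinish (g e)} \<times> {q w}"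
      unfolding kH[OF that] by (auto simp: pathstart_def pathfinish_def)
    then show ?thesis using D1(5)[OF that] by auto
  qed
  have endsV: "{pathstart (k ({v} \<times> f)), pathfinish (k ({v} \<times> f))} = map_prod p q ` ({v} \<times> f)" if "f \<in> F" for v f
  proof -
    have "{pathstart (k ({v} \<times> f)), pathfinish (k ({v} \<times> f))} = {p v} \<times> {pathstart (h f), pathfinish (h f)}"
      unfolding kV[OF that] by (auto simp: pathstart_def pathfinish_def)
    then show ?thesis using D2(5)[OF that] by auto
  qed
  have mapX: "map_prod p q ` (A \<times> B) = p ` A \<times> q ` B" for A B by (auto simp: map_prod_surj_on)
  have ptH: "path_image (g e) \<inter> {p v} = p ` (e \<inter> {v})" if "e \<in> E" "v \<in> V" for e v
  proof -
    have "p v \<in> path_image (g e) \<longleftrightarrow> v \<in> e"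
      using D1(6)[OF that(1)] D1(1) that(2) E[OF that(1)] by (auto simp: inj_on_def)
    then show ?thesis by auto
  qed
  have ptV: "path_image (h f) \<inter> {q w} = q ` (f \<inter> {w})" if "f \<in> F" "w \<in> W" for f w
  proof -
    have "q w \<in> path_image (h f) \<longleftrightarrow> w \<in> f"
      using D2(6)[OF that(1)] D2(1) that(2) F[OF that(1)] by (auto simp: inj_on_def)
    then show ?thesis by auto
  qed
  have HV: "path_image (k (e \<times> {w})) \<inter> path_image (k ({v} \<times> f)) = map_prod p q ` ((e \<times> {w}) \<inter> ({v} \<times> f))"
    if "e \<in> E" "f \<in> F" "v \<in> V" "w \<in> W" for e f v w
    unfolding imH[OF that(1)] imV[OF that(2)] Times_Int_Times mapX
    using ptH[OF that(1,3)] ptV[OF that(2,4)] by (simp add: Int_commute)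
  have HH: "path_image (k (e \<times> {w})) \<inter> path_image (k (e' \<times> {w'})) = map_prod p q ` ((e \<times> {w}) \<inter> (e' \<times> {w'}))"
    if "e \<in> E" "e' \<in> E" "w \<in> W" "w' \<in> W" "e \<times> {w} \<noteq> e' \<times> {w'}" for e e' w w'
  proof (cases "w = w'")
    case True
    then have "e \<noteq> e'" using that(5) by auto
    then show ?thesis unfolding imH[OF that(1)] imH[OF that(2)] Times_Int_Times mapX
      using D1(7)[OF that(1,2)] True by simp
  next
    case False
    then have "q w \<noteq> q w'" using D2(1) that(3,4) by (auto simp: inj_on_def)
    then show ?thesis unfolding imH[OF that(1)] imH[OF that(2)] Times_Int_Times mapX using False by simp
  qed
  have VV: "path_image (k ({v} \<times> f)) \<inter> path_image (k ({v'} \<times> f')) = map_prod p q ` (({v} \<times> f) \<inter> ({v'} \<times> f'))"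
    if "f \<in> F" "f' \<in> F" "v \<in> V" "v' \<in> V" "{v} \<times> f \<noteq> {v'} \<times> f'" for f f' v v'
  proof (cases "v = v'")
    case True
    then have "f \<noteq> f'" using that(5) by auto
    then show ?thesis unfolding imV[OF that(1)] imV[OF that(2)] Times_Int_Times mapX
      using D2(7)[OF that(1,2)] True by simp
  next
    case False
    then have "p v \<noteq> p v'" using D1(1) that(3,4) by (auto simp: inj_on_def)
    then show ?thesis unfolding imV[OF that(1)] imV[OF that(2)] Times_Int_Times mapX using False by simp
  qed
  have "drawing_on (S \<times> T) (V \<times> W) (prod_edges V E W F) (map_prod p q) k"
    unfolding drawing_on_def
  proof (intro conjI ballI impI)
    show "inj_on (map_prod p q) (V \<times> W)" using D1(1) D2(1) by (rule map_prod_inj_on)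
    show "map_prod p q ` (V \<times> W) \<subseteq> S \<times> T" unfolding mapX using D1(2) D2(2) by blast
    fix e assume "e \<in> prod_edges V E W F"
    then consider (H) e' w where "e = e' \<times> {w}" "e' \<in> E" "w \<in> W" | (V) v f where "e = {v} \<times> f" "f \<in> F" "v \<in> V"
      unfolding prod_edges_def by blast
    note ee = this
    show "arc (k e)" using ee by cases (use arcH arcV in auto)
    show "{pathstart (k e), pathfinish (k e)} = map_prod p q ` e" using ee by cases (use endsH endsV in auto)
    show "path_image (k e) \<subseteq> S \<times> T"
      using ee
    proof cases
      case H
      then show ?thesis using imH[OF H(2)] D1(4)[OF H(2)] D2(2) by auto
    next
      case V
      then show ?thesis using imV[OF V(2)] D2(4)[OF V(2)] D1(2) by auto
    qed
    show "path_image (k e) \<inter> map_prod p q ` (V \<times> W) = map_prod p q ` e"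
      using ee
    proof cases
      case H
      then show ?thesis unfolding H(1) imH[OF H(2)] mapX Times_Int_Times using D1(6)[OF H(2)] by auto
    next
      case V
      then show ?thesis unfolding V(1) imV[OF V(2)] mapX Times_Int_Times using D2(6)[OF V(2)] by auto
    qed
  next
    fix e e' assume "e \<in> prod_edges V E W F" "e' \<in> prod_edges V E W F" "e \<noteq> e'"
    moreover from this(1) consider (H) e0 w where "e = e0 \<times> {w}" "e0 \<in> E" "w \<in> W" | (V) v f where "e = {v} \<times> f" "f \<in> F" "v \<in> V"
      unfolding prod_edges_def by blast
    note ee = this
    moreover from \<open>e' \<in> prod_edges V E W F\<close> consider (H) e0 w where "e' = e0 \<times> {w}" "e0 \<in> E" "w \<in> W" | (V) v f where "e' = {v} \<times> f" "f \<in> F" "v \<in> V"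
      unfolding prod_edges_def by blast
    note ee' = this
    show "path_image (k e) \<inter> path_image (k e') = map_prod p q ` (e \<inter> e')"
      using ee
    proof cases
      case H: (H e0 w)
      show ?thesis using ee'
      proof cases
        case H': (H e1 w')
        then show ?thesis using HH[OF H(2) H'(2) H(3) H'(3)] H \<open>e \<noteq> e'\<close> by auto
      next
        case V': (V v f)
        then show ?thesis using HV[OF H(2) V'(2,3) H(3)] H by simp
      qed
    next
      case V: (V v f)
      show ?thesis using ee'
      proof cases
        case H': (H e1 w')
        then show ?thesis using HV[OF H'(2) V(2,3) H'(3)] V by (simp add: Int_commute)
      next
        case V': (V v' f')
        then show ?thesis using VV[OF V(2) V'(2) V(3) V'(3)] V \<open>e \<noteq> e'\<close> by auto
      qed
    qed
  qed
  then show ?thesis by blast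
qed

section \<open>The 4-cycle on the circle and the 4-cube on the torus\<close>

definition cycle4_edge :: "nat \<Rightarrow> nat set" where
  "cycle4_edge j = {j, Suc j mod 4}"

lemma inj_cycle4_edge: "inj_on cycle4_edge {..<4}"
proof -
  have "Suc (Suc i mod 4) mod 4 \<noteq> i" if "i < 4" for i :: nat using that by presburger
  then show ?thesis by (intro inj_onI) (auto simp: cycle4_edge_def doubleton_eq_iff)
qed

lemma drawing_cycle4: "\<exists>p g. drawing_on (sphere (0::complex) 1) {..<4} (cycle4_edge ` {..<4}) p g"
proof -
  define p where "p j = cis (2 * pi * (real j / 4))" for j
  define s where "s j t = cis (2 * pi * ((real j + t) / 4))" for j t
  define g where "g e = s (inv_into {..<4} cycle4_edge e)" for e
  have g: "g (cycle4_edge j) = s j" if "j < 4" for j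
    unfolding g_def using inj_cycle4_edge that by simp
  have s0: "s j 0 = p j" for j by (simp add: s_def p_def)
  have s1: "s j 1 = p (Suc j mod 4)" if "j < 4" for j
  proof (cases "j = 3")
    case True
    then show ?thesis using cis_2pi_eq_iff[of 1 0] by (simp add: s_def p_def)
  next
    case False
    then have "Suc j mod 4 = Suc j" using that by simp
    then show ?thesis by (simp add: s_def p_def add.commute)
  qed
  \<comment> \<open>Equal points have angles that differ by whole turns, so \<open>t - t'\<close> is
    an integer between -1 and 1. The value 0 means the same parameter on the same quarter, 1 and -1
    the common end of consecutive quarters.\<close>
  have key: "j = j' \<and> t = t' \<or> t = 0 \<and> t' = 1 \<and> j = Suc j' mod 4 \<or> t = 1 \<and> t' = 0 \<and> j' = Suc j mod 4"
    if "s j t = s j' t'" "j < 4" "j' < 4" "t \<in> {0..1}" "t' \<in> {0..1}" for j j' t t'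
  proof -
    have "(real j + t) / 4 - (real j' + t') / 4 \<in> \<int>"
      using that(1) unfolding s_def cis_2pi_eq_iff .
    then obtain n :: int where "(real j + t) / 4 - (real j' + t') / 4 = n" by (auto simp: Ints_def)
    then have n: "t - t' = real_of_int (4 * n + int j' - int j)" by (simp add: field_simps)
    define m where "m = 4 * n + int j' - int j"
    have "-1 \<le> t - t'" "t - t' \<le> 1" using that by auto
    then have "-1 \<le> m" "m \<le> 1" using n m_def by linarith+
    then consider "m = 0" | "m = 1" | "m = -1" by linarith
    then show ?thesis
    proof cases
      case 1
      then have "int j - int j' = 4 * n" "t = t'" using n by (auto simp: m_def)
      then have "n = 0" using that by linarith
      then show ?thesis using \<open>int j - int j' = 4 * n\<close> \<open>t = t'\<close> by simp
    next
      case 2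
      then have "t - t' = 1" using n by (simp add: m_def)
      then have t: "t = 1" "t' = 0" using that by auto
      have "int j' = int j + 1 - 4 * n" using 2 by (simp add: m_def)
      moreover have "0 \<le> n" "n \<le> 1" using calculation that(2,3) by linarith+
      then have "n = 0 \<or> n = 1" by linarith
      ultimately have "j' = Suc j \<or> j = 3 \<and> j' = 0" using that(2,3) by auto
      then show ?thesis using t that(3) by auto
    next
      case 3
      then have "t - t' = -1" using n by (simp add: m_def)
      then have t: "t = 0" "t' = 1" using that by auto
      have "int j = int j' + 1 + 4 * n" using 3 by (simp add: m_def)
      moreover have "-1 \<le> n" "n \<le> 0" using calculation that(2,3) by linarith+
      then have "n = 0 \<or> n = -1" by linarith
      ultimately have "j = Suc j' \<or> j' = 3 \<and> j = 0" using that(2,3) by auto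
      then show ?thesis using t that(2) by auto
    qed
  qed
  have p_inj: "j = j'" if "p j = p j'" "j < 4" "j' < 4" for j j'
    using key[of j 0 j' 0] that s0 by auto
  have pe: "p ` cycle4_edge j = {s j 0, s j 1}" if "j < 4" for j
    using s0 s1[OF that] by (simp add: cycle4_edge_def)
  have "drawing_on (sphere (0::complex) 1) {..<4} (cycle4_edge ` {..<4}) p g"
    unfolding drawing_on_def
  proof (intro conjI ballI impI)
    show "inj_on p {..<4}" using p_inj by (auto simp: inj_on_def)
    show "p ` {..<4} \<subseteq> sphere 0 1" by (auto simp: p_def)
    fix e assume "e \<in> cycle4_edge ` {..<4}"
    then obtain j where j: "j < 4" "e = cycle4_edge j" by blast
    have ge: "g e = s j" using g j by simp
    show "arc (g e)" unfolding ge arc_def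
    proof
      show "path (s j)" unfolding path_def s_def by (intro continuous_intros) auto
      show "inj_on (s j) {0..1}"
      proof (rule inj_onI)
        fix t t' assume "t \<in> {0..1}" "t' \<in> {0..1}" "s j t = s j t'"
        moreover have "Suc j mod 4 \<noteq> j" using j(1) by presburger
        ultimately show "t = t'" using key[of j t j t'] j(1) by auto
      qed
    qed
    show "path_image (g e) \<subseteq> sphere 0 1" unfolding ge by (auto simp: path_image_def s_def)
    show "{pathstart (g e), pathfinish (g e)} = p ` e"
      unfolding ge unfolding j(2) pe[OF j(1)] by (simp add: pathstart_def pathfinish_def)
    show "path_image (g e) \<inter> p ` {..<4} = p ` e"
    proof (intro equalityI subsetI)
      fix z assume "z \<in> path_image (g e) \<inter> p ` {..<4}"
      then obtain t i where "t \<in> {0..1}" "z = s j t" "i < 4" "z = s i 0"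
        unfolding ge path_image_def using s0 by auto
      then have "t = 0 \<or> t = 1" using key[of j t i 0] j(1) by auto
      then show "z \<in> p ` e" using \<open>z = s j t\<close> unfolding j(2) pe[OF j(1)] by auto
    next
      fix z assume z: "z \<in> p ` e"
      have "e \<subseteq> {..<4}" using j by (auto simp: cycle4_edge_def)
      then have "z \<in> p ` {..<4}" using z by blast
      moreover have "z = s j 0 \<or> z = s j 1" using z unfolding j(2) pe[OF j(1)] by simp
      then have "z \<in> path_image (g e)" unfolding ge path_image_def by auto
      ultimately show "z \<in> path_image (g e) \<inter> p ` {..<4}" by blast
    qed
  next
    fix e e' assume "e \<in> cycle4_edge ` {..<4}" "e' \<in> cycle4_edge ` {..<4}" "e \<noteq> e'"
    then obtain j j' where j: "j < 4" "e = cycle4_edge j" "j' < 4" "e' = cycle4_edge j'" "j \<noteq> j'" by blast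
    show "path_image (g e) \<inter> path_image (g e') = p ` (e \<inter> e')"
    proof (intro equalityI subsetI)
      fix z assume "z \<in> path_image (g e) \<inter> path_image (g e')"
      then obtain t t' where t: "t \<in> {0..1}" "t' \<in> {0..1}" "z = s j t" "z = s j' t'"
        using g j by (auto simp: path_image_def)
      then consider "t = 0" "j = Suc j' mod 4" | "t = 1" "j' = Suc j mod 4" using key[of j t j' t'] j by auto
      then show "z \<in> p ` (e \<inter> e')"
      proof cases
        case 1
        then show ?thesis using t(3) s0 j by (auto simp: cycle4_edge_def)
      next
        case 2
        then show ?thesis using t(3) s1[OF j(1)] j by (auto simp: cycle4_edge_def)
      qed
    next
      fix z assume "z \<in> p ` (e \<inter> e')"
      then have "z \<in> p ` cycle4_edge j" "z \<in> p ` cycle4_edge j'" using j by auto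
      then have "z = s j 0 \<or> z = s j 1" "z = s j' 0 \<or> z = s j' 1"
        unfolding pe[OF j(1)] pe[OF j(3)] by simp_all
      then have "z \<in> path_image (s j)" "z \<in> path_image (s j')" unfolding path_image_def by auto
      then show "z \<in> path_image (g e) \<inter> path_image (g e')" using g j by simp
    qed
  qed
  then show ?thesis by blast
qed

definition hypercube_edges :: "nat \<Rightarrow> bool list set set" where
  "hypercube_edges m = {{xs, ys} |xs ys. length xs = m \<and> length ys = m \<and> hamming_adj xs ys}"

lemma drawing_hypercube_4: "\<exists>p g. drawing_on torus {xs. length xs = 4} (hypercube_edges 4) p g"
proof -
  obtain p g where d: "drawing_on (sphere (0::complex) 1) {..<4} (cycle4_edge ` {..<4}) p g"
    using drawing_cycle4 by blast
  have ce: "e \<subseteq> {..<4} \<and> card e = 2" if "e \<in> cycle4_edge ` {..<4}" for e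
  proof -
    obtain j where j: "j < 4" "e = cycle4_edge j" using \<open>e \<in> _\<close> by blast
    have "Suc j mod 4 \<noteq> j" using j(1) by presburger
    then show ?thesis using j by (auto simp: cycle4_edge_def)
  qed
  let ?E = "prod_edges {..<4} (cycle4_edge ` {..<4}) {..<4} (cycle4_edge ` {..<4})"
  obtain k where k: "drawing_on torus ({..<4} \<times> {..<4}) ?E (map_prod p p) k"
    using drawing_on_product[OF d d ce ce] unfolding torus_def by blast
  \<comment> \<open>A Gray code: going round the 4-cycle the two bits run through 00, 10, 11, 01, so
    flipping one bit moves along an edge.\<close>
  define c where "c x y = (if x then (if y then 2 else 1) else (if y then 3 else 0::nat))" for x y
  define \<phi> where "\<phi> xs = (c (xs ! 0) (xs ! 1), c (xs ! 2) (xs ! 3))" for xs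
  have c4: "c x y < 4" for x y by (simp add: c_def)
  have c_inj: "c x y = c x' y' \<longleftrightarrow> x = x' \<and> y = y'" for x y x' y' by (simp add: c_def)
  have "{c x y, c (\<not> x) y} = cycle4_edge (if y then 2 else 0)"
    "{c x y, c x (\<not> y)} = cycle4_edge (if x then 1 else 3)" for x y
    by (cases x; cases y; auto simp: c_def cycle4_edge_def)+
  then have c_adj: "{c x y, c (\<not> x) y} \<in> cycle4_edge ` {..<4}" "{c x y, c x (\<not> y)} \<in> cycle4_edge ` {..<4}" for x y
    by simp_all
  have len4: "\<exists>a b c d. xs = [a, b, c, d]" if "length xs = 4" for xs :: "bool list"
    using that by (auto simp: numeral_eq_Suc length_Suc_conv)
  have "drawing_on torus {xs. length xs = 4} (hypercube_edges 4) (map_prod p p \<circ> \<phi>) (\<lambda>e. k (\<phi> ` e))"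
  proof (rule drawing_on_subgraph[OF k])
    show "inj_on \<phi> {xs. length xs = 4}"
      by (rule inj_onI) (auto simp: \<phi>_def c_inj dest!: len4)
    show "\<phi> ` {xs. length xs = 4} \<subseteq> {..<4} \<times> {..<4}" by (auto simp: \<phi>_def c4)
    fix e assume "e \<in> hypercube_edges 4"
    then obtain xs ys where e: "e = {xs, ys}" "length xs = 4" "length ys = 4" "hamming_adj xs ys"
      unfolding hypercube_edges_def by blast
    obtain a1 a2 a3 a4 b1 b2 b3 b4 where ab: "xs = [a1, a2, a3, a4]" "ys = [b1, b2, b3, b4]"
      using len4 e by metis
    have H: "{(u, w), (v, w)} \<in> ?E" if "{u, v} \<in> cycle4_edge ` {..<4}" "w < 4" for u v w
      using that unfolding prod_edges_def by (intro UnI1) (auto intro!: exI[of _ "{u, v}"])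
    have V: "{(w, u), (w, v)} \<in> ?E" if "{u, v} \<in> cycle4_edge ` {..<4}" "w < 4" for u v w
      using that unfolding prod_edges_def by (intro UnI2) (auto intro!: exI[of _ "{u, v}"])
    consider "b1 = (\<not> a1)" "b2 = a2" "b3 = a3" "b4 = a4" | "b1 = a1" "b2 = (\<not> a2)" "b3 = a3" "b4 = a4"
      | "b1 = a1" "b2 = a2" "b3 = (\<not> a3)" "b4 = a4" | "b1 = a1" "b2 = a2" "b3 = a3" "b4 = (\<not> a4)"
      using e(4) ab by (auto split: if_splits)
    then have "\<phi> ` e \<in> ?E"
    proof cases
      case 1
      then show ?thesis using H[OF c_adj(1)[of a1 a2] c4[of a3 a4]] e(1) ab by (simp add: \<phi>_def)
    next
      case 2
      then show ?thesis using H[OF c_adj(2)[of a1 a2] c4[of a3 a4]] e(1) ab by (simp add: \<phi>_def)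
    next
      case 3
      then show ?thesis using V[OF c_adj(1)[of a3 a4] c4[of a1 a2]] e(1) ab by (simp add: \<phi>_def)
    next
      case 4
      then show ?thesis using V[OF c_adj(2)[of a3 a4] c4[of a1 a2]] e(1) ab by (simp add: \<phi>_def)
    qed
    then show "e \<subseteq> {xs. length xs = 4} \<and> \<phi> ` e \<in> ?E" using e by auto
  qed
  then show ?thesis by blast
qed

text \<open>One side is numbered 0, 1, 2 and the other 3, 4, 5, so the indices of an edge are its
  minimum and its maximum less 3.\<close>

lemma K33_arcs_drawing:
  fixes k :: "nat \<Rightarrow> nat \<Rightarrow> real \<Rightarrow> 's::t2_space"
  assumes K: "K33_arcs a b k" and S: "\<And>i j. i < 3 \<Longrightarrow> j < 3 \<Longrightarrow> path_image (k i j) \<subseteq> S"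
  shows "drawing_on S {..<6} {{i, j + 3} |i j. i < 3 \<and> j < 3}
    (\<lambda>i. if i < 3 then a i else b (i - 3)) (\<lambda>e. k (Min e) (Max e - 3))"
proof -
  note D = K33_arcsD[OF K] and I = K33_arcs_Int[OF K]
  define p where "p i = (if i < 3 then a i else b (i - 3))" for i :: nat
  define g where "g e = k (Min e) (Max e - 3)" for e :: "nat set"
  have g: "g {i, j + 3} = k i j" if "i < 3" for i j using that by (simp add: g_def)
  have pe: "p ` {i, j + 3} = {a i, b j}" if "i < 3" for i j using that by (auto simp: p_def)
  have inI: "a i \<in> path_image (k i j)" "b j \<in> path_image (k i j)" if "i < 3" "j < 3" for i j
    using D(2,3)[OF that] by (metis pathstart_in_path_image, metis pathfinish_in_path_image)
  have ab: "a i \<noteq> b j" if "i < 3" "j < 3" for i j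
    using D(1-3)[OF that] arc_distinct_ends by metis
  \<comment> \<open>\<open>a i'\<close> also lies on the arc \<open>(i', j')\<close> for any
    \<open>j'\<close> other than \<open>j\<close>, and for \<open>i'\<close> other than
    \<open>i\<close> that arc is disjoint from \<open>(i, j)\<close>.\<close>
  have a_in: "i' = i" if "i < 3" "j < 3" "i' < 3" "a i' \<in> path_image (k i j)" for i i' j
  proof (rule ccontr)
    assume "i' \<noteq> i"
    define j' where "j' = (if j = 0 then 1 else 0::nat)"
    have "j' < 3" "j \<noteq> j'" by (auto simp: j'_def)
    then show False using I[of i j i' j'] inI(1)[of i' j'] that \<open>i' \<noteq> i\<close> by auto
  qed
  have b_in: "j' = j" if "i < 3" "j < 3" "j' < 3" "b j' \<in> path_image (k i j)" for i j j'
  proof (rule ccontr)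
    assume "j' \<noteq> j"
    define i' where "i' = (if i = 0 then 1 else 0::nat)"
    have "i' < 3" "i \<noteq> i'" by (auto simp: i'_def)
    then show False using I[of i j i' j'] inI(2)[of i' j'] that \<open>j' \<noteq> j\<close> by auto
  qed
  have six: "x < 3 \<or> (\<exists>j<3. x = j + 3)" if "x < 6" for x :: nat
  proof (cases "x < 3")
    case False
    then show ?thesis using that by (intro disjI2 exI[of _ "x - 3"]) auto
  qed auto
  have "drawing_on S {..<6} {{i, j + 3} |i j. i < 3 \<and> j < 3} p g"
    unfolding drawing_on_def
  proof (intro conjI ballI impI)
    show "inj_on p {..<6}"
    proof (rule inj_onI)
      fix x y assume "x \<in> {..<6}" "y \<in> {..<6}" and eq: "p x = p y"
      then have "x < 3 \<or> (\<exists>j<3. x = j + 3)" "y < 3 \<or> (\<exists>j<3. y = j + 3)" using six by auto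
      then consider "x < 3" "y < 3" | j where "x < 3" "j < 3" "y = j + 3" | i where "i < 3" "x = i + 3" "y < 3"
        | i j where "i < 3" "x = i + 3" "j < 3" "y = j + 3" by blast
      then show "x = y"
      proof cases
        case 1
        then show ?thesis using a_in[of y 0 x] inI(1)[of y 0] eq by (simp add: p_def)
      next
        case (2 j)
        then show ?thesis using ab[of x j] eq by (simp add: p_def)
      next
        case (3 i)
        then show ?thesis using ab[of y i] eq by (simp add: p_def)
      next
        case (4 i j)
        then show ?thesis using b_in[of 0 j i] inI(2)[of 0 j] eq by (simp add: p_def)
      qed
    qed
    show "p ` {..<6} \<subseteq> S"
    proof (rule image_subsetI)
      fix x :: nat assume "x \<in> {..<6}"
      then consider "x < 3" | j where "j < 3" "x = j + 3" using six by auto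
      then show "p x \<in> S"
        by cases (use inI[of x 0] S[of x 0] inI(2)[of 0] S[of 0] in \<open>auto simp: p_def\<close>)
    qed
    fix e assume "e \<in> {{i, j + 3} |i j. i < 3 \<and> j < (3::nat)}"
    then obtain i j where e: "e = {i, j + 3}" "i < 3" "j < 3" by blast
    show "arc (g e)" "path_image (g e) \<subseteq> S" "{pathstart (g e), pathfinish (g e)} = p ` e"
      unfolding e(1) g[OF e(2)] pe[OF e(2)] using D[OF e(2,3)] S[OF e(2,3)] by auto
    show "path_image (g e) \<inter> p ` {..<6} = p ` e"
    proof (intro equalityI subsetI)
      fix z assume "z \<in> path_image (g e) \<inter> p ` {..<6}"
      then obtain x where x: "x < 6" "z = p x" "p x \<in> path_image (k i j)" using g[OF e(2)] e(1) by auto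
      consider "x < 3" | j' where "j' < 3" "x = j' + 3" using six[OF x(1)] by auto
      then have "x \<in> e"
      proof cases
        case 1
        then show ?thesis using a_in[OF e(2,3), of x] x(3) e(1) by (simp add: p_def)
      next
        case (2 j')
        then show ?thesis using b_in[OF e(2,3), of j'] x(3) e(1) by (simp add: p_def)
      qed
      then show "z \<in> p ` e" using x(2) by blast
    next
      fix z assume z: "z \<in> p ` e"
      have "e \<subseteq> {..<6}" using e by auto
      moreover have "z \<in> path_image (g e)" using z unfolding e(1) g[OF e(2)] pe[OF e(2)] using inI[OF e(2,3)] by auto
      ultimately show "z \<in> path_image (g e) \<inter> p ` {..<6}" using z by blast
    qed
  next
    fix e e' assume "e \<in> {{i, j + 3} |i j. i < 3 \<and> j < (3::nat)}" "e' \<in> {{i, j + 3} |i j. i < 3 \<and> j < (3::nat)}"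
      and ne: "e \<noteq> e'"
    then obtain i j i' j' where e: "e = {i, j + 3}" "i < 3" "j < 3" and e': "e' = {i', j' + 3}" "i' < 3" "j' < 3" by blast
    have ne': "(i, j) \<noteq> (i', j')" using ne e e' by auto
    have "e \<inter> e' = (if i = i' then {i} else {}) \<union> (if j = j' then {j + 3} else {})"
      using e e' by auto
    then have "p ` (e \<inter> e') = (if i = i' then {a i} else {}) \<union> (if j = j' then {b j} else {})"
      using e(2) by (auto simp: p_def)
    moreover have "path_image (k i j) \<inter> path_image (k i' j') = (if i = i' then {a i} else {}) \<union> (if j = j' then {b j} else {})"
      using I[OF e(2,3) e'(2,3) ne'] inI[OF e(2,3)] inI[OF e'(2,3)] by (auto split: if_splits)
    ultimately show "path_image (g e) \<inter> path_image (g e') = p ` (e \<inter> e')"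
      unfolding e(1) e'(1) g[OF e(2)] g[OF e'(2)] using e(1) e'(1) by simp
  qed
  then show ?thesis by (simp add: p_def[abs_def] g_def[abs_def])
qed

lemma drawing_K33_torus: "\<exists>p g. drawing_on torus {..<6::nat} {{i, j + 3} |i j. i < 3 \<and> j < 3} p g"
proof -
  obtain p g where d: "drawing_on torus {xs. length xs = 4} (hypercube_edges 4) p g"
    using drawing_hypercube_4 by blast
  \<comment> \<open>The subdivision used in the 5-cube, without its last coordinate.\<close>
  define K where "K = map (map (map (map odd)))
    [[[[0,0,1,1], [1,0,1,1], [1,1,1,1], [1,1,1,0]], [[0,0,1,1], [0,0,1,0]], [[0,0,1,1], [0,0,0,1], [0,0,0,0]]],
     [[[0,1,1,0], [1,1,1,0]], [[0,1,1,0], [0,0,1,0]], [[0,1,1,0], [0,1,0,0], [0,0,0,0]]],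
     [[[1,0,1,0], [1,1,1,0]], [[1,0,1,0], [0,0,1,0]], [[1,0,1,0], [1,0,0,0], [0,0,0,0::nat]]]]"
  have K: "K33_routes hamming_adj K" unfolding K_def by code_simp
  have "\<forall>i\<in>set [0..<3]. \<forall>j\<in>set [0..<3]. \<forall>xs\<in>set (K ! i ! j). length xs = 4"
    unfolding K_def by code_simp
  then have len: "set (K ! i ! j) \<subseteq> {xs. length xs = 4}" if "i < 3" "j < 3" for i j using that by auto
  have E: "{xs, ys} \<in> hypercube_edges 4" if "xs \<in> {xs. length xs = 4}" "ys \<in> {xs. length xs = 4}" "hamming_adj xs ys" for xs ys
    using that unfolding hypercube_edges_def by blast
  have "\<exists>k. K33_arcs (\<lambda>i. p (hd (K ! i ! 0))) (\<lambda>j. p (last (K ! 0 ! j))) k \<and>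
      (\<forall>i<3. \<forall>j<3. path_image (k i j) = route_image g (K ! i ! j))"
    by (rule K33_routes_arcs[OF d K len E]) auto
  then obtain k where k: "K33_arcs (\<lambda>i. p (hd (K ! i ! 0))) (\<lambda>j. p (last (K ! 0 ! j))) k"
    "\<And>i j. i < 3 \<Longrightarrow> j < 3 \<Longrightarrow> path_image (k i j) = route_image g (K ! i ! j)"
    by blast
  have "path_image (k i j) \<subseteq> torus" if "i < 3" "j < 3" for i j
    unfolding k(2)[OF that] by (rule route_image_subset[OF d route_okD(1)[OF K33_routesD(1)[OF K that] len[OF that] E]])
  then show ?thesis using K33_arcs_drawing[OF k(1)] by blast
qed

section \<open>The classification\<close>

lemma hamming_adj_append:
  "length xs = length ys \<Longrightarrow> hamming_adj (xs @ zs) (ys @ zs) \<longleftrightarrow> hamming_adj xs ys"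
proof (induction xs ys rule: list_induct2)
  case Nil
  have "\<not> hamming_adj zs zs" by (induction zs) auto
  then show ?case by simp
qed auto

text \<open>Padding with \<open>False\<close> embeds smaller cubes into larger ones. This is used
  both ways: the 5-cube goes into the interval if the length is at least 5, and the interval goes
  into the 4-cube if the length is at most 4.\<close>

lemma toroidal_hypercube_bruhat:
  assumes \<sigma>: "\<sigma> permutes {1..n}" and av: "avoids_321_3412 \<sigma>"
  shows "toroidal (bruhat_graph n \<sigma>) \<longleftrightarrow> card (inversions \<sigma>) \<le> 4"
proof -
  define m where "m = card (inversions \<sigma>)"
  obtain \<phi> where \<phi>: "bij_betw \<phi> {xs. length xs = m} (bruhat_interval n \<sigma>)"
    and adj: "\<And>xs ys. length xs = m \<Longrightarrow> length ys = m \<Longrightarrow> reflection_adj (\<phi> xs) (\<phi> ys) \<longleftrightarrow> hamming_adj xs ys"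
    using bruhat_interval_hypercube[OF \<sigma> av] unfolding m_def by blast
  have in_I: "\<phi> xs \<in> bruhat_interval n \<sigma>" if "length xs = m" for xs
    using bij_betwE[OF \<phi>] that by blast
  have "\<not> toroidal (bruhat_graph n \<sigma>)" if "5 \<le> m"
  proof (rule hypercube_5_not_toroidal)
    let ?pad = "\<lambda>xs. xs @ replicate (m - 5) False"
    show "inj_on (\<phi> \<circ> ?pad) {xs. length xs = 5}"
    proof (rule comp_inj_on)
      show "inj_on \<phi> (?pad ` {xs. length xs = 5})"
        using that by (intro inj_on_subset[OF bij_betw_imp_inj_on[OF \<phi>]]) auto
    qed (auto simp: inj_on_def)
    show "(\<phi> \<circ> ?pad) ` {xs. length xs = 5} \<subseteq> verts (bruhat_graph n \<sigma>)"
      using in_I that by auto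
    show "{(\<phi> \<circ> ?pad) xs, (\<phi> \<circ> ?pad) ys} \<in> undirected_edges (bruhat_graph n \<sigma>)"
      if "length xs = 5" "length ys = 5" "hamming_adj xs ys" for xs ys
    proof -
      have l: "length (?pad xs) = m" "length (?pad ys) = m" using that \<open>5 \<le> m\<close> by auto
      have "hamming_adj (?pad xs) (?pad ys)" using hamming_adj_append[of xs ys] that by simp
      then have "reflection_adj (\<phi> (?pad xs)) (\<phi> (?pad ys))" using adj[OF l] by blast
      then show ?thesis using in_I[OF l(1)] in_I[OF l(2)] unfolding undirected_edges_bruhat_graph by auto
    qed
  qed
  moreover have "toroidal (bruhat_graph n \<sigma>)" if m: "m \<le> 4"
  proof -
    obtain p g where d: "drawing_on torus {xs. length xs = 4} (hypercube_edges 4) p g"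
      using drawing_hypercube_4 by blast
    define \<psi> where "\<psi> v = inv_into {xs. length xs = m} \<phi> v @ replicate (4 - m) False" for v
    have inv: "length (inv_into {xs. length xs = m} \<phi> v) = m" "\<phi> (inv_into {xs. length xs = m} \<phi> v) = v"
      if "v \<in> bruhat_interval n \<sigma>" for v
    proof -
      have v: "v \<in> \<phi> ` {xs. length xs = m}" using that bij_betw_imp_surj_on[OF \<phi>] by simp
      show "length (inv_into {xs. length xs = m} \<phi> v) = m" using inv_into_into[OF v] by simp
      show "\<phi> (inv_into {xs. length xs = m} \<phi> v) = v" using f_inv_into_f[OF v] .
    qed
    have "drawing_on torus (bruhat_interval n \<sigma>) (undirected_edges (bruhat_graph n \<sigma>)) (p \<circ> \<psi>) (\<lambda>e. g (\<psi> ` e))"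
    proof (rule drawing_on_subgraph[OF d])
      show "inj_on \<psi> (bruhat_interval n \<sigma>)" using inv by (intro inj_onI) (metis \<psi>_def append_same_eq)
      show "\<psi> ` bruhat_interval n \<sigma> \<subseteq> {xs. length xs = 4}" using inv m by (auto simp: \<psi>_def)
      fix e assume "e \<in> undirected_edges (bruhat_graph n \<sigma>)"
      then obtain u v where e: "e = {u, v}" "u \<in> bruhat_interval n \<sigma>" "v \<in> bruhat_interval n \<sigma>" "reflection_adj u v"
        unfolding undirected_edges_bruhat_graph by blast
      have "hamming_adj (\<psi> u) (\<psi> v)"
        using adj[of "inv_into {xs. length xs = m} \<phi> u" "inv_into {xs. length xs = m} \<phi> v"] inv e
          hamming_adj_append[of "inv_into {xs. length xs = m} \<phi> u" "inv_into {xs. length xs = m} \<phi> v"]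
        by (simp add: \<psi>_def)
      moreover have "length (\<psi> u) = 4" "length (\<psi> v) = 4" using inv e m by (auto simp: \<psi>_def)
      ultimately show "e \<subseteq> bruhat_interval n \<sigma> \<and> \<psi> ` e \<in> hypercube_edges 4"
        using e unfolding hypercube_edges_def by auto
    qed
    then show ?thesis unfolding toroidal_def by auto
  qed
  ultimately show ?thesis unfolding m_def[symmetric] by (cases "m \<le> 4") auto
qed

text \<open>The three pairs from {a, b, c} are already all the inversions. Along a descending chain
  from \<open>\<sigma>\<close> only values at these positions get permuted, and no other position
  can form an inversion with them, so the next step stays within {a, b, c} as well.\<close>

lemma bruhat_interval_321:
  assumes \<sigma>: "\<sigma> permutes {1..n}" and abc: "a < b" "b < c" "\<sigma> b < \<sigma> a" "\<sigma> c < \<sigma> b"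
    and len: "card (inversions \<sigma>) = 3" and u: "u \<in> bruhat_interval n \<sigma>"
  shows "\<exists>w. w permutes {a, b, c} \<and> u = \<sigma> \<circ> w"
proof -
  have inj: "inj \<sigma>" using permutes_inj[OF \<sigma>] .
  have sub: "{(a, b), (a, c), (b, c)} \<subseteq> inversions \<sigma>" using abc by (auto simp: inversions_def)
  have c3: "card {(a, b), (a, c), (b, c)} = 3" using abc by simp
  have invs: "inversions \<sigma> = {(a, b), (a, c), (b, c)}"
    using card_seteq[OF finite_inversions[OF \<sigma>] sub] len c3 by simp
  have no_inv: "\<sigma> x < \<sigma> y" if "x < y" "(x, y) \<notin> {(a, b), (a, c), (b, c)}" for x y
  proof -
    have "\<not> \<sigma> y < \<sigma> x" using that unfolding invs[symmetric] by (simp add: inversions_def)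
    moreover have "\<sigma> x \<noteq> \<sigma> y" using that(1) by (simp add: inj_eq[OF inj])
    ultimately show ?thesis by simp
  qed
  \<comment> \<open>Such a position would be in an inversion with \<open>a\<close> or with
    \<open>c\<close>, since \<open>\<sigma> c < \<sigma> a\<close>.\<close>
  have gap: False if "x \<notin> {a, b, c}" "a < x" "x < c" for x
    using no_inv[of a x] no_inv[of x c] that abc by auto
  have "bruhat_le n u \<sigma>" using u by (simp add: bruhat_interval_def)
  then show ?thesis
  proof (induction rule: bruhat_le_induct)
    case refl
    show ?case
    proof (intro exI[of _ id] conjI)
      show "id permutes {a, b, c}" by (rule permutes_id)
    qed (rule comp_id[symmetric])
  next
    case (step u v)
    then obtain w where w: "w permutes {a, b, c}" "v = \<sigma> \<circ> w" by blast
    obtain p q where pq: "p < q" "v q < v p" "u = v \<circ> Transposition.transpose p q"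
      using step(1) unfolding bruhat_step_iff by blast
    have wT: "w x \<in> {a, b, c} \<longleftrightarrow> x \<in> {a, b, c}" for x using permutes_in_image[OF w(1)] .
    have wo: "w x = x" if "x \<notin> {a, b, c}" for x using permutes_not_in[OF w(1) that] .
    have lt: "\<sigma> (w q) < \<sigma> (w p)" using pq(2) w(2) by simp
    have "p \<in> {a, b, c} \<and> q \<in> {a, b, c}"
    proof (rule ccontr)
      assume n: "\<not> ?thesis"
      consider "p \<notin> {a, b, c}" "q \<notin> {a, b, c}" | "p \<notin> {a, b, c}" "q \<in> {a, b, c}" | "p \<in> {a, b, c}" "q \<notin> {a, b, c}"
        using n by blast
      then show False
      proof cases
        case 1
        then have "w p = p" "w q = q" using wo by blast+
        then show False using lt no_inv[OF pq(1)] 1 by auto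
      next
        case 2
        then have p: "w p = p" and q: "w q \<in> {a, b, c}" using wo wT by blast+
        have "\<not> p < w q" using no_inv[of p "w q"] lt p 2 by auto
        moreover have "p \<noteq> w q" using q 2 by auto
        ultimately show False using gap[OF 2(1)] q 2(2) pq(1) abc by auto
      next
        case 3
        then have q: "w q = q" and p: "w p \<in> {a, b, c}" using wo wT by blast+
        have "\<not> w p < q" using no_inv[of "w p" q] lt q 3 by auto
        moreover have "q \<noteq> w p" using p 3 by auto
        ultimately show False using gap[OF 3(2)] p 3(1) pq(1) abc by auto
      qed
    qed
    then have "w \<circ> Transposition.transpose p q permutes {a, b, c}"
      using w(1) by (intro permutes_compose permutes_swap_id) auto
    moreover have "u = \<sigma> \<circ> (w \<circ> Transposition.transpose p q)" using pq(3) w(2) by (simp add: comp_assoc)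
    ultimately show ?case by blast
  qed
qed

lemma card_sign_permutations_3:
  fixes a b c :: 'a
  assumes "a \<noteq> b" "a \<noteq> c" "b \<noteq> c"
  shows "card {w. w permutes {a, b, c} \<and> sign w = 1} = 3" "card {w. w permutes {a, b, c} \<and> sign w = - 1} = 3"
proof -
  let ?P = "{w. w permutes {a, b, c}}"
  let ?E = "{w. w permutes {a, b, c} \<and> sign w = 1}" and ?O = "{w. w permutes {a, b, c} \<and> sign w = - 1}"
  let ?t = "Transposition.transpose a b"
  have fin: "finite ?P" by (rule finite_permutations) simp
  have card: "card ?P = 6"
    using card_permutations[of "{a, b, c}" 3] assms by (simp add: fact_numeral)
  have tp: "?t permutes {a, b, c}" by (rule permutes_swap_id) auto
  have sgn: "sign (w \<circ> ?t) = - sign w" if "w permutes {a, b, c}" for w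
  proof -
    have "permutation w" using permutes_imp_permutation[OF _ that] by simp
    then have "sign (w \<circ> ?t) = sign w * sign ?t" using permutation_swap_id by (rule sign_compose)
    then show ?thesis using assms(1) by (simp add: sign_swap_id)
  qed
  have tt: "w \<circ> ?t \<circ> ?t = w" for w :: "'a \<Rightarrow> 'a" by (rule ext) simp
  have "bij_betw (\<lambda>w. w \<circ> ?t) ?E ?O"
  proof (rule bij_betw_byWitness[where f' = "\<lambda>w. w \<circ> ?t"])
    show "(\<lambda>w. w \<circ> ?t) ` ?E \<subseteq> ?O" "(\<lambda>w. w \<circ> ?t) ` ?O \<subseteq> ?E"
      by (intro image_subsetI; use sgn permutes_compose[OF tp] in force)+
  qed (unfold tt, blast+)
  then have "card ?E = card ?O" by (rule bij_betw_same_card)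
  moreover have "?P = ?E \<union> ?O" by (auto simp: sign_def)
  then have "card (?E \<union> ?O) = 6" using card by (rule subst)
  moreover have "card (?E \<union> ?O) = card ?E + card ?O"
  proof (intro card_Un_disjoint)
    show "finite ?E" "finite ?O" by (rule finite_subset[OF _ fin]; blast)+
    show "?E \<inter> ?O = {}" by auto
  qed
  ultimately show "card ?E = 3" "card ?O = 3" by linarith+
qed

text \<open>A transposition changes the sign, so every edge joins the two sign classes
  \<open>P\<close> and \<open>N\<close>. All elements are \<open>\<sigma> \<circ> w\<close> with
  \<open>w\<close> a permutation of {a, b, c}, so each class has at most three of them and the graph
  embeds into K_{3,3}.\<close>

lemma toroidal_bruhat_321:
  assumes \<sigma>: "\<sigma> permutes {1..n}" and abc: "a < b" "b < c" "\<sigma> b < \<sigma> a" "\<sigma> c < \<sigma> b"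
    and len: "card (inversions \<sigma>) = 3"
  shows "toroidal (bruhat_graph n \<sigma>)"
proof -
  let ?I = "bruhat_interval n \<sigma>"
  define P N where "P = {u \<in> ?I. sign u = sign \<sigma>}" and "N = {u \<in> ?I. sign u = - sign \<sigma>}"
  have perm: "permutation u" if "u permutes S" "finite S" for u :: "nat \<Rightarrow> nat" and S
    using that permutes_imp_permutation by blast
  have rep: "\<exists>w. w permutes {a, b, c} \<and> u = \<sigma> \<circ> w \<and> sign u = sign \<sigma> * sign w" if u: "u \<in> ?I" for u
  proof -
    obtain w where w: "w permutes {a, b, c}" "u = \<sigma> \<circ> w"
      using bruhat_interval_321[OF \<sigma> abc len u] by blast
    then show ?thesis using sign_compose[OF perm[OF \<sigma>] perm[OF w(1)]] by auto
  qed
  have sg: "sign \<sigma> \<noteq> 0" by (simp add: sign_def)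
  have abc': "a \<noteq> b" "a \<noteq> c" "b \<noteq> c" using abc by auto
  note card3 = card_sign_permutations_3[OF abc']
  have fin: "finite {w. w permutes {a, b, c} \<and> Q w}" for Q
    by (rule finite_subset[OF _ finite_permutations[of "{a, b, c}"]]) auto
  have lift: "u \<in> (\<circ>) \<sigma> ` {w. w permutes {a, b, c} \<and> sign w = s}" if u: "u \<in> ?I" "sign u = sign \<sigma> * s" for u s
  proof -
    obtain w where w: "w permutes {a, b, c}" "u = \<sigma> \<circ> w" "sign u = sign \<sigma> * sign w"
      using rep[OF u(1)] by blast
    then have "sign w = s" using u(2) sg by simp
    then show ?thesis using w by blast
  qed
  have "P \<subseteq> (\<circ>) \<sigma> ` {w. w permutes {a, b, c} \<and> sign w = 1}"
    unfolding P_def by (intro subsetI lift) auto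
  then have P: "finite P" "card P \<le> card {..<3::nat}"
    using surj_card_le[OF fin[of "\<lambda>w. sign w = 1"], of P] card3(1) fin[of "\<lambda>w. sign w = 1"]
    by (auto intro: finite_subset)
  have "N \<subseteq> (\<circ>) \<sigma> ` {w. w permutes {a, b, c} \<and> sign w = - 1}"
    unfolding N_def by (intro subsetI lift) auto
  then have N: "finite N" "card N \<le> card {..<3::nat}"
    using surj_card_le[OF fin[of "\<lambda>w. sign w = - 1"], of N] card3(2) fin[of "\<lambda>w. sign w = - 1"]
    by (auto intro: finite_subset)
  have PN: "?I = P \<union> N" "P \<inter> N = {}"
  proof -
    have "sign u = sign \<sigma> \<or> sign u = - sign \<sigma>" for u by (simp add: sign_def)
    then show "?I = P \<union> N" by (auto simp: P_def N_def)
    show "P \<inter> N = {}" using sg by (auto simp: P_def N_def)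
  qed
  obtain \<alpha> where \<alpha>: "\<alpha> ` P \<subseteq> {..<3::nat}" "inj_on \<alpha> P" using card_le_inj[OF P(1) _ P(2)] by auto
  obtain \<beta> where \<beta>: "\<beta> ` N \<subseteq> {..<3::nat}" "inj_on \<beta> N" using card_le_inj[OF N(1) _ N(2)] by auto
  define \<phi> where "\<phi> u = (if u \<in> P then \<alpha> u else \<beta> u + 3)" for u
  have \<phi>P: "\<phi> u = \<alpha> u" "\<phi> u < 3" if "u \<in> P" for u using that \<alpha>(1) by (auto simp: \<phi>_def)
  have \<phi>N: "\<phi> u = \<beta> u + 3" "\<beta> u < 3" if "u \<in> N" for u using that \<beta>(1) PN(2) by (auto simp: \<phi>_def)
  obtain p g where d: "drawing_on torus {..<6::nat} {{i, j + 3} |i j. i < 3 \<and> j < 3} p g"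
    using drawing_K33_torus by blast
  have "drawing_on torus ?I (undirected_edges (bruhat_graph n \<sigma>)) (p \<circ> \<phi>) (\<lambda>e. g (\<phi> ` e))"
  proof (rule drawing_on_subgraph[OF d])
    show "inj_on \<phi> ?I"
    proof (rule inj_onI)
      fix u v assume uv: "u \<in> ?I" "v \<in> ?I" "\<phi> u = \<phi> v"
      then consider "u \<in> P" "v \<in> P" | "u \<in> P" "v \<in> N" | "u \<in> N" "v \<in> P" | "u \<in> N" "v \<in> N" using PN by blast
      then show "u = v"
      proof cases
        case 1
        then show ?thesis using uv(3) \<phi>P inj_onD[OF \<alpha>(2)] by metis
      next
        case 2
        then show ?thesis using uv(3) \<phi>P(2)[of u] \<phi>N(1)[of v] by simp
      next
        case 3
        then show ?thesis using uv(3) \<phi>P(2)[of v] \<phi>N(1)[of u] by simp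
      next
        case 4
        then show ?thesis using uv(3) \<phi>N(1)[of u] \<phi>N(1)[of v] inj_onD[OF \<beta>(2), of u v] by simp
      qed
    qed
    show "\<phi> ` ?I \<subseteq> {..<6}"
    proof (rule image_subsetI)
      fix u assume "u \<in> ?I"
      then consider "u \<in> P" | "u \<in> N" using PN by blast
      then show "\<phi> u \<in> {..<6}" by cases (use \<phi>P(2)[of u] \<phi>N[of u] in auto)
    qed
    fix e assume "e \<in> undirected_edges (bruhat_graph n \<sigma>)"
    then obtain u v where e: "e = {u, v}" "u \<in> ?I" "v \<in> ?I" "reflection_adj u v"
      unfolding undirected_edges_bruhat_graph by blast
    obtain i j where ij: "i \<noteq> j" "u = v \<circ> Transposition.transpose i j"
      using e(4) unfolding reflection_adj_def by blast
    have "permutation v" using e(3) perm[of v "{1..n}"] by (simp add: bruhat_interval_def)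
    then have "sign u = - sign v"
      unfolding ij(2) using ij(1) by (simp add: sign_compose permutation_swap_id sign_swap_id)
    then have "(u \<in> P \<and> v \<in> N) \<or> (u \<in> N \<and> v \<in> P)" using PN(1) e(2,3) by (auto simp: P_def N_def)
    then have "\<exists>i j. \<phi> ` e = {i, j + 3} \<and> i < 3 \<and> j < 3"
    proof
      assume "u \<in> P \<and> v \<in> N"
      then show ?thesis using \<phi>P[of u] \<phi>N[of v] e(1) by (intro exI[of _ "\<phi> u"] exI[of _ "\<beta> v"]) auto
    next
      assume "u \<in> N \<and> v \<in> P"
      then show ?thesis using \<phi>P[of v] \<phi>N[of u] e(1) by (intro exI[of _ "\<phi> v"] exI[of _ "\<beta> u"]) auto
    qed
    then show "e \<subseteq> ?I \<and> \<phi> ` e \<in> {{i, j + 3} |i j. i < 3 \<and> j < 3}" using e by auto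
  qed
  then show ?thesis unfolding toroidal_def by auto
qed

lemma contains_321_iff:
  assumes \<sigma>: "\<sigma> permutes {1..n}"
  shows "contains_pattern n \<sigma> 3 (one_line [3, 2, 1]) \<longleftrightarrow> (\<exists>a b c. a < b \<and> b < c \<and> \<sigma> b < \<sigma> a \<and> \<sigma> c < \<sigma> b)"
proof
  assume "contains_pattern n \<sigma> 3 (one_line [3, 2, 1])"
  then obtain f where f: "strict_mono_on {1..3} f"
    and ord: "\<And>a b. a \<in> {1..3} \<Longrightarrow> b \<in> {1..3} \<Longrightarrow> \<sigma> (f a) < \<sigma> (f b) \<longleftrightarrow> one_line [3, 2, 1] a < one_line [3, 2, 1] b"
    unfolding contains_pattern_def by blast
  have "f 1 < f 2" "f 2 < f 3" using f by (auto simp: strict_mono_on_def)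
  moreover have "\<sigma> (f 2) < \<sigma> (f 1)" "\<sigma> (f 3) < \<sigma> (f 2)" using ord[of 2 1] ord[of 3 2] by (auto simp: one_line_def)
  ultimately show "\<exists>a b c. a < b \<and> b < c \<and> \<sigma> b < \<sigma> a \<and> \<sigma> c < \<sigma> b" by blast
next
  assume "\<exists>a b c. a < b \<and> b < c \<and> \<sigma> b < \<sigma> a \<and> \<sigma> c < \<sigma> b"
  then obtain a b c where abc: "a < b" "b < c" "\<sigma> b < \<sigma> a" "\<sigma> c < \<sigma> b" by blast
  show "contains_pattern n \<sigma> 3 (one_line [3, 2, 1])"
  proof (rule contains_patternI[OF permutes_inj[OF \<sigma>], of "[a, b, c]"])
    show "set [a, b, c] \<subseteq> {1..n}"
      using inversion_range[OF \<sigma> abc(1,3)] inversion_range[OF \<sigma> abc(2,4)] by simp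
    fix i j :: nat assume "j < 3" "i < j"
    then consider "i = 0" "j = 1" | "i = 0" "j = 2" | "i = 1" "j = 2" by linarith
    then show "\<sigma> ([a, b, c] ! i) < \<sigma> ([a, b, c] ! j) \<longleftrightarrow> [3, 2, 1::nat] ! i < [3, 2, 1] ! j"
      by cases (use abc in simp_all)
  qed (use abc in simp_all)
qed

lemma contains_3412I:
  assumes \<sigma>: "\<sigma> permutes {1..n}"
    and l: "a < b" "b < c" "c < d" "\<sigma> c < \<sigma> d" "\<sigma> d < \<sigma> a" "\<sigma> a < \<sigma> b"
  shows "contains_pattern n \<sigma> 4 (one_line [3, 4, 1, 2])"
proof (rule contains_patternI[OF permutes_inj[OF \<sigma>], of "[a, b, c, d]"])
  have "a < c" "\<sigma> c < \<sigma> a" "b < d" "\<sigma> d < \<sigma> b" using l by linarith+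
  then show "set [a, b, c, d] \<subseteq> {1..n}"
    using inversion_range[OF \<sigma> \<open>a < c\<close>] inversion_range[OF \<sigma> \<open>b < d\<close>] by simp
  fix i j :: nat assume "j < 4" "i < j"
  then consider "i = 0" "j = 1" | "i = 0" "j = 2" | "i = 0" "j = 3" | "i = 1" "j = 2" | "i = 1" "j = 3" | "i = 2" "j = 3"
    by linarith
  then show "\<sigma> ([a, b, c, d] ! i) < \<sigma> ([a, b, c, d] ! j) \<longleftrightarrow> [3, 4, 1, 2::nat] ! i < [3, 4, 1, 2] ! j"
    by cases (use l in simp_all)
qed (use l in simp_all)

theorem theorem4p1:
  fixes n :: nat and \<sigma> :: "nat \<Rightarrow> nat"
  assumes "n \<ge> 1" and "\<sigma> permutes {1..n}"
  shows "toroidal (bruhat_graph n \<sigma>) \<longleftrightarrow>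
           avoids_pattern n \<sigma> 4 (one_line [3, 4, 1, 2]) \<and>
           (contains_pattern n \<sigma> 3 (one_line [3, 2, 1]) \<longrightarrow> perm_length n \<sigma> = 3) \<and>
           perm_length n \<sigma> \<le> 4"
proof -
  note \<sigma> = assms(2)
  have not_3412: "avoids_pattern n \<sigma> 4 (one_line [3, 4, 1, 2])" if "toroidal (bruhat_graph n \<sigma>)"
  proof -
    have "sort [3, 4, 1, 2::nat] = [1..<Suc 4]" by code_simp
    then show ?thesis using not_toroidal_pattern[OF \<sigma> _ not_toroidal_bruhat_3412] that by blast
  qed
  show ?thesis
  proof (cases "contains_pattern n \<sigma> 3 (one_line [3, 2, 1])")
    case True
    then obtain a b c where abc: "a < b" "b < c" "\<sigma> b < \<sigma> a" "\<sigma> c < \<sigma> b"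
      using contains_321_iff[OF \<sigma>] by blast
    \<comment> \<open>A 321 alone accounts for three inversions, and a fourth one destroys
      toroidality, so the length is exactly 3.\<close>
    have "card {(a, b), (a, c), (b, c)} \<le> card (inversions \<sigma>)"
      using abc by (intro card_mono finite_inversions[OF \<sigma>]) (auto simp: inversions_def)
    then have "3 \<le> card (inversions \<sigma>)" using abc by simp
    then have "card (inversions \<sigma>) = 3" if "toroidal (bruhat_graph n \<sigma>)"
      using not_toroidal_321_length_4[OF \<sigma> abc] that by linarith
    then show ?thesis
      using True not_3412 toroidal_bruhat_321[OF \<sigma> abc] perm_length_eq_card_inversions[OF \<sigma>] by auto
  next
    case False
    have "avoids_321_3412 \<sigma>" if "avoids_pattern n \<sigma> 4 (one_line [3, 4, 1, 2])"
      unfolding avoids_321_3412_def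
      using False contains_321_iff[OF \<sigma>] contains_3412I[OF \<sigma>] that by blast
    then show ?thesis
      using False not_3412 toroidal_hypercube_bruhat[OF \<sigma>] perm_length_eq_card_inversions[OF \<sigma>] by auto
  qed
qed

end
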